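(* Let $n\in\{3,4\}$ and let $F_0$ be a real-analytic, area-preserving and orientation-preserving map of a neighbourhood of the origin in $\mathbb R^2$ with $F_0(0)=0$ and $DF_0(0)=R_{\alpha_0}$, where $\lambda_0=e^{i\alpha_0}$ satisfies $\lambda_0^n=1$ and $\lambda_0^k\neq 1$ for all integers $1\le k<n$. Suppose that in the complex coordinate $z=x+iy$ the map has the form $$f_0=a(z\bar z)\,z+b(z\bar z)\,\bar z^{\,n-1}+O(|z|^{n+1}),$$ where $a,b$ are polynomials with complex coefficients and $a(0)=\lambda_0$. If $b(0)\neq 0$, then there is a formal canonical change of variables which conjugates $F_0$ with $R_{\alpha_0}\circ\Phi^1_{H_0}$, where the formal Hamiltonian $H_0$ has the form $$H_0(I,\varphi)=I^2A_0(I)+I^{n/2}B_0(I)\cos n\varphi ,$$ where $A_0(I)=\sum_{k\ge 0}a_kI^k$ and $B_0(I)=\sum_{k\ge 0}b_kI^k$ are formal series in $I$ with real coefficients such that - if $n=3$, then $a_k=0$ for $k\equiv 0\pmod 3$ and $b_k=0$ for $k\equiv 2\pmod 3$; - if $n=4$, then $a_k=0$ for $k\equiv 1\pmod 4$ and $b_k=0$ for $k\equiv 3\pmod 4$. The coefficients of the series $A_0$ and $B_0$ are defined uniquely by the map $F_0$ provided the leading order is normalised to ensure $b_0>0$.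
   Context: $R_\alpha$ is the rotation of the plane by the angle $\alpha$, $R_\alpha=\begin{pmatrix}\cos\alpha&-\sin\alpha\\ \sin\alpha&\cos\alpha\end{pmatrix}$. The plane with coordinates $(x,y)$ is identified with the complex plane via $z=x+iy$, $\bar z=x-iy$. Symplectic polar coordinates $(I,\varphi)$ are defined by $x=\sqrt{2I}\cos\varphi$, $y=\sqrt{2I}\sin\varphi$, so $z=\sqrt{2I}e^{i\varphi}$, $z\bar z=2I$, and $I^{n/2}\cos n\varphi=2^{-n/2}\,\mathrm{Re}(z^n)$. Thus a Hamiltonian of the stated form is a real formal power series in $(x,y)$. For a formal power series $H$, $\Phi^t_H$ is the formal Hamiltonian flow generated by $H$ with respect to the area form, with the convention $\dot x=\partial H/\partial y$, $\dot y=-\partial H/\partial x$; $\Phi_H^1$ is the time-one map, understood as a formal power series. A formal canonical change of variables is an invertible pair of real formal power series in $(x,y)$ without constant term whose Jacobian determinant is identically $1$ (formally area-preserving). Conjugation is understood at the level of formal Taylor series at the origin. Any real-analytic area-preserving map with an elliptic fixed point at the origin that is resonant of order $n$ can be brought to the displayed form of $f_0$ by an analytic area-preserving change of variables; the theorem assumes that this has been done. *)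

theory Defs
  imports
    "HOL-Analysis.Analysis"
    "HOL-Library.Landau_Symbols"
    "HOL-Computational_Algebra.Computational_Algebra"
begin

text \<open>
  Formal series in \<open>(x, y)\<close> are series in \<open>y\<close> whose coefficients are series in \<open>x\<close>;
  \<open>coeff2 P i j\<close> is the coefficient of \<open>x\<^sup>i y\<^sup>j\<close>.
\<close>

type_synonym fps2 = "real fps fps"
type_synonym fmap = "fps2 \<times> fps2"

definition coeff2 :: "'a::zero fps fps \<Rightarrow> nat \<Rightarrow> nat \<Rightarrow> 'a" where
  "coeff2 P i j = fps_nth (fps_nth P j) i"

definition mk_fps2 :: "(nat \<Rightarrow> nat \<Rightarrow> 'a) \<Rightarrow> 'a::zero fps fps" where
  "mk_fps2 c = Abs_fps (\<lambda>j. Abs_fps (\<lambda>i. c i j))"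

definition const2 :: "'a::zero \<Rightarrow> 'a fps fps" where
  "const2 c = fps_const (fps_const c)"

definition X2 :: "'a::{zero,one} fps fps" where
  "X2 = fps_const fps_X"

definition Y2 :: "'a::{zero,one} fps fps" where
  "Y2 = fps_X"

definition dX :: "fps2 \<Rightarrow> fps2" where
  "dX P = Abs_fps (\<lambda>j. fps_deriv (fps_nth P j))"

definition dY :: "fps2 \<Rightarrow> fps2" where
  "dY P = fps_deriv P"

text \<open>
  \<open>subst2 P G\<close> is \<open>P(G\<^sub>1(x,y), G\<^sub>2(x,y))\<close>. It is meaningful only when \<open>G\<close> has no constant
  term; then \<open>G\<^sub>1\<^sup>i G\<^sub>2\<^sup>j\<close> starts in total degree \<open>i + j\<close>, so the truncation of the sum
  at \<open>k + l\<close> loses nothing. The same remark applies to \<open>subst1\<close>, which is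
  \<open>A(P(x,y))\<close> for a series \<open>A\<close> in one variable.
\<close>

definition subst2 :: "fps2 \<Rightarrow> fmap \<Rightarrow> fps2" where
  "subst2 P G = mk_fps2 (\<lambda>k l. \<Sum>i\<le>k + l. \<Sum>j\<le>k + l.
     coeff2 P i j * coeff2 (fst G ^ i * snd G ^ j) k l)"

definition subst1 :: "real fps \<Rightarrow> fps2 \<Rightarrow> fps2" where
  "subst1 A P = mk_fps2 (\<lambda>k l. \<Sum>m\<le>k + l. fps_nth A m * coeff2 (P ^ m) k l)"

definition no_const :: "fmap \<Rightarrow> bool" where
  "no_const G \<longleftrightarrow> coeff2 (fst G) 0 0 = 0 \<and> coeff2 (snd G) 0 0 = 0"

definition fid :: fmap where
  "fid = (X2, Y2)"

definition fcomp :: "fmap \<Rightarrow> fmap \<Rightarrow> fmap" where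
  "fcomp F G = (subst2 (fst F) G, subst2 (snd F) G)"

definition fjacobian :: "fmap \<Rightarrow> fps2" where
  "fjacobian G = dX (fst G) * dY (snd G) - dY (fst G) * dX (snd G)"

definition formal_canonical :: "fmap \<Rightarrow> bool" where
  "formal_canonical C \<longleftrightarrow> no_const C \<and> fjacobian C = 1 \<and>
     (\<exists>D. no_const D \<and> fcomp C D = fid \<and> fcomp D C = fid)"

definition formally_conjugate :: "fmap \<Rightarrow> fmap \<Rightarrow> bool" where
  "formally_conjugate F N \<longleftrightarrow> (\<exists>C. formal_canonical C \<and> fcomp C F = fcomp N C)"

text \<open>
  The formal flow of \<open>dx/dt = \<partial>H/\<partial>y\<close>, \<open>dy/dt = - \<partial>H/\<partial>x\<close>, the origin being an equilibrium:
  the differential equation holds coefficient by coefficient.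
\<close>

definition formal_ham_flow :: "fps2 \<Rightarrow> (real \<Rightarrow> fmap) \<Rightarrow> bool" where
  "formal_ham_flow H \<Phi> \<longleftrightarrow> \<Phi> 0 = fid \<and> (\<forall>t. no_const (\<Phi> t)) \<and>
     (\<forall>i j t.
       ((\<lambda>s. coeff2 (fst (\<Phi> s)) i j) has_real_derivative coeff2 (subst2 (dY H) (\<Phi> t)) i j) (at t) \<and>
       ((\<lambda>s. coeff2 (snd (\<Phi> s)) i j) has_real_derivative - coeff2 (subst2 (dX H) (\<Phi> t)) i j) (at t))"

definition time_one_map :: "fps2 \<Rightarrow> fmap \<Rightarrow> bool" where
  "time_one_map H G \<longleftrightarrow> (\<exists>\<Phi>. formal_ham_flow H \<Phi> \<and> G = \<Phi> 1)"

definition frotation :: "real \<Rightarrow> fmap" where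
  "frotation \<alpha> = (const2 (cos \<alpha>) * X2 - const2 (sin \<alpha>) * Y2,
                  const2 (sin \<alpha>) * X2 + const2 (cos \<alpha>) * Y2)"

text \<open>
  In symplectic polar coordinates \<open>x + \<i>y = sqrt (2I) e\<^sup>i\<^sup>\<phi>\<close>, so \<open>I = (x\<^sup>2 + y\<^sup>2)/2\<close> and
  \<open>I\<^bsup>n/2\<^esup> cos n\<phi> = 2\<^bsup>-n/2\<^esup> Re ((x + \<i>y)\<^sup>n)\<close>.
\<close>

definition action2 :: fps2 where
  "action2 = const2 (1 / 2) * (X2 ^ 2 + Y2 ^ 2)"

definition resonant_term :: "nat \<Rightarrow> fps2" where
  "resonant_term n = const2 (2 powr (- real n / 2)) *
     mk_fps2 (\<lambda>i j. Re (coeff2 ((X2 + const2 \<i> * Y2) ^ n) i j))"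

definition nf_hamiltonian :: "nat \<Rightarrow> real fps \<Rightarrow> real fps \<Rightarrow> fps2" where
  "nf_hamiltonian n A B =
     action2 ^ 2 * subst1 A action2 + resonant_term n * subst1 B action2"

definition nf_coeffs :: "nat \<Rightarrow> real fps \<Rightarrow> real fps \<Rightarrow> bool" where
  "nf_coeffs n A B \<longleftrightarrow>
     (n = 3 \<longrightarrow> (\<forall>k. (k mod 3 = 0 \<longrightarrow> fps_nth A k = 0) \<and> (k mod 3 = 2 \<longrightarrow> fps_nth B k = 0))) \<and>
     (n = 4 \<longrightarrow> (\<forall>k. (k mod 4 = 1 \<longrightarrow> fps_nth A k = 0) \<and> (k mod 4 = 3 \<longrightarrow> fps_nth B k = 0)))"

definition is_normal_form :: "nat \<Rightarrow> real \<Rightarrow> fmap \<Rightarrow> real fps \<Rightarrow> real fps \<Rightarrow> bool" where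
  "is_normal_form n \<alpha> T A B \<longleftrightarrow> nf_coeffs n A B \<and>
     (\<exists>G. time_one_map (nf_hamiltonian n A B) G \<and>
          formally_conjugate T (fcomp (frotation \<alpha>) G))"

definition has_power_series_at :: "(real^2 \<Rightarrow> real) \<Rightarrow> fps2 \<Rightarrow> real^2 \<Rightarrow> bool" where
  "has_power_series_at f P p \<longleftrightarrow> (\<exists>r>0. \<forall>v. norm v < r \<longrightarrow>
     ((\<lambda>(i, j). coeff2 P i j * (v $ 1) ^ i * (v $ 2) ^ j) has_sum f (p + v)) UNIV)"

definition real_analytic_on :: "(real^2 \<Rightarrow> real^2) \<Rightarrow> (real^2) set \<Rightarrow> bool" where
  "real_analytic_on F U \<longleftrightarrow> (\<forall>p\<in>U. \<forall>m. \<exists>P. has_power_series_at (\<lambda>v. F v $ m) P p)"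

definition taylor_at_0 :: "(real^2 \<Rightarrow> real^2) \<Rightarrow> fmap \<Rightarrow> bool" where
  "taylor_at_0 F T \<longleftrightarrow> has_power_series_at (\<lambda>v. F v $ 1) (fst T) 0 \<and>
                       has_power_series_at (\<lambda>v. F v $ 2) (snd T) 0"

text \<open>
  Preservation of the area form \<open>dx \<and> dy\<close>, i.e. of area and of orientation.
\<close>

definition area_orientation_preserving_on :: "(real^2 \<Rightarrow> real^2) \<Rightarrow> (real^2) set \<Rightarrow> bool" where
  "area_orientation_preserving_on F U \<longleftrightarrow>
     (\<forall>p\<in>U. \<exists>J :: real^2^2. (F has_derivative (\<lambda>h. J *v h)) (at p) \<and> det J = 1)"

definition rotation :: "real \<Rightarrow> real^2^2" where
  "rotation \<alpha> = vector [vector [cos \<alpha>, - sin \<alpha>], vector [sin \<alpha>, cos \<alpha>]]"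

definition cplx :: "real^2 \<Rightarrow> complex" where
  "cplx v = Complex (v $ 1) (v $ 2)"

end

theory Submission
  imports Defs
begin

text \<open>
  A formal map close to the identity is a Lie series \<open>exp (ad H)\<close>: the lowest-order deviation of an
  area-preserving map from the identity is a Hamiltonian vector field, and composing with the flow
  of a homogeneous \<open>\<chi>\<close> adds \<open>\<chi> \<circ> R - \<chi>\<close> to it in its own degree. This removes all
  non-resonant terms. On resonant terms it vanishes, and the first effect of \<open>\<chi>\<close> is
  the bracket with the leading part of \<open>H\<close>, which is \<open>h = b\<^sub>0 Re z\<^sup>3\<close> for \<open>n = 3\<close> and
  \<open>h = a\<^sub>0 |z|\<^sup>4 + b\<^sub>0 Re z\<^sup>4\<close> for \<open>n = 4\<close> (up to constants). In the
  monomials \<open>z\<^sup>i w\<^sup>j\<close>, \<open>w\<close> conjugate to \<open>z\<close>, this homological operator is a three-term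
  recursion; a sign argument shows that its image is complementary to the terms kept in the normal
  form, while its kernel is spanned by the powers of \<open>h\<close>. Existence follows by normalising degree by degree.

  For uniqueness, the \<open>n\<close>-th iterate is free of the rotation, so that a conjugacy \<open>C\<close> of two normal
  forms commutes with the rotation and carries one Hamiltonian into the other. Composing \<open>C\<close> with flows of
  powers of the Hamiltonian, which preserve it, pushes \<open>C\<close> to the identity to any
  order without changing the normal forms, and the complementarity above makes the two Hamiltonians equal.
\<close>

subsection \<open>Coefficients and the total-degree filtration\<close>

text \<open>The missing coefficients come from a free top value. The real and imaginary parts of the
  resonant coefficients of a generator of degree \<open>m\<close> obey the same recursion, whose top
  value is free exactly when \<open>m = n J\<close>. In the real part this freedom is the kernel
  \<open>h^J\<close>, the source of non-unique conjugacies. In the imaginary part, where the entry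
  of index 0 must be 0, it is a parameter that removes one more coefficient: a diagonal one for odd
  \<open>J\<close>, one of a cosine term for even \<open>J\<close>. In powers of \<open>I\<close>
  these are the congruences modulo 3 and 4. For \<open>n = 4\<close> the ratio of the two leading
  coefficients is arbitrary, which is why signs are followed instead of explicit solutions. The
  second difficulty is a mismatch of degrees: terms of degree \<open>d + 1\<close> are removed by
  non-resonant generators of that degree, but by resonant ones of degree \<open>d + 3 - n\<close>.
  Maps are therefore studied through their substitution operators, which can be added and compared
  by the degrees they gain. Convergence serves only to turn the hypotheses on the analytic map into
  identities for its Taylor series.\<close>

lemma coeff2_0 [simp]: "coeff2 0 i j = 0"
  by (simp add: coeff2_def)

lemma coeff2_add [simp]:
  fixes P Q :: "'a::comm_ring_1 fps fps"
  shows "coeff2 (P + Q) i j = coeff2 P i j + coeff2 Q i j"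
  by (simp add: coeff2_def)

lemma coeff2_diff [simp]:
  fixes P Q :: "'a::comm_ring_1 fps fps"
  shows "coeff2 (P - Q) i j = coeff2 P i j - coeff2 Q i j"
  by (simp add: coeff2_def)

lemma coeff2_uminus [simp]:
  fixes P :: "'a::comm_ring_1 fps fps"
  shows "coeff2 (- P) i j = - coeff2 P i j"
  by (simp add: coeff2_def)

lemma coeff2_sum [simp]:
  fixes P :: "'b \<Rightarrow> 'a::comm_ring_1 fps fps"
  shows "coeff2 (\<Sum>x\<in>S. P x) i j = (\<Sum>x\<in>S. coeff2 (P x) i j)"
  by (induction S rule: infinite_finite_induct) auto

lemma coeff2_mk [simp]: "coeff2 (mk_fps2 c) i j = c i j"
  by (simp add: coeff2_def mk_fps2_def)

lemma fps2_eqI: "(\<And>i j. coeff2 P i j = coeff2 Q i j) \<Longrightarrow> P = Q"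
  by (simp add: coeff2_def fps_ext)

lemma coeff2_1:
  "coeff2 (1 :: 'a::comm_ring_1 fps fps) i j = (if i = 0 \<and> j = 0 then 1 else 0)"
  by (simp add: coeff2_def fps_one_nth)

lemma coeff2_mult:
  fixes P Q :: "'a::comm_ring_1 fps fps"
  shows "coeff2 (P * Q) i j =
    (\<Sum>a\<le>i. \<Sum>b\<le>j. coeff2 P a b * coeff2 Q (i - a) (j - b))"
proof -
  have "coeff2 (P * Q) i j = (\<Sum>b\<le>j. \<Sum>a\<le>i. coeff2 P a b * coeff2 Q (i - a) (j - b))"
    by (simp add: coeff2_def fps_mult_nth fps_sum_nth atLeast0AtMost)
  then show ?thesis
    by (subst sum.swap)
qed

lemma coeff2_const_mult [simp]:
  fixes P :: "'a::comm_ring_1 fps fps"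
  shows "coeff2 (const2 c * P) i j = c * coeff2 P i j"
  by (simp add: coeff2_def const2_def)

lemma coeff2_X_mult:
  fixes P :: "'a::comm_ring_1 fps fps"
  shows "coeff2 (X2 * P) i j = (if i = 0 then 0 else coeff2 P (i - 1) j)"
  by (simp add: coeff2_def X2_def)

lemma coeff2_Y_mult:
  fixes P :: "'a::comm_ring_1 fps fps"
  shows "coeff2 (Y2 * P) i j = (if j = 0 then 0 else coeff2 P i (j - 1))"
  by (simp add: coeff2_def Y2_def)

lemma coeff2_X_power_mult:
  fixes P :: "'a::comm_ring_1 fps fps"
  shows "coeff2 (X2 ^ a * P) i j = (if i < a then 0 else coeff2 P (i - a) j)"
proof (induction a arbitrary: i)
  case (Suc a)
  show ?case
    by (auto simp: mult.assoc coeff2_X_mult Suc.IH)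
qed simp

lemma coeff2_Y_power_mult:
  fixes P :: "'a::comm_ring_1 fps fps"
  shows "coeff2 (Y2 ^ b * P) i j = (if j < b then 0 else coeff2 P i (j - b))"
proof (induction b arbitrary: j)
  case (Suc b)
  show ?case
    by (auto simp: mult.assoc coeff2_Y_mult Suc.IH)
qed simp

definition mono2 :: "'a::comm_ring_1 \<Rightarrow> nat \<Rightarrow> nat \<Rightarrow> 'a fps fps" where
  "mono2 c i j = const2 c * (X2 ^ i * Y2 ^ j)"

lemma coeff2_mono2: "coeff2 (mono2 c i j) k l = (if k = i \<and> l = j then c else 0)"
proof -
  have "coeff2 (X2 ^ i * (Y2 ^ j * 1)) k l = (if k = i \<and> l = j then 1 else (0::'a))"
    unfolding coeff2_X_power_mult coeff2_Y_power_mult coeff2_1 by auto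
  then show ?thesis
    by (auto simp: mono2_def)
qed

lemma const2_simps [simp]:
  "const2 (0::'a::comm_ring_1) = 0" "const2 (1::'a) = 1"
  "const2 ((c::'a) + d) = const2 c + const2 d" "const2 (c * d) = const2 c * const2 d"
  "const2 (- c) = - const2 c" "const2 (c - d) = const2 c - const2 d"
  by (simp_all add: const2_def)

lemma const2_mult_mult: "const2 c * (const2 d * P) = const2 (c * d :: 'a::comm_ring_1) * P"
  by (simp add: mult.assoc)

lemma const2_power [simp]: "const2 ((c::'a::comm_ring_1) ^ k) = const2 c ^ k"
  by (induction k) auto

lemma mono2_mult: "mono2 c i j * mono2 d k l = mono2 (c * d) (i + k) (j + l)"
  by (simp add: mono2_def power_add algebra_simps)

lemma coeff2_mult_mono2:
  "coeff2 (P * mono2 c a b) i j = (if a \<le> i \<and> b \<le> j then c * coeff2 P (i - a) (j - b) else 0)"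
proof -
  have "P * mono2 c a b = const2 c * (X2 ^ a * (Y2 ^ b * P))"
    by (simp add: mono2_def mult_ac)
  then show ?thesis
    by (simp only: coeff2_const_mult coeff2_X_power_mult coeff2_Y_power_mult) auto
qed

lemma X2_eq_mono2: "X2 = mono2 1 1 0" and Y2_eq_mono2: "Y2 = mono2 1 0 1"
  and const2_eq_mono2: "const2 c = mono2 c 0 0"
  by (simp_all add: mono2_def)

lemma coeff2_X2: "coeff2 (X2::'a::comm_ring_1 fps fps) i j = (if i = 1 \<and> j = 0 then 1 else 0)"
  and coeff2_Y2: "coeff2 (Y2::'a::comm_ring_1 fps fps) i j = (if i = 0 \<and> j = 1 then 1 else 0)"
  and coeff2_const2: "coeff2 (const2 (c::'a)) i j = (if i = 0 \<and> j = 0 then c else 0)"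
  by (simp_all only: X2_eq_mono2 Y2_eq_mono2 const2_eq_mono2 coeff2_mono2)

text \<open>Membership in the \<open>k\<close>-th power of the ideal generated by \<open>x\<close>
  and \<open>y\<close>; it takes the place of an estimate of order \<open>k\<close> at the
  origin.\<close>

definition vanish :: "nat \<Rightarrow> 'a::comm_ring_1 fps fps \<Rightarrow> bool" where
  "vanish k P \<longleftrightarrow> (\<forall>i j. i + j < k \<longrightarrow> coeff2 P i j = 0)"

lemma vanishD: "vanish k P \<Longrightarrow> i + j < k \<Longrightarrow> coeff2 P i j = 0"
  by (simp add: vanish_def)

lemma vanishI: "(\<And>i j. i + j < k \<Longrightarrow> coeff2 P i j = 0) \<Longrightarrow> vanish k P"
  by (simp add: vanish_def)

lemma vanish_0 [simp]: "vanish 0 P" and vanish_zero [simp]: "vanish k 0"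
  by (simp_all add: vanish_def)

lemma vanish_add: "vanish k P \<Longrightarrow> vanish k Q \<Longrightarrow> vanish k (P + Q)"
  and vanish_diff: "vanish k P \<Longrightarrow> vanish k Q \<Longrightarrow> vanish k (P - Q)"
  and vanish_uminus: "vanish k P \<Longrightarrow> vanish k (- P)"
  by (simp_all add: vanish_def)

lemma vanish_sum: "(\<And>x. x \<in> S \<Longrightarrow> vanish k (P x)) \<Longrightarrow> vanish k (\<Sum>x\<in>S. P x)"
  by (simp add: vanish_def)

lemma vanish_mono: "vanish k P \<Longrightarrow> l \<le> k \<Longrightarrow> vanish l P"
  by (simp add: vanish_def)

lemma vanish_all: "(\<And>k. vanish k P) \<Longrightarrow> P = 0"
  by (rule fps2_eqI) (metis coeff2_0 less_add_one vanishD)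

lemma vanish_mult:
  assumes "vanish k P" "vanish l Q"
  shows "vanish (k + l) (P * Q)"
proof (rule vanishI)
  fix i j :: nat assume ij: "i + j < k + l"
  have "coeff2 P a b * coeff2 Q (i - a) (j - b) = 0" if "a \<le> i" "b \<le> j" for a b
  proof (cases "a + b < k")
    case True
    then show ?thesis using assms(1) by (simp add: vanishD)
  next
    case False
    then have "(i - a) + (j - b) < l" using that ij by linarith
    then show ?thesis using assms(2) by (simp add: vanishD)
  qed
  then show "coeff2 (P * Q) i j = 0"
    unfolding coeff2_mult by (intro sum.neutral ballI) auto
qed

lemma vanish_mult_left: "vanish k P \<Longrightarrow> vanish k (P * Q)"
  and vanish_mult_right: "vanish k P \<Longrightarrow> vanish k (Q * P)"
  by (metis add.right_neutral vanish_0 vanish_mult, metis add_0 vanish_0 vanish_mult)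

lemma vanish_power: "vanish k P \<Longrightarrow> vanish (i * k) (P ^ i)"
  by (induction i) (simp_all add: vanish_mult)

lemma vanish_const2_mult: "vanish k P \<Longrightarrow> vanish k (const2 c * P)"
  by (simp add: vanish_def)

lemma vanish_mono2: "k \<le> i + j \<Longrightarrow> vanish k (mono2 c i j)"
  by (auto simp: vanish_def coeff2_mono2)

lemma vanish_X2: "vanish 1 X2" and vanish_Y2: "vanish 1 Y2"
  by (simp_all add: X2_eq_mono2 Y2_eq_mono2 vanish_mono2)

lemma vanish_diff_trans: "vanish k (P - Q) \<Longrightarrow> vanish k (Q - R) \<Longrightarrow> vanish k (P - R)"
  and vanish_diff_sym: "vanish k (P - Q) \<Longrightarrow> vanish k (Q - P)"
  by (simp_all add: vanish_def)

lemma vanish_diff_iff: "vanish k (P - Q) \<Longrightarrow> vanish k P \<longleftrightarrow> vanish k Q"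
  by (simp add: vanish_def)

text \<open>The errors are counted relative to the orders \<open>p\<close>, \<open>q\<close> of the
  factors, so that the gain \<open>k\<close> is the same for the product; only one factor is
  exchanged at a time.\<close>

lemma vanish_mult_diff:
  fixes P Q :: "'a::comm_ring_1 fps fps"
  assumes "vanish (k + p) (P - P')" "vanish (k + q) (Q - Q')" "vanish p P" "vanish q Q'"
  shows "vanish (k + p + q) (P * Q - P' * Q')"
proof -
  have eq: "P * Q - P' * Q' = P * (Q - Q') + (P - P') * Q'"
    by (simp add: algebra_simps)
  have "vanish (k + p + q) (P * (Q - Q'))"
    using vanish_mult [OF assms(3,2)] by (simp only: add.assoc add.left_commute [of p])
  moreover have "vanish (k + p + q) ((P - P') * Q')"
    by (rule vanish_mult [OF assms(1,4)])
  ultimately show ?thesis unfolding eq by (rule vanish_add)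
qed

lemma vanish_power_diff:
  fixes P Q :: "'a::comm_ring_1 fps fps"
  assumes "vanish (k + 1) (P - Q)" "vanish 1 P" "vanish 1 Q"
  shows "vanish (k + i) (P ^ i - Q ^ i)"
proof (induction i)
  case (Suc i)
  have "vanish i (Q ^ i)" using vanish_power [OF assms(3), of i] by simp
  from vanish_mult_diff [OF assms(1) Suc.IH assms(2) this]
  show ?case by simp
qed simp

subsection \<open>Additive continuous maps are determined on monomials\<close>

text \<open>Additivity is asked for instead of linearity, so that conjugation of coefficients and
  the passage from real to complex coefficients are covered. The second clause is continuity at 0 in
  the topology given by \<open>vanish\<close>.\<close>

definition fcont :: "('a::comm_ring_1 fps fps \<Rightarrow> 'b::comm_ring_1 fps fps) \<Rightarrow> bool" where
  "fcont f \<longleftrightarrow> (\<forall>P Q. f (P + Q) = f P + f Q) \<and> (\<forall>k. \<exists>m. \<forall>P. vanish m P \<longrightarrow> vanish k (f P))"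

lemma fcontI:
  assumes "\<And>P Q. f (P + Q) = f P + f Q" "\<And>k P. vanish (k + m) P \<Longrightarrow> vanish k (f P)"
  shows "fcont f"
  using assms unfolding fcont_def by blast

lemma fcont_add: "fcont f \<Longrightarrow> f (P + Q) = f P + f Q"
  by (simp add: fcont_def)

lemma fcont_zero: "fcont f \<Longrightarrow> f 0 = 0"
  by (metis add_cancel_right_right fcont_add)

lemma fcont_diff: "fcont f \<Longrightarrow> f (P - Q) = f P - f Q"
  using fcont_add [of f "P - Q" Q] by simp

lemma fcont_uminus: "fcont f \<Longrightarrow> f (- P) = - f P"
  using fcont_diff [of f 0 P] by (simp add: fcont_zero)

lemma fcont_sum: "fcont f \<Longrightarrow> f (\<Sum>x\<in>S. P x) = (\<Sum>x\<in>S. f (P x))"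
  by (induction S rule: infinite_finite_induct) (auto simp: fcont_add fcont_zero)

definition trunc2 :: "nat \<Rightarrow> 'a::comm_ring_1 fps fps \<Rightarrow> 'a fps fps" where
  "trunc2 m P = (\<Sum>i<m. \<Sum>j<m. mono2 (coeff2 P i j) i j)"

lemma vanish_diff_trunc2: "vanish m (P - trunc2 m P)"
proof (rule vanishI)
  fix i j :: nat assume ij: "i + j < m"
  have "coeff2 (trunc2 m P) i j = (\<Sum>a<m. \<Sum>b<m. if i = a \<and> j = b then coeff2 P a b else 0)"
    by (simp add: trunc2_def coeff2_mono2)
  also have "\<dots> = (\<Sum>a<m. if i = a then \<Sum>b<m. if j = b then coeff2 P a b else 0 else 0)"
    by (intro sum.cong) auto
  also have "\<dots> = coeff2 P i j"
    using ij by (simp add: sum.delta)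
  finally show "coeff2 (P - trunc2 m P) i j = 0" by simp
qed

lemma fcont_eqI:
  fixes f g :: "'a::comm_ring_1 fps fps \<Rightarrow> 'b::comm_ring_1 fps fps"
  assumes f: "fcont f" and g: "fcont g"
    and eq: "\<And>c i j. f (mono2 c i j) = g (mono2 c i j)"
  shows "f P = g P"
proof -
  have "vanish k (f P - g P)" for k
  proof -
    obtain m1 where m1: "\<And>P. vanish m1 P \<Longrightarrow> vanish k (f P)"
      using f unfolding fcont_def by blast
    obtain m2 where m2: "\<And>P. vanish m2 P \<Longrightarrow> vanish k (g P)"
      using g unfolding fcont_def by blast
    define m where "m = max m1 m2"
    define t where "t = trunc2 m P"
    have v: "vanish m (P - t)" by (simp add: t_def vanish_diff_trunc2)
    have "vanish k (f (P - t))" "vanish k (g (P - t))"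
      using v m1 m2 by (simp_all add: m_def vanish_mono)
    moreover have "f t = g t"
      by (simp add: t_def trunc2_def fcont_sum f g eq)
    moreover have "f P - g P = (f (P - t) + f t) - (g (P - t) + g t)"
      by (simp add: fcont_add [OF f, symmetric] fcont_add [OF g, symmetric])
    ultimately show ?thesis by (simp add: vanish_diff)
  qed
  then show ?thesis using vanish_all by fastforce
qed

lemma fcont_compose:
  assumes "fcont f" "fcont g"
  shows "fcont (\<lambda>P. f (g P))"
  unfolding fcont_def
proof (intro conjI allI)
  fix k
  obtain m1 where m1: "\<And>P. vanish m1 P \<Longrightarrow> vanish k (f P)"
    using assms(1) unfolding fcont_def by blast
  obtain m2 where m2: "\<And>P. vanish m2 P \<Longrightarrow> vanish m1 (g P)"
    using assms(2) unfolding fcont_def by blast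
  show "\<exists>m. \<forall>P. vanish m P \<longrightarrow> vanish k (f (g P))" using m1 m2 by blast
qed (use assms in \<open>simp add: fcont_add\<close>)

lemma fcont_plus:
  assumes "fcont f" "fcont g"
  shows "fcont (\<lambda>P. f P + g P)"
  unfolding fcont_def
proof (intro conjI allI)
  fix k
  obtain m1 where m1: "\<And>P. vanish m1 P \<Longrightarrow> vanish k (f P)"
    using assms(1) unfolding fcont_def by blast
  obtain m2 where m2: "\<And>P. vanish m2 P \<Longrightarrow> vanish k (g P)"
    using assms(2) unfolding fcont_def by blast
  show "\<exists>m. \<forall>P. vanish m P \<longrightarrow> vanish k (f P + g P)"
    by (rule exI [of _ "max m1 m2"]) (auto intro!: vanish_add m1 m2 intro: vanish_mono)
qed (use assms in \<open>simp add: fcont_add\<close>)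

lemma fcont_id: "fcont (\<lambda>P. P)"
  by (rule fcontI [of _ 0]) simp_all

lemma fcont_mult_left: "fcont (\<lambda>P. Q * P)" and fcont_mult_right: "fcont (\<lambda>P. P * Q)"
  by (rule fcontI [of _ 0]; simp add: algebra_simps vanish_mult_left vanish_mult_right)+

subsection \<open>Formal substitution\<close>

text \<open>\<open>subst2\<close> for any coefficient ring: the same calculus serves the complex
  coordinates below.\<close>

definition gsubst2 :: "'a::comm_ring_1 fps fps \<Rightarrow> 'a fps fps \<times> 'a fps fps \<Rightarrow> 'a fps fps" where
  "gsubst2 P G = mk_fps2 (\<lambda>k l. \<Sum>i\<le>k + l. \<Sum>j\<le>k + l.
     coeff2 P i j * coeff2 (fst G ^ i * snd G ^ j) k l)"

lemma subst2_eq_gsubst2: "subst2 = gsubst2"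
  by (intro ext) (simp add: subst2_def gsubst2_def)

definition nc :: "'a::comm_ring_1 fps fps \<times> 'a fps fps \<Rightarrow> bool" where
  "nc G \<longleftrightarrow> vanish 1 (fst G) \<and> vanish 1 (snd G)"

lemma no_const_eq_nc: "no_const G \<longleftrightarrow> nc G"
  by (simp add: no_const_def nc_def vanish_def)

lemma nc_monomial:
  assumes "nc G" shows "vanish (i + j) (fst G ^ i * snd G ^ j)"
  using vanish_mult [OF vanish_power vanish_power, of 1 "fst G" 1 "snd G" i j] assms
  by (simp add: nc_def)

lemma nc_id [simp]: "nc (X2, Y2)"
  unfolding nc_def by (simp only: vanish_X2 vanish_Y2 fst_conv snd_conv)

lemma gsubst2_add: "gsubst2 (P + Q) G = gsubst2 P G + gsubst2 Q G"
  by (rule fps2_eqI) (simp add: gsubst2_def algebra_simps sum.distrib)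

lemma vanish_gsubst2:
  assumes G: "nc G" and P: "vanish k P"
  shows "vanish k (gsubst2 P G)"
proof (rule vanishI)
  fix a b :: nat assume ab: "a + b < k"
  have "coeff2 P i j * coeff2 (fst G ^ i * snd G ^ j) a b = 0" for i j
    using ab vanishD [OF P, of i j] vanishD [OF nc_monomial [OF G, of i j], of a b]
    by (cases "i + j < k") auto
  then show "coeff2 (gsubst2 P G) a b = 0"
    by (simp add: gsubst2_def)
qed

lemma fcont_gsubst2: "nc G \<Longrightarrow> fcont (\<lambda>P. gsubst2 P G)"
  by (rule fcontI [of _ 0]) (auto simp: gsubst2_add vanish_gsubst2)

lemmas gsubst2_diff = fcont_diff [OF fcont_gsubst2]
lemmas gsubst2_uminus = fcont_uminus [OF fcont_gsubst2]
lemmas gsubst2_zero = fcont_zero [OF fcont_gsubst2]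

lemma gsubst2_mono2:
  assumes "nc G"
  shows "gsubst2 (mono2 c i j) G = const2 c * (fst G ^ i * snd G ^ j)"
proof (rule fps2_eqI)
  fix k l
  have "coeff2 (gsubst2 (mono2 c i j) G) k l =
      (\<Sum>a\<le>k + l. \<Sum>b\<le>k + l. if a = i \<and> b = j then c * coeff2 (fst G ^ i * snd G ^ j) k l else 0)"
    unfolding gsubst2_def coeff2_mk coeff2_mono2 by (intro sum.cong) auto
  also have "\<dots> = (\<Sum>a\<le>k + l. if a = i then \<Sum>b\<le>k + l. if b = j
      then c * coeff2 (fst G ^ i * snd G ^ j) k l else 0 else 0)"
    by (intro sum.cong) auto
  also have "\<dots> = (if i \<le> k + l \<and> j \<le> k + l then c * coeff2 (fst G ^ i * snd G ^ j) k l else 0)"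
    by (simp add: sum.delta)
  also have "\<dots> = c * coeff2 (fst G ^ i * snd G ^ j) k l"
    using vanishD [OF nc_monomial [OF assms, of i j], of k l] by auto
  finally show "coeff2 (gsubst2 (mono2 c i j) G) k l =
      coeff2 (const2 c * (fst G ^ i * snd G ^ j)) k l" by simp
qed

lemma gsubst2_mult:
  assumes "nc G"
  shows "gsubst2 (P * Q) G = gsubst2 P G * gsubst2 Q G"
proof -
  note S = fcont_gsubst2 [OF assms]
  have 1: "gsubst2 (mono2 c i j * Q) G = gsubst2 (mono2 c i j) G * gsubst2 Q G" for c i j Q
  proof (rule fcont_eqI [of "\<lambda>Q. gsubst2 (mono2 c i j * Q) G" "\<lambda>Q. gsubst2 (mono2 c i j) G * gsubst2 Q G"])
    fix d k l
    show "gsubst2 (mono2 c i j * mono2 d k l) G = gsubst2 (mono2 c i j) G * gsubst2 (mono2 d k l) G"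
      by (simp add: mono2_mult gsubst2_mono2 [OF assms] power_add mult_ac)
  qed (intro fcont_compose [OF S fcont_mult_left] fcont_compose [OF fcont_mult_left S])+
  show ?thesis
    by (rule fcont_eqI [of "\<lambda>P. gsubst2 (P * Q) G"])
       (auto intro: fcont_compose [OF S fcont_mult_right] fcont_compose [OF fcont_mult_right S]
         simp: 1)
qed

lemma gsubst2_basic:
  assumes "nc G"
  shows "gsubst2 X2 G = fst G" "gsubst2 Y2 G = snd G" "gsubst2 (const2 c) G = const2 c"
    "gsubst2 1 G = 1"
  using gsubst2_mono2 [OF assms, of 1 1 0] gsubst2_mono2 [OF assms, of 1 0 1]
    gsubst2_mono2 [OF assms, of c 0 0] gsubst2_mono2 [OF assms, of 1 0 0]
  by (simp_all add: mono2_def)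

lemma gsubst2_const_mult:
  assumes "nc G"
  shows "gsubst2 (const2 c * P) G = const2 c * gsubst2 P G"
  by (simp add: gsubst2_mult gsubst2_basic assms)

lemma gsubst2_power: "nc G \<Longrightarrow> gsubst2 (P ^ k) G = gsubst2 P G ^ k"
  by (induction k) (auto simp: gsubst2_basic gsubst2_mult)

lemma gsubst2_id [simp]: "gsubst2 P (X2, Y2) = P"
  by (rule fcont_eqI [of "\<lambda>P. gsubst2 P (X2, Y2)"])
     (auto simp: fcont_gsubst2 fcont_id gsubst2_mono2, simp add: mono2_def)

definition gcomp :: "'a::comm_ring_1 fps fps \<times> 'a fps fps \<Rightarrow> 'a fps fps \<times> 'a fps fps \<Rightarrow>
    'a fps fps \<times> 'a fps fps" where
  "gcomp F G = (gsubst2 (fst F) G, gsubst2 (snd F) G)"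

lemma fcomp_eq_gcomp: "fcomp = gcomp"
  by (intro ext) (simp add: fcomp_def gcomp_def subst2_eq_gsubst2)

lemma nc_gcomp: "nc F \<Longrightarrow> nc G \<Longrightarrow> nc (gcomp F G)"
  by (simp add: gcomp_def nc_def [of F] nc_def [of "(_, _)"] vanish_gsubst2)

lemma gsubst2_gcomp:
  assumes "nc F" "nc G"
  shows "gsubst2 P (gcomp F G) = gsubst2 (gsubst2 P F) G"
  by (rule fcont_eqI [of "\<lambda>P. gsubst2 P (gcomp F G)"])
     (auto intro!: fcont_compose [OF fcont_gsubst2 fcont_gsubst2] fcont_gsubst2
       simp: nc_gcomp assms gsubst2_mono2 gsubst2_mult gsubst2_power gsubst2_basic,
      simp add: gcomp_def)

lemma gcomp_assoc: "nc F \<Longrightarrow> nc G \<Longrightarrow> gcomp (gcomp H F) G = gcomp H (gcomp F G)"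
  by (simp add: gcomp_def [of H] gcomp_def [of "(_, _)"] gsubst2_gcomp)

lemma gcomp_id [simp]: "gcomp F (X2, Y2) = F" and id_gcomp: "nc F \<Longrightarrow> gcomp (X2, Y2) F = F"
  by (simp_all add: gcomp_def gsubst2_basic)

text \<open>Exchanging one of \<open>i + j\<close> factors leaves \<open>i + j - 1\<close> factors
  of order 1 beside a difference of order \<open>k + 1\<close>. Hence a monomial of degree
  \<open>i + j \<ge> p\<close> changes only from order \<open>k + p\<close> on.\<close>

lemma gsubst2_cong_vanish:
  assumes G: "nc G" "nc G'" and d: "vanish (k + 1) (fst G - fst G')" "vanish (k + 1) (snd G - snd G')"
    and P: "vanish p P"
  shows "vanish (k + p) (gsubst2 P G - gsubst2 P G')"
proof -
  have m: "vanish (k + i + j) (fst G ^ i * snd G ^ j - fst G' ^ i * snd G' ^ j)" for i j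
    using vanish_mult_diff [of k i "fst G ^ i" "fst G' ^ i" j "snd G ^ j" "snd G' ^ j"]
      vanish_power_diff [OF d(1)] vanish_power_diff [OF d(2)] G
      vanish_power [of 1 "fst G" i] vanish_power [of 1 "snd G'" j]
    by (simp add: nc_def)
  show ?thesis
  proof (rule vanishI)
    fix a b :: nat assume ab: "a + b < k + p"
    have "coeff2 P i j * coeff2 (fst G ^ i * snd G ^ j) a b =
        coeff2 P i j * coeff2 (fst G' ^ i * snd G' ^ j) a b" for i j
    proof (cases "i + j < p")
      case False
      then have "coeff2 (fst G ^ i * snd G ^ j - fst G' ^ i * snd G' ^ j) a b = 0"
        using ab by (intro vanishD [OF m [of i j]]) auto
      then show ?thesis by simp
    qed (simp add: vanishD [OF P])
    then show "coeff2 (gsubst2 P G - gsubst2 P G') a b = 0"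
      by (simp add: gsubst2_def)
  qed
qed

subsection \<open>Partial derivatives and the chain rule\<close>

definition gdX :: "'a::comm_ring_1 fps fps \<Rightarrow> 'a fps fps" where
  "gdX P = Abs_fps (\<lambda>j. fps_deriv (fps_nth P j))"

definition gdY :: "'a::comm_ring_1 fps fps \<Rightarrow> 'a fps fps" where
  "gdY P = fps_deriv P"

lemma dX_eq_gdX: "dX = gdX" and dY_eq_gdY: "dY = gdY"
  by (intro ext, simp add: dX_def gdX_def dY_def gdY_def)+

lemma coeff2_gdX: "coeff2 (gdX P) i j = of_nat (i + 1) * coeff2 P (i + 1) j"
  by (simp add: coeff2_def gdX_def)

lemma coeff2_gdY: "coeff2 (gdY P) i j = of_nat (j + 1) * coeff2 P i (j + 1)"
proof -
  have "fps_nth (of_nat k * A) i = of_nat k * fps_nth A i" for k and A :: "'a fps"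
    by (simp add: fps_of_nat [symmetric])
  from this [of "j + 1"] show ?thesis
    by (simp add: coeff2_def gdY_def)
qed

lemma gdX_mult: "gdX (P * Q) = gdX P * Q + P * gdX Q"
  by (rule fps_ext)
     (simp add: gdX_def fps_mult_nth fps_deriv_sum sum.distrib add.commute)

lemma gdY_mult: "gdY (P * Q) = gdY P * Q + P * gdY Q"
  by (simp add: gdY_def algebra_simps)

lemma gdX_add: "gdX (P + Q) = gdX P + gdX Q" and gdY_add: "gdY (P + Q) = gdY P + gdY Q"
  by (rule fps2_eqI, simp add: coeff2_gdX coeff2_gdY algebra_simps)+

lemma vanish_gdX: "vanish k P \<Longrightarrow> vanish (k - 1) (gdX P)"
  and vanish_gdY: "vanish k P \<Longrightarrow> vanish (k - 1) (gdY P)"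
  by (auto simp: vanish_def coeff2_gdX coeff2_gdY)

lemma fcont_gdX: "fcont gdX" and fcont_gdY: "fcont gdY"
  using vanish_gdX vanish_gdY
  by (metis fcontI [of _ 1] gdX_add gdY_add add_diff_cancel_right')+

lemmas gdX_diff = fcont_diff [OF fcont_gdX] and gdY_diff = fcont_diff [OF fcont_gdY]
  and gdX_uminus = fcont_uminus [OF fcont_gdX] and gdY_uminus = fcont_uminus [OF fcont_gdY]

lemma gd_basic [simp]:
  "gdX X2 = 1" "gdX Y2 = 0" "gdY X2 = 0" "gdY Y2 = 1" "gdX (const2 c) = 0" "gdY (const2 c) = 0"
  "gdX 0 = 0" "gdY 0 = 0" "gdX 1 = 0" "gdY 1 = 0"
  by (rule fps2_eqI; simp add: coeff2_gdX coeff2_gdY coeff2_X2 coeff2_Y2 coeff2_const2 coeff2_1)+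

lemma gdX_const_mult: "gdX (const2 c * P) = const2 c * gdX P"
  and gdY_const_mult: "gdY (const2 c * P) = const2 c * gdY P"
  by (simp_all add: gdX_mult gdY_mult)

lemma gdX_gdY: "gdX (gdY P) = gdY (gdX P)"
  by (rule fps2_eqI) (simp add: coeff2_gdX coeff2_gdY algebra_simps)

lemma gdX_mono2: "gdX (mono2 c i j) = mono2 (c * of_nat i) (i - 1) j"
  and gdY_mono2: "gdY (mono2 c i j) = mono2 (c * of_nat j) i (j - 1)"
  by (rule fps2_eqI; cases i; cases j; auto simp: coeff2_gdX coeff2_gdY coeff2_mono2 algebra_simps)+

lemma derivation_power:
  fixes D :: "'a::comm_ring_1 \<Rightarrow> 'a"
  assumes "\<And>P Q. D (P * Q) = D P * Q + P * D Q" "D 1 = 0"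
  shows "D (P ^ k) = of_nat k * P ^ (k - 1) * D P"
proof (induction k)
  case (Suc k)
  then show ?case using assms by (cases k) (simp_all add: algebra_simps)
qed (use assms in simp)

lemma derivation_chain_rule:
  fixes D :: "'a::comm_ring_1 fps fps \<Rightarrow> 'a fps fps"
  assumes G: "nc G" and D: "\<And>P Q. D (P * Q) = D P * Q + P * D Q" "\<And>c. D (const2 c) = 0" "fcont D"
  shows "D (gsubst2 P G) = gsubst2 (gdX P) G * D (fst G) + gsubst2 (gdY P) G * D (snd G)"
proof (rule fcont_eqI [of "\<lambda>P. D (gsubst2 P G)" "\<lambda>P. gsubst2 (gdX P) G * D (fst G) + gsubst2 (gdY P) G * D (snd G)"])
  note S = fcont_gsubst2 [OF G]
  show "fcont (\<lambda>P. D (gsubst2 P G))" by (rule fcont_compose [OF D(3) S])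
  show "fcont (\<lambda>P. gsubst2 (gdX P) G * D (fst G) + gsubst2 (gdY P) G * D (snd G))"
    by (intro fcont_plus fcont_compose [OF fcont_mult_right] fcont_compose [OF S fcont_gdX]
        fcont_compose [OF S fcont_gdY])
  fix c :: 'a and i j
  have D1: "D 1 = 0" using D(2) [of 1] by simp
  have "const2 (of_nat k :: 'a) = of_nat k" for k :: nat
    by (induction k) auto
  then show "D (gsubst2 (mono2 c i j) G) = gsubst2 (gdX (mono2 c i j)) G * D (fst G) +
      gsubst2 (gdY (mono2 c i j)) G * D (snd G)"
    by (simp add: gdX_mono2 gdY_mono2 gsubst2_mono2 [OF G] D derivation_power [of D, OF D(1) D1] algebra_simps)
qed

lemmas gdX_gsubst2 = derivation_chain_rule [of _ gdX, OF _ gdX_mult gd_basic(5) fcont_gdX]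
lemmas gdY_gsubst2 = derivation_chain_rule [of _ gdY, OF _ gdY_mult gd_basic(6) fcont_gdY]

subsection \<open>Operators raising the degree\<close>

text \<open>Two families matter: substitution by a map without constant term has
  \<open>r = 0\<close>, and the bracket with a Hamiltonian of order \<open>r + 2\<close> raises by
  \<open>r\<close>.\<close>

definition raising :: "nat \<Rightarrow> (fps2 \<Rightarrow> fps2) \<Rightarrow> bool" where
  "raising r D \<longleftrightarrow> (\<forall>P Q. D (P + Q) = D P + D Q) \<and>
     (\<forall>c P. D (const2 c * P) = const2 c * D P) \<and>
     (\<forall>k P. vanish k P \<longrightarrow> vanish (k + r) (D P))"

lemma raisingI:
  assumes "\<And>P Q. D (P + Q) = D P + D Q" "\<And>c P. D (const2 c * P) = const2 c * D P"
    "\<And>k P. vanish k P \<Longrightarrow> vanish (k + r) (D P)"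
  shows "raising r D"
  using assms by (simp add: raising_def)

lemma raising_add: "raising r D \<Longrightarrow> D (P + Q) = D P + D Q"
  and raising_const: "raising r D \<Longrightarrow> D (const2 c * P) = const2 c * D P"
  and raising_vanish: "raising r D \<Longrightarrow> vanish k P \<Longrightarrow> vanish (k + r) (D P)"
  by (simp_all add: raising_def)

lemma raising_fcont: "raising r D \<Longrightarrow> fcont D"
  by (rule fcontI [of _ 0]) (auto simp: raising_def dest!: spec intro: vanish_mono [OF _ le_add1])

lemmas raising_diff = fcont_diff [OF raising_fcont]
lemmas raising_sum = fcont_sum [OF raising_fcont]

lemma raising_mono: "raising r D \<Longrightarrow> s \<le> r \<Longrightarrow> raising s D"
  unfolding raising_def by (meson add_left_mono vanish_mono)

lemma raising_id: "raising 0 (\<lambda>P. P)"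
  by (rule raisingI) auto

lemma raising_compose:
  assumes "raising r D" "raising s F"
  shows "raising (r + s) (\<lambda>P. D (F P))"
proof (rule raisingI)
  show "vanish k P \<Longrightarrow> vanish (k + (r + s)) (D (F P))" for k P
    using raising_vanish [OF assms(1) raising_vanish [OF assms(2)], of k P] by (simp add: add_ac)
qed (simp_all add: raising_add [OF assms(1)] raising_add [OF assms(2)]
      raising_const [OF assms(1)] raising_const [OF assms(2)])

lemma raising_plus: "raising r D \<Longrightarrow> raising r F \<Longrightarrow> raising r (\<lambda>P. D P + F P)"
  by (rule raisingI) (auto simp: raising_def algebra_simps intro: vanish_add)

lemma raising_minus: "raising r D \<Longrightarrow> raising r F \<Longrightarrow> raising r (\<lambda>P. D P - F P)"
  by (rule raisingI) (auto simp: raising_def algebra_simps intro: vanish_diff)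

lemma raising_const_mult: "raising r D \<Longrightarrow> raising r (\<lambda>P. const2 c * D P)"
  by (rule raisingI)
     (simp_all only: raising_add raising_const distrib_left mult.left_commute vanish_const2_mult raising_vanish)

lemma raising_funpow: "raising r D \<Longrightarrow> raising (k * r) (D ^^ k)"
  by (induction k) (use raising_id raising_compose in \<open>auto simp: comp_def id_def\<close>)

lemma raising_funpow_vanish:
  assumes "raising r D" "vanish n P"
  shows "vanish (n + k * r) ((D ^^ k) P)"
  using raising_vanish [OF raising_funpow [OF assms(1)] assms(2)] .

text \<open>The gain \<open>s\<close> is uniform in the order \<open>k\<close> of the argument. This
  makes the relation stable under composition with raising operators.\<close>

definition opcong :: "nat \<Rightarrow> (fps2 \<Rightarrow> fps2) \<Rightarrow> (fps2 \<Rightarrow> fps2) \<Rightarrow> bool" where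
  "opcong s A B \<longleftrightarrow> (\<forall>k P. vanish k P \<longrightarrow> vanish (k + s) (A P - B P))"

lemma opcongD: "opcong s A B \<Longrightarrow> vanish k P \<Longrightarrow> vanish (k + s) (A P - B P)"
  by (simp add: opcong_def)

lemma opcong_refl: "opcong s A A"
  by (simp add: opcong_def)

lemma opcong_sym: "opcong s A B \<Longrightarrow> opcong s B A"
  unfolding opcong_def using vanish_diff_sym by blast

lemma opcong_trans [trans]: "opcong s A B \<Longrightarrow> opcong s B C \<Longrightarrow> opcong s A C"
  unfolding opcong_def using vanish_diff_trans by blast

lemma opcong_mono: "opcong s A B \<Longrightarrow> r \<le> s \<Longrightarrow> opcong r A B"
  unfolding opcong_def by (meson add_left_mono vanish_mono)

lemma opcong_comp_right: "opcong s A B \<Longrightarrow> raising r C \<Longrightarrow> opcong (s + r) (\<lambda>P. A (C P)) (\<lambda>P. B (C P))"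
  unfolding opcong_def raising_def by (metis add.assoc add.commute)

lemma opcong_comp_left:
  assumes "opcong s A B" "raising r C"
  shows "opcong (s + r) (\<lambda>P. C (A P)) (\<lambda>P. C (B P))"
  unfolding opcong_def
proof (intro allI impI)
  fix k and P :: fps2 assume "vanish k P"
  from raising_vanish [OF assms(2) opcongD [OF assms(1) this]]
  show "vanish (k + (s + r)) (C (A P) - C (B P))"
    by (simp add: raising_diff [OF assms(2)] add.assoc)
qed

lemma opcong_add:
  assumes "opcong s A B" "opcong s A' B'"
  shows "opcong s (\<lambda>P. A P + A' P) (\<lambda>P. B P + B' P)"
  unfolding opcong_def
proof (intro allI impI)
  fix k and P :: fps2 assume "vanish k P"
  from vanish_add [OF opcongD [OF assms(1) this] opcongD [OF assms(2) this]]
  show "vanish (k + s) (A P + A' P - (B P + B' P))" by (simp add: algebra_simps)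
qed

lemma opcong_raising0: "raising s A \<Longrightarrow> opcong s (\<lambda>P. B P + A P) B"
  by (simp add: opcong_def raising_def)

subsection \<open>Exponentials of degree-raising operators\<close>

definition dpow :: "(fps2 \<Rightarrow> fps2) \<Rightarrow> nat \<Rightarrow> fps2 \<Rightarrow> fps2" where
  "dpow D k P = const2 (1 / fact k) * (D ^^ k) P"

definition tay :: "nat \<Rightarrow> (fps2 \<Rightarrow> fps2) \<Rightarrow> fps2 \<Rightarrow> fps2" where
  "tay N D P = (\<Sum>k<N. dpow D k P)"

text \<open>The exponential series of \<open>D\<close>. Breaking off at \<open>k = i + j\<close> is
  harmless for operators with \<open>raising 1 D\<close>, whose later powers have no terms in degree
  \<open>i + j\<close>.\<close>

definition lexp :: "(fps2 \<Rightarrow> fps2) \<Rightarrow> fps2 \<Rightarrow> fps2" where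
  "lexp D P = mk_fps2 (\<lambda>i j. \<Sum>k\<le>i + j. coeff2 (dpow D k P) i j)"

lemma raising_dpow:
  assumes "raising r D" shows "raising (k * r) (dpow D k)"
  using raising_const_mult [OF raising_funpow [OF assms]] by (simp add: dpow_def [abs_def])

lemma raising_tay: "raising r D \<Longrightarrow> raising 0 (tay N D)"
proof (induction N)
  case 0
  show ?case by (rule raisingI) (simp_all add: tay_def)
next
  case (Suc N)
  from raising_plus [OF Suc.IH raising_mono [OF raising_dpow]] Suc.prems
  show ?case by (simp add: tay_def [abs_def])
qed

lemma dpow_vanish:
  assumes "raising r D" "vanish n P"
  shows "vanish (n + k * r) (dpow D k P)"
  using raising_vanish [OF raising_dpow [OF assms(1)] assms(2)] .

lemma lexp_approx:
  assumes D: "raising 1 D" and K: "\<And>k. k \<ge> m \<Longrightarrow> vanish K (dpow D k P)"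
  shows "vanish K (lexp D P - tay m D P)"
proof (rule vanishI)
  fix i j :: nat assume ij: "i + j < K"
  define f where "f k = coeff2 (dpow D k P) i j" for k
  define N where "N = max m (i + j + 1)"
  have f0: "f k = 0" if "k \<ge> m \<or> k > i + j" for k
    using that
  proof
    assume "m \<le> k" then show ?thesis unfolding f_def by (rule vanishD [OF K ij])
  next
    assume "i + j < k"
    then show ?thesis using dpow_vanish [OF D vanish_0, of k P] by (simp add: f_def vanishD)
  qed
  have "(\<Sum>k\<le>i + j. f k) = (\<Sum>k<N. f k)"
    by (rule sum.mono_neutral_left) (auto simp: N_def f0)
  moreover have "(\<Sum>k<m. f k) = (\<Sum>k<N. f k)"
    by (rule sum.mono_neutral_left) (auto simp: N_def f0)
  ultimately show "coeff2 (lexp D P - tay m D P) i j = 0"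
    by (simp add: lexp_def tay_def f_def)
qed

lemma lexp_tay: "raising 1 D \<Longrightarrow> vanish N (lexp D P - tay N D P)"
  by (rule lexp_approx) (auto intro: vanish_mono [OF dpow_vanish [OF _ vanish_0]])

lemma coeff2_lexp:
  assumes "raising 1 D" "i + j < N"
  shows "coeff2 (lexp D P) i j = (\<Sum>k<N. coeff2 (dpow D k P) i j)"
  using vanishD [OF lexp_tay [OF assms(1)] assms(2), of P] by (simp add: tay_def)

lemma opcong_lexp:
  assumes D: "raising r D" "r \<ge> 1"
  shows "opcong (m * r) (lexp D) (tay m D)"
  unfolding opcong_def
proof (intro allI impI)
  fix k and P :: fps2 assume P: "vanish k P"
  show "vanish (k + m * r) (lexp D P - tay m D P)"
  proof (rule lexp_approx)
    show "raising 1 D" using D raising_mono by blast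
    fix l assume "m \<le> l"
    then show "vanish (k + m * r) (dpow D l P)"
      by (intro vanish_mono [OF dpow_vanish [OF D(1) P, of l]]) simp
  qed
qed

lemma raising_lexp:
  assumes "raising 1 D"
  shows "raising 0 (lexp D)"
proof (rule raisingI)
  note T = raising_tay [OF assms]
  show "lexp D (P + Q) = lexp D P + lexp D Q" for P Q
    by (rule fps2_eqI)
       (simp add: lexp_def raising_add [OF raising_dpow [OF assms]] sum.distrib)
  show "lexp D (const2 c * P) = const2 c * lexp D P" for c P
    by (rule fps2_eqI)
       (simp add: lexp_def raising_const [OF raising_dpow [OF assms]] sum_distrib_left)
  show "vanish (k + 0) (lexp D P)" if "vanish k P" for k P
  proof -
    have "vanish k (tay k D P)" using raising_vanish [OF T that] by simp
    from vanish_add [OF lexp_tay [OF assms, of k P] this] show ?thesis by simp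
  qed
qed

lemma tay_1 [simp]: "tay (Suc 0) D P = P" and tay_2: "tay 2 D P = P + D P"
  by (simp_all add: tay_def dpow_def eval_nat_numeral)

lemma opcong_lexp_1: "raising r D \<Longrightarrow> r \<ge> 1 \<Longrightarrow> opcong r (lexp D) (\<lambda>P. P)"
  using opcong_lexp [of r D 1] by (simp add: opcong_def)

lemma opcong_lexp_2: "raising r D \<Longrightarrow> r \<ge> 1 \<Longrightarrow> opcong (2 * r) (lexp D) (\<lambda>P. P + D P)"
  using opcong_lexp [of r D 2] by (simp add: opcong_def tay_2)

text \<open>Expand both exponentials into words in \<open>D\<close> and \<open>F\<close>. A word of
  length at least two that contains \<open>F\<close> has a further letter, which raises by at least
  \<open>r\<close>; the only remaining difference is the single letter \<open>F\<close>.\<close>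

lemma opcong_lexp_perturb:
  assumes D: "raising r D" and F: "raising s F" and r: "1 \<le> r" "r \<le> s"
  shows "opcong (r + s) (lexp (\<lambda>P. D P + F P)) (\<lambda>P. lexp D P + F P)"
  unfolding opcong_def
proof (intro allI impI)
  fix n and P :: fps2 assume P: "vanish n P"
  define G where "G = (\<lambda>P. D P + F P)"
  have G: "raising r G"
    unfolding G_def using D F r raising_mono raising_plus by blast
  \<comment> \<open>The weak bound is what the induction carries: one application of
    \<open>G\<close> improves it by \<open>r\<close> and gives the strong bound for the next
    exponent.\<close>
  have 1: "vanish (n + s) ((G ^^ Suc k) P - (D ^^ Suc k) P) \<and>
      (k > 0 \<longrightarrow> vanish (n + (r + s)) ((G ^^ Suc k) P - (D ^^ Suc k) P))" for k
  proof (induction k)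
    case 0
    then show ?case using raising_vanish [OF F P] by (simp add: G_def)
  next
    case (Suc k)
    let ?d = "(G ^^ Suc k) P - (D ^^ Suc k) P"
    have eq: "(G ^^ Suc (Suc k)) P - (D ^^ Suc (Suc k)) P = G ?d + F ((D ^^ Suc k) P)"
      unfolding raising_diff [OF G] by (simp add: G_def)
    have "vanish (n + s + r) (G ?d)" using raising_vanish [OF G] Suc.IH by blast
    moreover have "vanish (n + Suc k * r + s) (F ((D ^^ Suc k) P))"
      by (rule raising_vanish [OF F raising_funpow_vanish [OF D P]])
    moreover have "n + (r + s) \<le> n + Suc k * r + s" by simp
    ultimately have "vanish (n + (r + s)) ((G ^^ Suc (Suc k)) P - (D ^^ Suc (Suc k)) P)"
      unfolding eq by (metis add.assoc add.commute vanish_add vanish_mono)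
    then show ?case using vanish_mono [of "n + (r + s)" _ "n + s"] by simp
  qed
  define N where "N = n + r + s + 2"
  have T: "tay N G P - tay N D P - F P = (\<Sum>k\<in>{2..<N}. const2 (1 / fact k) * ((G ^^ k) P - (D ^^ k) P))"
  proof -
    have "tay N G P - tay N D P = (\<Sum>k<N. const2 (1 / fact k) * ((G ^^ k) P - (D ^^ k) P))"
      by (simp add: tay_def dpow_def sum_subtractf algebra_simps)
    also have "{..<N} = {0, 1} \<union> {2..<N}" by (auto simp: N_def)
    also have "(\<Sum>k\<in>{0,1} \<union> {2..<N}. const2 (1 / fact k) * ((G ^^ k) P - (D ^^ k) P)) =
        F P + (\<Sum>k\<in>{2..<N}. const2 (1 / fact k) * ((G ^^ k) P - (D ^^ k) P))"
      by (subst sum.union_disjoint) (auto simp: G_def)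
    finally show ?thesis by simp
  qed
  have "vanish (n + (r + s)) (tay N G P - tay N D P - F P)"
    unfolding T
  proof (intro vanish_sum vanish_const2_mult)
    fix k assume "k \<in> {2..<N}"
    then obtain l where "k = Suc l" "l > 0" by (cases k) auto
    then show "vanish (n + (r + s)) ((G ^^ k) P - (D ^^ k) P)" using 1 by blast
  qed
  moreover have "vanish (n + (r + s)) (lexp G P - tay N G P)"
    by (rule vanish_mono [OF lexp_tay]) (use G r raising_mono N_def in auto)
  moreover have "vanish (n + (r + s)) (lexp D P - tay N D P)"
    by (rule vanish_mono [OF lexp_tay]) (use D r raising_mono N_def in auto)
  moreover have "lexp G P - (lexp D P + F P) = (tay N G P - tay N D P - F P) +
      (lexp G P - tay N G P) - (lexp D P - tay N D P)" by simp
  ultimately show "vanish (n + (r + s)) (lexp (\<lambda>P. D P + F P) P - (lexp D P + F P))"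
    unfolding G_def [symmetric] by (metis vanish_add vanish_diff)
qed

text \<open>The square and its part below the antidiagonal differ only by entries with
  \<open>i + j \<ge> N\<close>. This serves as the Cauchy product for truncated
  exponentials.\<close>

lemma vanish_triangle_sum:
  fixes f :: "nat \<Rightarrow> nat \<Rightarrow> fps2"
  assumes "\<And>i j. i + j \<ge> N \<Longrightarrow> vanish v (f i j)"
  shows "vanish v ((\<Sum>i<N. \<Sum>j<N. f i j) - (\<Sum>k<N. \<Sum>i\<le>k. f i (k - i)))"
proof -
  define T where "T = {(i, j). i + j < N}"
  have "T \<subseteq> {..<N} \<times> {..<N}" by (auto simp: T_def)
  then have "(\<Sum>p\<in>{..<N} \<times> {..<N}. case p of (i, j) \<Rightarrow> f i j) =
      (\<Sum>p\<in>{..<N} \<times> {..<N} - T. case p of (i, j) \<Rightarrow> f i j) + (\<Sum>p\<in>T. case p of (i, j) \<Rightarrow> f i j)"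
    by (intro sum.subset_diff) auto
  moreover have "vanish v (\<Sum>p\<in>{..<N} \<times> {..<N} - T. case p of (i, j) \<Rightarrow> f i j)"
    by (rule vanish_sum) (use assms in \<open>auto simp: T_def\<close>)
  ultimately show ?thesis
    by (simp add: sum.cartesian_product T_def sum.triangle_reindex)
qed

text \<open>The Leibniz rule for divided powers; \<open>B\<close> is either the product or the Poisson bracket.\<close>

lemma lexp_bilinear:
  fixes B :: "fps2 \<Rightarrow> fps2 \<Rightarrow> fps2"
  assumes D: "raising 1 D" and Leib: "\<And>P Q. D (B P Q) = B (D P) Q + B P (D Q)"
    and B1: "\<And>P P' Q. B (P + P') Q = B P Q + B P' Q" "\<And>c P Q. B (const2 c * P) Q = const2 c * B P Q"
    and B2: "\<And>P Q Q'. B P (Q + Q') = B P Q + B P Q'" "\<And>c P Q. B P (const2 c * Q) = const2 c * B P Q"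
    and Bv: "\<And>p q P Q. vanish p P \<Longrightarrow> vanish q Q \<Longrightarrow> vanish (p + q - 2) (B P Q)"
  shows "lexp D (B P Q) = B (lexp D P) (lexp D Q)"
proof -
  have B10: "B 0 Q = 0" and B20: "B P 0 = 0" for P Q
    using B1(2) [of 0 0 Q] B2(2) [of P 0 0] by simp_all
  have Bs1: "B (\<Sum>x\<in>S. f x) Q = (\<Sum>x\<in>S. B (f x) Q)" for S :: "nat set" and f Q
    by (induction S rule: infinite_finite_induct) (auto simp: B10 B1)
  have Bs2: "B P (\<Sum>x\<in>S. f x) = (\<Sum>x\<in>S. B P (f x))" for S :: "nat set" and f P
    by (induction S rule: infinite_finite_induct) (auto simp: B20 B2)
  have Bd: "B P Q - B P' Q' = B (P - P') Q + B P' (Q - Q')" for P P' Q Q'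
    using B1(1) [of "P - P'" P' Q] B2(1) [of P' "Q - Q'" Q'] by simp
  have step: "D (dpow D k P) = const2 (of_nat (Suc k)) * dpow D (Suc k) P" for k P
  proof -
    have "const2 (of_nat (Suc k)) * dpow D (Suc k) P = const2 (of_nat (Suc k) * (1 / fact (Suc k))) * (D ^^ Suc k) P"
      unfolding dpow_def by (rule const2_mult_mult)
    also have "of_nat (Suc k) * (1 / fact (Suc k)) = (1 / fact k :: real)"
      by simp
    finally show ?thesis unfolding dpow_def [of D k] raising_const [OF D] by simp
  qed
  have Lk: "dpow D k (B P Q) = (\<Sum>i\<le>k. B (dpow D i P) (dpow D (k - i) Q))" for k
  proof (induction k)
    case 0
    then show ?case by (simp add: dpow_def)
  next
    case (Suc k)
    define a where "a i = B (dpow D i P) (dpow D (Suc k - i) Q)" for i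
    \<comment> \<open>Divided powers turn the binomial recursion into the identity
      \<open>i + (k + 1 - i) = k + 1\<close>; the common factor \<open>k + 1\<close> is cancelled at
      the end.\<close>
    have "const2 (of_nat (Suc k)) * dpow D (Suc k) (B P Q) = D (dpow D k (B P Q))"
      by (simp add: step)
    also have "\<dots> = (\<Sum>i\<le>k. B (D (dpow D i P)) (dpow D (k - i) Q) + B (dpow D i P) (D (dpow D (k - i) Q)))"
      by (simp add: Suc.IH raising_sum [OF D] Leib)
    also have "\<dots> = (\<Sum>i\<le>k. const2 (of_nat (Suc i)) * a (Suc i) + const2 (of_nat (Suc k - i)) * a i)"
      by (intro sum.cong refl arg_cong2 [of _ _ _ _ "(+)"])
         (simp_all only: step B1 B2 a_def diff_Suc_Suc Suc_diff_le atMost_iff)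
    also have "\<dots> = (\<Sum>i\<le>k. const2 (of_nat (Suc i)) * a (Suc i)) + (\<Sum>i\<le>k. const2 (of_nat (Suc k - i)) * a i)"
      by (rule sum.distrib)
    also have "(\<Sum>i\<le>k. const2 (of_nat (Suc i)) * a (Suc i)) = (\<Sum>i\<le>Suc k. const2 (of_nat i) * a i)"
      by (subst sum.atMost_Suc_shift) simp
    also have "(\<Sum>i\<le>k. const2 (of_nat (Suc k - i)) * a i) = (\<Sum>i\<le>Suc k. const2 (of_nat (Suc k - i)) * a i)"
      by simp
    also have "(\<Sum>i\<le>Suc k. const2 (of_nat i) * a i) + (\<Sum>i\<le>Suc k. const2 (of_nat (Suc k - i)) * a i) =
        (\<Sum>i\<le>Suc k. const2 (of_nat (Suc k)) * a i)"
    proof -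
      have "const2 (of_nat i) * a i + const2 (of_nat (Suc k - i)) * a i = const2 (of_nat (Suc k)) * a i"
        if "i \<le> Suc k" for i
      proof -
        have "const2 (of_nat i :: real) + const2 (of_nat (Suc k - i)) = const2 (of_nat i + of_nat (Suc k - i))"
          by (simp only: const2_simps)
        also have "(of_nat i + of_nat (Suc k - i) :: real) = of_nat (Suc k)"
          using that by (simp add: of_nat_diff)
        finally show ?thesis by (simp only: distrib_right [symmetric])
      qed
      then show ?thesis unfolding sum.distrib [symmetric] by (intro sum.cong) auto
    qed
    also have "\<dots> = const2 (of_nat (Suc k)) * (\<Sum>i\<le>Suc k. a i)"
      by (simp only: sum_distrib_left)
    finally have "const2 (of_nat (Suc k)) * dpow D (Suc k) (B P Q) = const2 (of_nat (Suc k)) * (\<Sum>i\<le>Suc k. a i)" .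
    then have "const2 (1 / of_nat (Suc k)) * (const2 (of_nat (Suc k)) * dpow D (Suc k) (B P Q)) =
        const2 (1 / of_nat (Suc k)) * (const2 (of_nat (Suc k)) * (\<Sum>i\<le>Suc k. a i))" by (simp only:)
    moreover have "1 / of_nat (Suc k) * of_nat (Suc k) = (1::real)" by simp
    ultimately show ?case by (simp only: a_def const2_mult_mult const2_simps mult_1_left)
  qed
  have "vanish N (lexp D (B P Q) - B (lexp D P) (lexp D Q))" for N
  proof -
    \<comment> \<open>The bracket may lower the total order by two, so the factors are approximated
      two degrees further.\<close>
    define M where "M = N + 2"
    have 1: "vanish N (lexp D (B P Q) - tay M D (B P Q))"
      by (rule vanish_mono [OF lexp_tay [OF D, of M]]) (simp add: M_def)
    have 2: "vanish N (B (lexp D P) (lexp D Q) - B (tay M D P) (tay M D Q))"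
      unfolding Bd
      using Bv [OF lexp_tay [OF D, of M P] vanish_0, of "lexp D Q"] Bv [OF vanish_0 lexp_tay [OF D, of M Q], of "tay M D P"]
      by (simp add: M_def vanish_add)
    have "vanish N ((\<Sum>i<M. \<Sum>j<M. B (dpow D i P) (dpow D j Q)) - (\<Sum>k<M. \<Sum>i\<le>k. B (dpow D i P) (dpow D (k - i) Q)))"
    proof (rule vanish_triangle_sum)
      fix i j assume "M \<le> i + j"
      then show "vanish N (B (dpow D i P) (dpow D j Q))"
        using Bv [OF dpow_vanish [OF D vanish_0, of i P] dpow_vanish [OF D vanish_0, of j Q]]
        by (auto simp: M_def elim!: vanish_mono)
    qed
    then have 3: "vanish N (B (tay M D P) (tay M D Q) - tay M D (B P Q))"
      unfolding tay_def Lk by (simp only: Bs1) (simp only: Bs2)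
    from vanish_diff_trans [OF vanish_diff_trans [OF 1 vanish_diff_sym [OF 3]] vanish_diff_sym [OF 2]]
    show ?thesis .
  qed
  then show ?thesis using vanish_all by fastforce
qed

lemma lexp_intertwine:
  assumes D: "raising 1 D" "raising 1 D'" and S: "raising 0 S"
    and eq: "\<And>P. S (D P) = D' (S P)"
  shows "S (lexp D P) = lexp D' (S P)"
proof -
  have "S ((D ^^ k) P) = (D' ^^ k) (S P)" for k
    by (induction k) (auto simp: eq)
  then have T: "S (tay N D P) = tay N D' (S P)" for N
    by (simp add: tay_def raising_sum [OF S] dpow_def raising_const [OF S])
  have "vanish N (S (lexp D P) - lexp D' (S P))" for N
  proof -
    have "vanish N (S (lexp D P) - S (tay N D P))"
      using raising_vanish [OF S lexp_tay [OF D(1), of N P]] by (simp add: raising_diff [OF S])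
    then show ?thesis
      unfolding T using vanish_diff_trans vanish_diff_sym [OF lexp_tay [OF D(2)]] by blast
  qed
  then show ?thesis using vanish_all by fastforce
qed

text \<open>On the antidiagonal \<open>i + j = k\<close> the terms of the double series collect to
  \<open>D ^^ k\<close> times an alternating sum of binomial coefficients divided by
  \<open>fact k\<close>, which is zero unless \<open>k = 0\<close>.\<close>

lemma lexp_inverse:
  assumes D: "raising 1 D"
  shows "lexp (\<lambda>P. - D P) (lexp D P) = P"
proof -
  have mD: "raising 1 (\<lambda>P. - D P)"
    using raising_minus [of 1 "\<lambda>P. 0" D] D by (simp add: raising_def)
  have mk: "((\<lambda>P. - D P) ^^ k) Q = const2 ((- 1) ^ k) * (D ^^ k) Q" for k Q
  proof (induction k)
    case (Suc k)
    show ?case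
      by (simp add: Suc.IH [simplified] raising_const [OF D, of "(- 1) ^ k", simplified])
  qed simp
  have "vanish N (lexp (\<lambda>P. - D P) (lexp D P) - P)" if "N > 0" for N
  proof -
    let ?f = "\<lambda>i j. const2 ((- 1) ^ i / (fact i * fact j)) * (D ^^ (i + j)) P"
    have 1: "vanish N (lexp (\<lambda>P. - D P) (lexp D P) - tay N (\<lambda>P. - D P) (lexp D P))"
      by (rule lexp_tay [OF mD])
    have 2: "vanish N (tay N (\<lambda>P. - D P) (lexp D P) - tay N (\<lambda>P. - D P) (tay N D P))"
      using raising_vanish [OF raising_tay [OF mD, of N] lexp_tay [OF D, of N P]]
      by (simp add: raising_diff [OF raising_tay [OF mD]])
    have "dpow (\<lambda>P. - D P) i (dpow D j P) = ?f i j" for i j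
    proof -
      have "dpow (\<lambda>P. - D P) i (dpow D j P) =
          const2 (1 / fact i) * (const2 ((- 1) ^ i) * (const2 (1 / fact j) * (D ^^ i) ((D ^^ j) P)))"
        by (simp only: dpow_def mk raising_const [OF raising_funpow [OF D]])
      also have "\<dots> = const2 (1 / fact i * ((- 1) ^ i * (1 / fact j))) * (D ^^ (i + j)) P"
        by (simp only: const2_simps mult.assoc funpow_add comp_def)
      finally show ?thesis by simp
    qed
    then have eq: "tay N (\<lambda>P. - D P) (tay N D P) = (\<Sum>i<N. \<Sum>j<N. ?f i j)"
      by (simp add: tay_def raising_sum [OF raising_dpow [OF mD]])
    have 3: "vanish N ((\<Sum>i<N. \<Sum>j<N. ?f i j) - (\<Sum>k<N. \<Sum>i\<le>k. ?f i (k - i)))"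
    proof (rule vanish_triangle_sum)
      fix i j assume "N \<le> i + j"
      then show "vanish N (?f i j)"
        using raising_funpow_vanish [OF D vanish_0, of "i + j" P]
        by (auto intro!: vanish_const2_mult elim!: vanish_mono)
    qed
    have "(\<Sum>i\<le>k. ?f i (k - i)) = (if k = 0 then P else 0)" for k
    proof -
      have "(\<Sum>i\<le>k. ?f i (k - i)) = (\<Sum>i\<le>k. const2 ((- 1) ^ i / (fact i * fact (k - i))) * (D ^^ k) P)"
        by (intro sum.cong) auto
      also have "\<dots> = const2 (\<Sum>i\<le>k. (- 1) ^ i / (fact i * fact (k - i))) * (D ^^ k) P"
      proof -
        have "const2 (\<Sum>i\<in>S. g i) = (\<Sum>i\<in>S. const2 (g i))" for g :: "nat \<Rightarrow> real" and S
          by (induction S rule: infinite_finite_induct) auto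
        then show ?thesis by (simp only: sum_distrib_right)
      qed
      also have "(\<Sum>i\<le>k. (- 1) ^ i / (fact i * fact (k - i))) = (\<Sum>i\<le>k. (- 1) ^ i * of_nat (k choose i)) / (fact k :: real)"
        by (auto simp: sum_divide_distrib binomial_fact field_simps intro!: sum.cong)
      also have "\<dots> = (if k = 0 then 1 else 0)"
        by (cases "k = 0") (simp_all add: choose_alternating_sum)
      finally show ?thesis by simp
    qed
    then have "(\<Sum>k<N. \<Sum>i\<le>k. ?f i (k - i)) = P"
      using that by (simp add: sum.delta)
    with 3 eq have "vanish N (tay N (\<lambda>P. - D P) (tay N D P) - P)" by simp
    from vanish_diff_trans [OF vanish_diff_trans [OF 1 2] this] show ?thesis .
  qed
  then have "vanish N (lexp (\<lambda>P. - D P) (lexp D P) - P)" for N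
    by (cases "N = 0") auto
  then show ?thesis using vanish_all by fastforce
qed

subsection \<open>The Poisson bracket\<close>

text \<open>The order of the arguments and the sign are such that \<open>br P H\<close> is the
  derivative of \<open>P\<close> along the equations of \<open>formal_ham_flow\<close>.\<close>

definition br :: "'a::comm_ring_1 fps fps \<Rightarrow> 'a fps fps \<Rightarrow> 'a fps fps" where
  "br P H = gdX P * gdY H - gdY P * gdX H"

lemma br_add_left: "br (P + P') H = br P H + br P' H"
  and br_add_right: "br P (H + H') = br P H + br P H'"
  by (simp_all add: br_def gdX_add gdY_add algebra_simps)

lemma br_diff_left: "br (P - P') H = br P H - br P' H"
  and br_diff_right: "br P (H - H') = br P H - br P H'"
  by (simp_all add: br_def gdX_diff gdY_diff algebra_simps)

lemma br_const_left: "br (const2 c * P) H = const2 c * br P H"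
  and br_const_right: "br P (const2 c * H) = const2 c * br P H"
  unfolding br_def gdX_const_mult gdY_const_mult by (simp_all only: right_diff_distrib mult_ac)

lemma br_uminus_right: "br P (- H) = - br P H"
  by (simp add: br_def gdX_uminus gdY_uminus)

lemma br_const2 [simp]: "br (const2 c) H = 0" and br_one [simp]: "br 1 H = 0"
  by (simp_all add: br_def)

lemma br_self [simp]: "br H H = 0"
  by (simp add: br_def algebra_simps)

lemma br_antisym: "br P H = - br H P"
  by (simp add: br_def algebra_simps)

lemma br_X2: "br X2 H = gdY H" and br_Y2: "br Y2 H = - gdX H"
  by (simp_all add: br_def)

lemma br_X2_Y2 [simp]: "br X2 Y2 = 1"
  by (simp add: br_def)

lemma br_mult_left: "br (P * Q) H = br P H * Q + P * br Q H"
  by (simp add: br_def gdX_mult gdY_mult algebra_simps)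

text \<open>The Jacobi identity, arranged so that \<open>ad H\<close> is seen to be a derivation of
  the bracket.\<close>

lemma br_Leibniz: "br (br P Q) H = br (br P H) Q + br P (br Q H)"
  by (simp add: br_def gdX_mult gdY_mult gdX_diff gdY_diff gdX_gdY algebra_simps)

lemma br_power_self: "br (H ^ k) H = 0"
  by (induction k) (simp_all add: br_mult_left)

lemma vanish_gdX_mult:
  assumes "vanish p P" "vanish (r + 1) Q"
  shows "vanish (p + r) (gdX P * Q)" and "vanish (p + r) (gdY P * Q)"
  using vanish_mult [OF vanish_gdX [OF assms(1)] assms(2)]
    vanish_mult [OF vanish_gdY [OF assms(1)] assms(2)]
  by (auto elim!: vanish_mono)

lemma vanish_br:
  assumes "vanish p P" "vanish (r + 2) H"
  shows "vanish (p + r) (br P H)"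
  unfolding br_def
  using vanish_gdX_mult [OF assms(1), of r] vanish_gdX [OF assms(2)] vanish_gdY [OF assms(2)]
  by (auto intro: vanish_diff)

lemma vanish_br_sub:
  assumes "vanish p P" "vanish q Q"
  shows "vanish (p + q - 2) (br P Q)"
  unfolding br_def
  using vanish_mult [OF vanish_gdX [OF assms(1)] vanish_gdY [OF assms(2)]]
    vanish_mult [OF vanish_gdY [OF assms(1)] vanish_gdX [OF assms(2)]]
  by (auto intro!: vanish_diff elim!: vanish_mono)

abbreviation ad :: "fps2 \<Rightarrow> fps2 \<Rightarrow> fps2" where
  "ad H \<equiv> \<lambda>P. br P H"

lemma raising_ad: "vanish (r + 2) H \<Longrightarrow> raising r (ad H)"
  by (rule raisingI) (simp_all add: br_add_left br_const_left vanish_br)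

lemma raising_ad_minus: "vanish p H \<Longrightarrow> 2 \<le> p \<Longrightarrow> raising (p - 2) (ad H)"
  by (rule raising_ad) (simp only: le_add_diff_inverse2)

lemma raising_ad3: "vanish 3 H \<Longrightarrow> raising 1 (ad H)"
  by (rule raising_ad) (simp add: numeral_3_eq_3)

subsection \<open>Formal canonical maps\<close>

definition canon :: "fmap \<Rightarrow> bool" where
  "canon C \<longleftrightarrow> nc C \<and> br (fst C) (snd C) = 1 \<and>
     (\<exists>D. nc D \<and> gcomp C D = (X2, Y2) \<and> gcomp D C = (X2, Y2))"

lemma formal_canonical_iff: "formal_canonical C \<longleftrightarrow> canon C"
  by (simp add: formal_canonical_def canon_def no_const_eq_nc fjacobian_def br_def
      dX_eq_gdX dY_eq_gdY fcomp_eq_gcomp fid_def)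

text \<open>Symplectic maps that are not known to be invertible.\<close>

definition symp :: "fmap \<Rightarrow> bool" where
  "symp C \<longleftrightarrow> nc C \<and> br (fst C) (snd C) = 1"

lemma canon_symp: "canon C \<Longrightarrow> symp C" and symp_nc: "symp C \<Longrightarrow> nc C"
  by (simp_all add: canon_def symp_def)

lemma canon_nc: "canon C \<Longrightarrow> nc C"
  by (simp add: canon_def)

text \<open>The Jacobian is kept as a factor because the passage to complex coordinates has the
  constant Jacobian \<open>\<i> / 2\<close>; the same factor shows that the inverse of a canonical
  map is canonical.\<close>

lemma gsubst2_br_nc:
  assumes "nc C"
  shows "br (gsubst2 P C) (gsubst2 Q C) = gsubst2 (br P Q) C * br (fst C) (snd C)"
  by (simp add: br_def gdX_gsubst2 [OF assms] gdY_gsubst2 [OF assms] gsubst2_diff [OF assms]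
      gsubst2_mult [OF assms] algebra_simps)

lemma gsubst2_br_symp: "symp C \<Longrightarrow> gsubst2 (br P Q) C = br (gsubst2 P C) (gsubst2 Q C)"
  by (simp add: gsubst2_br_nc symp_def)

lemmas gsubst2_br = gsubst2_br_symp [OF canon_symp]

lemma symp_gcomp:
  assumes "symp A" "symp B"
  shows "symp (gcomp A B)"
proof -
  have "br (fst (gcomp A B)) (snd (gcomp A B)) = gsubst2 (br (fst A) (snd A)) B"
    by (simp add: gcomp_def gsubst2_br_symp [OF assms(2)])
  then show ?thesis
    using assms by (simp add: symp_def nc_gcomp gsubst2_basic)
qed

lemma raising_gsubst2: "nc C \<Longrightarrow> raising 0 (\<lambda>P. gsubst2 P C)"
  by (rule raisingI) (simp_all add: gsubst2_add gsubst2_const_mult vanish_gsubst2)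

lemma canon_gcomp:
  assumes "canon A" "canon B"
  shows "canon (gcomp A B)"
proof -
  obtain A' B' where A': "nc A'" "gcomp A A' = (X2, Y2)" "gcomp A' A = (X2, Y2)"
    and B': "nc B'" "gcomp B B' = (X2, Y2)" "gcomp B' B = (X2, Y2)"
    using assms unfolding canon_def by blast
  have n: "nc A" "nc B" using assms canon_nc by auto
  have "symp (gcomp A B)" by (rule symp_gcomp [OF assms [THEN canon_symp]])
  then have "br (fst (gcomp A B)) (snd (gcomp A B)) = 1" by (simp add: symp_def)
  moreover have "gcomp (gcomp A B) (gcomp B' A') = (X2, Y2)"
    by (metis A'(1,2) B'(1,2) n gcomp_assoc gcomp_id nc_gcomp)
  moreover have "gcomp (gcomp B' A') (gcomp A B) = (X2, Y2)"
    by (metis A'(1,3) B'(1,3) n gcomp_assoc gcomp_id nc_gcomp)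
  ultimately show ?thesis
    unfolding canon_def using n A'(1) B'(1) nc_gcomp by blast
qed

lemma canon_inverse:
  assumes "canon A"
  obtains B where "canon B" "gcomp A B = (X2, Y2)" "gcomp B A = (X2, Y2)"
    "\<And>P. gsubst2 (gsubst2 P A) B = P" "\<And>P. gsubst2 (gsubst2 P B) A = P"
proof -
  obtain B where B: "nc B" "gcomp A B = (X2, Y2)" "gcomp B A = (X2, Y2)"
    using assms unfolding canon_def by blast
  have n: "nc A" using assms canon_nc by auto
  have s: "gsubst2 (gsubst2 P A) B = P" "gsubst2 (gsubst2 P B) A = P" for P
    using gsubst2_gcomp [OF n B(1), of P] gsubst2_gcomp [OF B(1) n, of P] B by simp_all
  have "br (gsubst2 X2 A) (gsubst2 Y2 A) = 1"
    using assms by (simp add: canon_def gsubst2_basic)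
  then have "br (gsubst2 (gsubst2 X2 A) B) (gsubst2 (gsubst2 Y2 A) B) = br (fst B) (snd B)"
    by (simp add: gsubst2_br_nc [OF B(1)] gsubst2_basic [OF B(1)])
  then have "br (fst B) (snd B) = 1" by (simp add: s)
  then have "canon B" unfolding canon_def using B n by blast
  with that B s show ?thesis by blast
qed

lemma map_eqI:
  assumes "nc F" "nc G" "\<And>P. gsubst2 P F = gsubst2 P G"
  shows "F = G"
  using assms(3) [of X2] assms(3) [of Y2]
  by (simp add: gsubst2_basic [OF assms(1)] gsubst2_basic [OF assms(2)] prod_eq_iff)

subsection \<open>Lie series and formal Hamiltonian flows\<close>

definition flow :: "fps2 \<Rightarrow> fmap" where
  "flow H = (lexp (ad H) X2, lexp (ad H) Y2)"

context
  fixes H :: fps2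
  assumes H: "vanish 3 H"
begin

lemma raising_lexp_ad: "raising 0 (lexp (ad H))"
  by (rule raising_lexp [OF raising_ad3 [OF H]])

lemma lexp_ad_mult: "lexp (ad H) (P * Q) = lexp (ad H) P * lexp (ad H) Q"
  by (rule lexp_bilinear [OF raising_ad3 [OF H]])
     (auto simp: br_mult_left algebra_simps intro: vanish_mono [OF vanish_mult])

lemma lexp_ad_br: "lexp (ad H) (br P Q) = br (lexp (ad H) P) (lexp (ad H) Q)"
  by (rule lexp_bilinear [OF raising_ad3 [OF H]])
     (auto simp: br_Leibniz [of _ _ H] br_add_left br_add_right br_const_left br_const_right vanish_br_sub)

lemma lexp_ad_fixed:
  assumes "br P H = 0"
  shows "lexp (ad H) P = P"
proof (rule fps2_eqI)
  fix i j
  have "(ad H ^^ Suc k) P = 0" for k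
  proof (induction k)
    case (Suc k)
    then show ?case by (simp add: br_def)
  qed (use assms in simp)
  then have "dpow (ad H) k P = (if k = 0 then P else 0)" for k
    by (cases k) (simp_all add: dpow_def)
  then have "coeff2 (dpow (ad H) k P) i j = (if k = 0 then coeff2 P i j else 0)" for k
    by simp
  then show "coeff2 (lexp (ad H) P) i j = coeff2 P i j"
    by (simp add: lexp_def sum.delta)
qed

lemma lexp_ad_const2: "lexp (ad H) (const2 c) = const2 c"
  by (rule lexp_ad_fixed) simp

lemma lexp_ad_1: "lexp (ad H) 1 = 1"
  by (rule lexp_ad_fixed) simp

lemma lexp_ad_power: "lexp (ad H) (P ^ k) = lexp (ad H) P ^ k"
  by (induction k) (simp_all add: lexp_ad_1 lexp_ad_mult)

lemma nc_flow: "nc (flow H)"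
  unfolding nc_def flow_def fst_conv snd_conv
  using raising_vanish [OF raising_lexp_ad vanish_X2] raising_vanish [OF raising_lexp_ad vanish_Y2]
  by simp

text \<open>The exponential of a derivation is multiplicative and hence is itself a substitution,
  determined by the images of the coordinates. From here on flows can be treated as Lie
  series.\<close>

lemma gsubst2_flow: "gsubst2 P (flow H) = lexp (ad H) P"
proof (rule fcont_eqI [of "\<lambda>P. gsubst2 P (flow H)" "lexp (ad H)"])
  show "fcont (\<lambda>P. gsubst2 P (flow H))" by (rule fcont_gsubst2 [OF nc_flow])
  show "fcont (lexp (ad H))" by (rule raising_fcont [OF raising_lexp_ad])
  show "gsubst2 (mono2 c i j) (flow H) = lexp (ad H) (mono2 c i j)" for c i j
    by (simp add: gsubst2_mono2 [OF nc_flow])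
       (simp add: mono2_def lexp_ad_mult lexp_ad_const2 lexp_ad_power flow_def)
qed

lemma lexp_ad_inverse: "lexp (ad (- H)) (lexp (ad H) P) = P"
  using lexp_inverse [OF raising_ad3 [OF H], of P] by (simp add: br_uminus_right)

end

lemma canon_flow:
  assumes H: "vanish 3 H"
  shows "canon (flow H)"
proof -
  have mH: "vanish 3 (- H)" using H by (rule vanish_uminus)
  have "br (fst (flow H)) (snd (flow H)) = 1"
    by (simp add: flow_def lexp_ad_br [OF H, symmetric] lexp_ad_1 [OF H])
  moreover have "gcomp (flow H) (flow (- H)) = (X2, Y2)"
    by (simp add: gcomp_def gsubst2_flow [OF mH]) (simp add: flow_def lexp_ad_inverse [OF H])
  moreover have "gcomp (flow (- H)) (flow H) = (X2, Y2)"
    using lexp_ad_inverse [OF mH]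
    by (simp add: gcomp_def gsubst2_flow [OF H]) (simp add: flow_def)
  ultimately show ?thesis
    unfolding canon_def using nc_flow [OF H] nc_flow [OF mH] by blast
qed

text \<open>Substitution by a canonical map respects the bracket and so intertwines
  \<open>ad H\<close> with \<open>ad\<close> of the transported Hamiltonian; the exponentials
  follow.\<close>

lemma gsubst2_lexp_ad:
  assumes C: "canon C" and H: "vanish 3 H"
  shows "gsubst2 (lexp (ad H) P) C = lexp (ad (gsubst2 H C)) (gsubst2 P C)"
  by (rule lexp_intertwine [OF raising_ad3 [OF H] raising_ad3 raising_gsubst2])
     (simp_all add: C H canon_nc vanish_gsubst2 gsubst2_br)

section \<open>Formal flows: existence, and uniqueness of the time-one map\<close>

lemma dpow_ad_scale: "dpow (ad (const2 t * H)) k P = const2 (t ^ k) * dpow (ad H) k P"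
proof -
  have "(ad (const2 t * H) ^^ k) P = const2 (t ^ k) * (ad H ^^ k) P"
  proof (induction k)
    case (Suc k)
    have "(ad (const2 t * H) ^^ Suc k) P = ad (const2 t * H) (const2 (t ^ k) * (ad H ^^ k) P)"
      by (simp only: funpow.simps comp_def Suc.IH)
    then show ?case
      by (simp only: funpow.simps comp_def br_const_right br_const_left const2_mult_mult power_Suc)
  qed simp
  then show ?thesis by (simp only: dpow_def const2_mult_mult mult.commute)
qed

lemma coeff2_lexp_scale:
  assumes H: "vanish 3 H" and N: "i + j < N"
  shows "coeff2 (lexp (ad (const2 t * H)) P) i j = (\<Sum>k<N. coeff2 (dpow (ad H) k P) i j * t ^ k)"
  by (subst coeff2_lexp [OF raising_ad3 N])
     (simp_all add: vanish_const2_mult H dpow_ad_scale del: const2_power, simp add: mult.commute)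

lemma sum_powers_has_derivative:
  fixes c :: "nat \<Rightarrow> real"
  shows "((\<lambda>t. \<Sum>k<Suc N. c k * t ^ k) has_real_derivative (\<Sum>k<N. real (Suc k) * c (Suc k) * t ^ k)) (at t)"
proof (induction N)
  case (Suc N)
  have "((\<lambda>t. c (Suc N) * t ^ Suc N) has_real_derivative real (Suc N) * c (Suc N) * t ^ N) (at t)"
    by (intro DERIV_cong [OF DERIV_cmult [OF DERIV_pow]]) simp
  from DERIV_add [OF Suc.IH this] show ?case by simp
qed simp

text \<open>For fixed \<open>i\<close>, \<open>j\<close> the coefficient is a polynomial in
  \<open>t\<close>, so the differential equation is an identity between finitely many
  coefficients.\<close>

lemma lexp_scale_has_derivative:
  assumes H: "vanish 3 H"
  shows "((\<lambda>t. coeff2 (lexp (ad (const2 t * H)) P) i j) has_real_derivative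
    coeff2 (lexp (ad (const2 t * H)) (br P H)) i j) (at t)"
proof -
  define N where "N = i + j + 1"
  have N: "i + j < N" "i + j < Suc N" by (simp_all add: N_def)
  have "(ad H ^^ k) (ad H P) = (ad H ^^ Suc k) P" for k
    by (simp only: funpow_Suc_right comp_def)
  moreover have "1 / fact k = real (Suc k) * (1 / fact (Suc k))" for k
    by simp
  ultimately have d: "coeff2 (dpow (ad H) k (br P H)) i j = real (Suc k) * coeff2 (dpow (ad H) (Suc k) P) i j" for k
    unfolding dpow_def coeff2_const_mult by (metis mult.assoc)
  show ?thesis
    using sum_powers_has_derivative [of "\<lambda>k. coeff2 (dpow (ad H) k P) i j" N t]
      coeff2_lexp_scale [OF H N(2), of _ P] coeff2_lexp_scale [OF H N(1), of t "br P H"]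
    by (simp only: d)
qed

lemma formal_ham_flow_flow:
  assumes H: "vanish 3 H"
  shows "formal_ham_flow H (\<lambda>t. flow (const2 t * H))"
proof -
  have tH: "vanish 3 (const2 t * H)" for t using H by (rule vanish_const2_mult)
  have "flow (const2 0 * H) = fid"
    using lexp_ad_fixed [of 0] by (simp add: flow_def fid_def br_def)
  moreover have "coeff2 (subst2 (dY H) (flow (const2 t * H))) i j = coeff2 (lexp (ad (const2 t * H)) (br X2 H)) i j"
    "- coeff2 (subst2 (dX H) (flow (const2 t * H))) i j = coeff2 (lexp (ad (const2 t * H)) (br Y2 H)) i j" for t i j
    by (simp_all add: subst2_eq_gsubst2 gsubst2_flow [OF tH] br_X2 br_Y2 dX_eq_gdX dY_eq_gdY
        fcont_uminus [OF raising_fcont [OF raising_lexp_ad [OF tH]]])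
  ultimately show ?thesis
    unfolding formal_ham_flow_def no_const_eq_nc using nc_flow [OF tH] lexp_scale_has_derivative [OF H]
    by (simp add: flow_def)
qed

text \<open>The equations are triangular with respect to the degree, as \<open>\<nabla>H\<close> has no linear part.\<close>

lemma formal_ham_flow_unique:
  assumes H: "vanish 3 H" and F: "formal_ham_flow H \<Phi>" and G: "formal_ham_flow H \<Psi>"
  shows "\<Phi> t = \<Psi> t"
proof -
  have nF: "nc (\<Phi> t)" and nG: "nc (\<Psi> t)" for t
    using F G by (auto simp: formal_ham_flow_def no_const_eq_nc)
  have v: "vanish 2 (gdX H)" "vanish 2 (gdY H)"
    using vanish_gdX [OF H] vanish_gdY [OF H] by simp_all
  have "\<forall>t. vanish (Suc k) (fst (\<Phi> t) - fst (\<Psi> t)) \<and> vanish (Suc k) (snd (\<Phi> t) - snd (\<Psi> t))" for k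
  proof (induction k)
    case 0
    then show ?case using nF nG by (auto simp: nc_def intro: vanish_diff)
  next
    case (Suc k)
    \<comment> \<open>The gradient has order 2, so the right-hand sides agree one degree further
      than the solutions. In that degree the difference of the solutions is constant in
      \<open>t\<close> and starts at 0.\<close>
    have c: "vanish (k + 2) (gsubst2 (gdX H) (\<Phi> t) - gsubst2 (gdX H) (\<Psi> t))"
      "vanish (k + 2) (gsubst2 (gdY H) (\<Phi> t) - gsubst2 (gdY H) (\<Psi> t))" for t
      using Suc.IH gsubst2_cong_vanish [OF nF nG, of k t t 2] v by simp_all
    have "coeff2 (fst (\<Phi> t) - fst (\<Psi> t)) i j = 0 \<and> coeff2 (snd (\<Phi> t) - snd (\<Psi> t)) i j = 0"
      if "i + j < Suc (Suc k)" for t i j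
    proof
      have "((\<lambda>t. coeff2 (fst (\<Phi> t)) i j - coeff2 (fst (\<Psi> t)) i j) has_real_derivative 0) (at t)" for t
      proof -
        have "((\<lambda>t. coeff2 (fst (\<Phi> t)) i j - coeff2 (fst (\<Psi> t)) i j) has_real_derivative
          (coeff2 (subst2 (dY H) (\<Phi> t)) i j - coeff2 (subst2 (dY H) (\<Psi> t)) i j)) (at t)"
          using F G unfolding formal_ham_flow_def by (intro DERIV_diff) blast+
        then show ?thesis using vanishD [OF c(2) that[THEN less_le_trans], of t]
          by (simp add: subst2_eq_gsubst2 dY_eq_gdY)
      qed
      then have "coeff2 (fst (\<Phi> t)) i j - coeff2 (fst (\<Psi> t)) i j = coeff2 (fst (\<Phi> 0)) i j - coeff2 (fst (\<Psi> 0)) i j"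
        using DERIV_isconst_all by fastforce
      then show "coeff2 (fst (\<Phi> t) - fst (\<Psi> t)) i j = 0"
        using F G by (simp add: formal_ham_flow_def)
    next
      have "((\<lambda>t. coeff2 (snd (\<Phi> t)) i j - coeff2 (snd (\<Psi> t)) i j) has_real_derivative 0) (at t)" for t
      proof -
        have "((\<lambda>t. coeff2 (snd (\<Phi> t)) i j - coeff2 (snd (\<Psi> t)) i j) has_real_derivative
          (- coeff2 (subst2 (dX H) (\<Phi> t)) i j - - coeff2 (subst2 (dX H) (\<Psi> t)) i j)) (at t)"
          using F G unfolding formal_ham_flow_def by (intro DERIV_diff) blast+
        then show ?thesis using vanishD [OF c(1) that[THEN less_le_trans], of t]
          by (simp add: subst2_eq_gsubst2 dX_eq_gdX)
      qed
      then have "coeff2 (snd (\<Phi> t)) i j - coeff2 (snd (\<Psi> t)) i j = coeff2 (snd (\<Phi> 0)) i j - coeff2 (snd (\<Psi> 0)) i j"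
        using DERIV_isconst_all by fastforce
      then show "coeff2 (snd (\<Phi> t) - snd (\<Psi> t)) i j = 0"
        using F G by (simp add: formal_ham_flow_def)
    qed
    then show ?case by (simp add: vanish_def)
  qed
  then have "vanish k (fst (\<Phi> t) - fst (\<Psi> t))" "vanish k (snd (\<Phi> t) - snd (\<Psi> t))" for k
    using vanish_mono [OF _ le_SucI [OF order_refl]] by blast+
  then have "fst (\<Phi> t) - fst (\<Psi> t) = 0" "snd (\<Phi> t) - snd (\<Psi> t) = 0"
    using vanish_all by blast+
  then show ?thesis by (simp add: prod_eq_iff)
qed

lemma time_one_map_iff:
  assumes H: "vanish 3 H"
  shows "time_one_map H G \<longleftrightarrow> G = flow H"
proof -
  have "flow H = (\<lambda>t. flow (const2 t * H)) 1" by simp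
  then show ?thesis
    unfolding time_one_map_def
    using formal_ham_flow_flow [OF H] formal_ham_flow_unique [OF H] by metis
qed

subsection \<open>Agreement of formal maps up to a degree\<close>

definition agree :: "nat \<Rightarrow> fmap \<Rightarrow> fmap \<Rightarrow> bool" where
  "agree d F G \<longleftrightarrow> vanish d (fst F - fst G) \<and> vanish d (snd F - snd G)"

lemma agree_refl: "agree d F F"
  and agree_sym: "agree d F G \<Longrightarrow> agree d G F"
  and agree_trans: "agree d F G \<Longrightarrow> agree d G H \<Longrightarrow> agree d F H"
  and agree_mono: "agree d F G \<Longrightarrow> e \<le> d \<Longrightarrow> agree e F G"
  by (auto simp: agree_def intro: vanish_diff_sym vanish_diff_trans vanish_mono)

lemma agree_all: "(\<And>d. agree d F G) \<Longrightarrow> F = G"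
  using vanish_all [of "fst F - fst G"] vanish_all [of "snd F - snd G"]
  by (simp add: agree_def prod_eq_iff)

lemma gsubst2_agree:
  assumes "nc G" "nc G'" "agree (k + 1) G G'" "vanish p P"
  shows "vanish (k + p) (gsubst2 P G - gsubst2 P G')"
  using gsubst2_cong_vanish [of G G' k p P] assms by (simp add: agree_def)

lemma agree_gcomp:
  assumes "nc F" "nc G" "nc G'" "agree d F F'" "agree d G G'"
  shows "agree d (gcomp F G) (gcomp F' G')"
proof (cases d)
  case 0
  then show ?thesis by (simp add: agree_def)
next
  case (Suc k)
  have "vanish d (gsubst2 P G - gsubst2 P' G')" if "vanish 1 P" "vanish d (P - P')" for P P'
  proof -
    have "vanish d (gsubst2 P G - gsubst2 P G')"
      using gsubst2_agree [of G G' k 1 P] assms that Suc by simp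
    moreover have "vanish d (gsubst2 P G' - gsubst2 P' G')"
      using vanish_gsubst2 [OF assms(3) that(2)] by (simp add: gsubst2_diff assms)
    ultimately show ?thesis by (rule vanish_diff_trans)
  qed
  then show ?thesis using assms by (simp add: agree_def gcomp_def nc_def)
qed

text \<open>A coordinate function has order 1, which accounts for the shift between agreement of
  maps to order \<open>k + 1\<close> and a gain of \<open>k\<close> for their operators.\<close>

lemma agree_opcong:
  assumes "nc F" "nc G" "agree (k + 1) F G"
  shows "opcong k (\<lambda>P. gsubst2 P F) (\<lambda>P. gsubst2 P G)"
  unfolding opcong_def using gsubst2_agree [OF assms] by (simp add: add.commute)

lemma opcong_agree:
  assumes "nc F" "nc G" "opcong k (\<lambda>P. gsubst2 P F) (\<lambda>P. gsubst2 P G)"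
  shows "agree (k + 1) F G"
  using opcongD [OF assms(3) vanish_X2] opcongD [OF assms(3) vanish_Y2]
  by (simp add: agree_def gsubst2_basic [OF assms(1)] gsubst2_basic [OF assms(2)])

lemma agree_inverse:
  assumes n: "nc C" "nc C'" "nc D" "nc D'" and ag: "agree d C C'"
    and inv: "gcomp C D = (X2, Y2)" "gcomp D' C' = (X2, Y2)"
  shows "agree d D D'"
proof -
  have "agree d (gcomp D' (gcomp C D)) (gcomp D' (gcomp C' D))"
    by (intro agree_gcomp agree_refl ag n nc_gcomp)
  moreover have "gcomp D' (gcomp C' D) = D"
    by (simp add: gcomp_assoc [symmetric] n inv id_gcomp)
  ultimately show ?thesis by (simp add: inv agree_sym)
qed

subsection \<open>Leading terms of canonical maps are Hamiltonian\<close>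

definition hom2 :: "nat \<Rightarrow> 'a::comm_ring_1 fps fps \<Rightarrow> bool" where
  "hom2 d P \<longleftrightarrow> (\<forall>i j. i + j \<noteq> d \<longrightarrow> coeff2 P i j = 0)"

lemma hom2_vanish: "hom2 d P \<Longrightarrow> vanish d P"
  by (simp add: hom2_def vanish_def)

lemma vanish_Suc_gradient:
  fixes P :: fps2
  assumes "vanish k (gdX P)" "vanish k (gdY P)" "vanish 1 P"
  shows "vanish (Suc k) P"
proof (rule vanishI)
  fix i j :: nat assume ij: "i + j < Suc k"
  consider "i = 0" "j = 0" | i' where "i = Suc i'" | j' where "j = Suc j'"
    by (cases i; cases j) auto
  then show "coeff2 P i j = 0"
  proof cases
    case 1
    then show ?thesis using assms(3) by (simp add: vanishD)
  next
    case 2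
    then have "coeff2 (gdX P) i' j = 0" using ij by (intro vanishD [OF assms(1)]) simp
    with 2 show ?thesis by (simp add: coeff2_gdX del: of_nat_Suc)
  next
    case 3
    then have "coeff2 (gdY P) i j' = 0" using ij by (intro vanishD [OF assms(2)]) simp
    with 3 show ?thesis by (simp add: coeff2_gdY del: of_nat_Suc)
  qed
qed

text \<open>Write the map as the identity plus \<open>(v, w)\<close>. Jacobian 1 means that the
  divergence of \<open>(v, w)\<close> is minus a bracket of order at least \<open>2 d - 2\<close>,
  hence at least \<open>d\<close>. The part of degree \<open>d\<close> is therefore divergence-free,
  and such a polynomial field in the plane has a Hamiltonian.\<close>

lemma symp_leading_hamiltonian:
  assumes C: "symp D" and ag: "agree d D (X2, Y2)" and d: "d \<ge> 2"
  obtains g where "hom2 (d + 1) g" "vanish (d + 1) (fst D - X2 - gdY g)"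
    "vanish (d + 1) (snd D - Y2 + gdX g)"
proof -
  define v w where "v = fst D - X2" and "w = snd D - Y2"
  have v: "vanish d v" "vanish d w" using ag by (simp_all add: agree_def v_def w_def)
  have D: "fst D = X2 + v" "snd D = Y2 + w" by (simp_all add: v_def w_def)
  have "br v w + (gdX v + gdY w) = 0"
    using C unfolding symp_def D by (simp add: br_def gdX_add gdY_add algebra_simps)
  then have "- br v w = gdX v + gdY w" by (rule minus_unique)
  then have "vanish (d + d - 2) (gdX v + gdY w)"
    using vanish_uminus [OF vanish_br_sub [OF v]] by simp
  then have div0: "real (Suc i) * coeff2 v (Suc i) j + real (Suc j) * coeff2 w i (Suc j) = 0"
    if "i + j + 1 = d" for i j
    using vanishD [of "d + d - 2" "gdX v + gdY w" i j] that d
    by (simp add: coeff2_gdX coeff2_gdY)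
  \<comment> \<open>Terms containing \<open>y\<close> are found by integrating \<open>v\<close> in
    \<open>y\<close>; only the pure power of \<open>x\<close> has to be taken from \<open>w\<close>.
    Vanishing divergence reconciles the remaining coefficients of \<open>w\<close>.\<close>
  define g :: fps2 where "g = mk_fps2 (\<lambda>i j. if i + j \<noteq> d + 1 then 0
      else if j > 0 then coeff2 v i (j - 1) / real j else - coeff2 w (i - 1) j / real i)"
  have "hom2 (d + 1) g" by (simp add: hom2_def g_def)
  moreover have "vanish (d + 1) (v - gdY g)"
  proof (rule vanishI)
    fix i j :: nat assume "i + j < d + 1"
    then show "coeff2 (v - gdY g) i j = 0"
      using vanishD [OF v(1), of i j] by (auto simp: coeff2_gdY g_def)
  qed
  moreover have "vanish (d + 1) (w + gdX g)"
  proof (rule vanishI)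
    fix i j :: nat assume ij: "i + j < d + 1"
    show "coeff2 (w + gdX g) i j = 0"
    proof (cases "i + j = d \<and> j > 0")
      case True
      then obtain j' where j': "j = Suc j'" by (cases j) auto
      with True have "real (Suc i) * coeff2 v (Suc i) j' + real (Suc j') * coeff2 w i (Suc j') = 0"
        by (intro div0) simp
      with True j' show ?thesis by (simp add: coeff2_gdX g_def field_simps)
    next
      case False
      then show ?thesis
        using ij vanishD [OF v(2), of i j] by (auto simp: coeff2_gdX g_def)
    qed
  qed
  ultimately show ?thesis by (intro that) (simp_all add: v_def w_def)
qed

text \<open>\<open>D\<close> agrees with the flow of \<open>g\<close> one degree beyond its
  agreement with the identity; for \<open>d \<ge> 2\<close> the quadratic term of that flow already
  lies beyond the precision \<open>d\<close>.\<close>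

lemma symp_leading_op:
  assumes C: "symp D" and ag: "agree d D (X2, Y2)" and d: "d \<ge> 2"
  obtains g where "hom2 (d + 1) g" "opcong d (\<lambda>P. gsubst2 P D) (\<lambda>P. P + br P g)"
proof -
  obtain g where g: "hom2 (d + 1) g" "vanish (d + 1) (fst D - X2 - gdY g)"
    "vanish (d + 1) (snd D - Y2 + gdX g)"
    using symp_leading_hamiltonian [OF assms] .
  have vg: "vanish (d - 1 + 2) g" using hom2_vanish [OF g(1)] d by simp
  then have g3: "vanish 3 g" by (rule vanish_mono) (use d in simp)
  have lex: "opcong d (lexp (ad g)) (\<lambda>P. P + br P g)"
    by (rule opcong_mono [OF opcong_lexp_2 [OF raising_ad [OF vg]]]) (use d in auto)
  have "vanish (d + 1) (fst D - fst (flow g))"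
    using vanish_diff [OF g(2) opcongD [OF lex vanish_X2, unfolded add.commute [of 1]]]
    by (simp add: flow_def br_X2 algebra_simps)
  moreover have "vanish (d + 1) (snd D - snd (flow g))"
    using vanish_diff [OF g(3) opcongD [OF lex vanish_Y2, unfolded add.commute [of 1]]]
    by (simp add: flow_def br_Y2 algebra_simps)
  ultimately have "agree (d + 1) D (flow g)" by (simp add: agree_def)
  from agree_opcong [OF symp_nc [OF C] nc_flow [OF g3] this]
  have "opcong d (\<lambda>P. gsubst2 P D) (lexp (ad g))"
    by (simp add: gsubst2_flow [OF g3])
  with lex g(1) that show ?thesis using opcong_trans by blast
qed

subsection \<open>Effect of a change of variables on the leading terms\<close>

lemma opcong_ad: "vanish (s + 2) (g - g') \<Longrightarrow> opcong s (ad g) (ad g')"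
  using raising_vanish [OF raising_ad [of s "g - g'"]] by (simp add: opcong_def br_diff_right)

lemma opcong_comp:
  assumes "opcong s A A'" "opcong s B B'" "raising 0 A'" "raising 0 B"
  shows "opcong s (\<lambda>P. A (B P)) (\<lambda>P. A' (B' P))"
  using opcong_trans [of s "\<lambda>P. A (B P)" "\<lambda>P. A' (B P)"]
    opcong_comp_right [OF assms(1,4)] opcong_comp_left [OF assms(2,3)] by simp

lemma opcong_absorb:
  assumes "opcong 1 A (\<lambda>P. P)" "raising r S"
  shows "opcong (Suc r) (\<lambda>P. A (S P)) S"
  using opcong_comp_right [OF assms] by simp

lemma opcong_absorb_right:
  assumes "opcong 1 A (\<lambda>P. P)" "raising r S"
  shows "opcong (Suc r) (\<lambda>P. S (A P)) S"
  using opcong_comp_left [OF assms] by simp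

lemma opcong_perturb_ad:
  assumes "vanish 3 H" "vanish (d + 1) g" "d \<ge> 2"
  shows "opcong d (lexp (ad (H + g))) (\<lambda>P. lexp (ad H) P + br P g)"
proof -
  have "raising (d - 1) (ad g)" by (rule raising_ad) (use assms in simp)
  from opcong_lexp_perturb [OF raising_ad3 [OF assms(1)] this] assms(3)
  show ?thesis by (simp add: br_add_right)
qed

text \<open>Here the generators have the order of the error \<open>g\<close>, so each bracket
  between two of \<open>\<eta>\<close>, \<open>\<eta>'\<close>, \<open>g\<close>, \<open>H\<close>
  is negligible. The two outer exponentials contribute their first-order terms only, which differ
  because a rotation will have passed between them.\<close>

lemma conj_nonresonant:
  assumes H: "vanish 3 H" and chi: "vanish (d + 1) \<eta>" "vanish (d + 1) \<eta>'"
    and g: "vanish (d + 1) g" and d: "d \<ge> 2"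
  shows "opcong d (\<lambda>Q. lexp (ad (- \<eta>)) (lexp (ad H) (lexp (ad \<eta>') Q) + br (lexp (ad \<eta>') Q) g))
     (\<lambda>Q. lexp (ad H) Q + br Q (g + \<eta>' - \<eta>))"
proof -
  have dd: "Suc (d - 1) = d" "d \<le> 2 * (d - 1)" "1 \<le> d - 1" using d by auto
  note absorb = opcong_absorb [where r = "d - 1", unfolded dd(1)]
    and absorb_right = opcong_absorb_right [where r = "d - 1", unfolded dd(1)]
  have r: "raising (d - 1) (ad \<eta>')" "raising (d - 1) (ad (- \<eta>))" "raising (d - 1) (ad g)"
    using raising_ad_minus [OF chi(2)] raising_ad_minus [OF vanish_uminus [OF chi(1)]]
      raising_ad_minus [OF g] d by simp_all
  have H1: "opcong 1 (lexp (ad H)) (\<lambda>P. P)"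
    by (rule opcong_lexp_1 [OF raising_ad3 [OF H]]) simp
  have c1: "opcong 1 (lexp (ad \<eta>')) (\<lambda>P. P)"
    by (rule opcong_mono [OF opcong_lexp_1 [OF r(1)]]) (use dd in auto)
  have c2: "opcong d (lexp (ad \<eta>')) (\<lambda>P. P + br P \<eta>')" "opcong d (lexp (ad (- \<eta>))) (\<lambda>P. P + br P (- \<eta>))"
    by (rule opcong_mono [OF opcong_lexp_2 [OF r(1) dd(3)] dd(2)], rule opcong_mono [OF opcong_lexp_2 [OF r(2) dd(3)] dd(2)])
  note rH = raising_lexp_ad [OF H]
  define V where "V = (\<lambda>Q. lexp (ad H) Q + br Q \<eta>' + br Q g)"
  have 1: "opcong d (\<lambda>Q. lexp (ad H) (lexp (ad \<eta>') Q)) (\<lambda>Q. lexp (ad H) Q + br Q \<eta>')"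
  proof -
    have "opcong d (\<lambda>Q. lexp (ad H) (lexp (ad \<eta>') Q)) (\<lambda>Q. lexp (ad H) (Q + br Q \<eta>'))"
      using opcong_comp_left [OF c2(1) rH] by simp
    moreover have "opcong d (\<lambda>Q. lexp (ad H) Q + lexp (ad H) (br Q \<eta>')) (\<lambda>Q. lexp (ad H) Q + br Q \<eta>')"
      by (rule opcong_add [OF opcong_refl absorb [OF H1 r(1)]])
    ultimately show ?thesis unfolding raising_add [OF rH] by (rule opcong_trans)
  qed
  have 2: "opcong d (\<lambda>Q. br (lexp (ad \<eta>') Q) g) (ad g)"
    by (rule absorb_right [OF c1 r(3)])
  have V: "opcong d (\<lambda>Q. lexp (ad H) (lexp (ad \<eta>') Q) + br (lexp (ad \<eta>') Q) g) V"
    unfolding V_def by (rule opcong_add [OF 1 2])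
  have rV: "raising 0 V"
    unfolding V_def
    by (intro raising_plus rH raising_mono [OF r(1)] raising_mono [OF r(3)] le0)
  have V1: "opcong 1 V (\<lambda>P. P)"
  proof -
    have "opcong 1 V (\<lambda>Q. lexp (ad H) Q)"
      unfolding V_def
      by (rule opcong_trans [OF opcong_raising0 [OF raising_mono [OF r(3) dd(3)]]
            opcong_raising0 [OF raising_mono [OF r(1) dd(3)]]])
    then show ?thesis using H1 opcong_trans by blast
  qed
  have "raising 0 (lexp (ad (- \<eta>)))"
    by (rule raising_lexp [OF raising_mono [OF r(2)]]) (use dd in auto)
  from opcong_comp_left [OF V this]
  have "opcong d (\<lambda>Q. lexp (ad (- \<eta>)) (lexp (ad H) (lexp (ad \<eta>') Q) + br (lexp (ad \<eta>') Q) g)) (\<lambda>Q. lexp (ad (- \<eta>)) (V Q))"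
    by simp
  also have "opcong d (\<lambda>Q. lexp (ad (- \<eta>)) (V Q)) (\<lambda>Q. V Q + br (V Q) (- \<eta>))"
    using opcong_comp_right [OF c2(2) rV] by simp
  also have "opcong d (\<lambda>Q. V Q + br (V Q) (- \<eta>)) (\<lambda>Q. V Q + br Q (- \<eta>))"
    by (rule opcong_add [OF opcong_refl absorb_right [OF V1 r(2)]])
  finally show ?thesis
    by (simp add: V_def br_add_right br_diff_right br_uminus_right algebra_simps)
qed

text \<open>The generator may have lower order than \<open>g\<close>, so a first-order expansion of
  the two outer exponentials would be too coarse. Instead the conjugation is transferred exactly to
  the Hamiltonian. The quadratic term of the transferred \<open>H\<close> has order
  \<open>n + 2 (m - 2) = d + m - 1 \<ge> d + 2\<close>, so only \<open>br \<eta> H\<close>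
  remains.\<close>

lemma conj_resonant:
  assumes H: "vanish n H" "n \<ge> 3" and chi: "vanish m \<eta>" "m \<ge> 3"
    and g: "vanish (d + 1) g" and d: "m + n = d + 3"
  shows "opcong d (\<lambda>Q. lexp (ad (- \<eta>)) (lexp (ad H) (lexp (ad \<eta>) Q) + br (lexp (ad \<eta>) Q) g))
     (\<lambda>Q. lexp (ad H) Q + br Q (g + br \<eta> H))"
proof -
  have H3: "vanish 3 H" and chi3: "vanish 3 \<eta>" "vanish 3 (- \<eta>)"
    using H chi vanish_mono vanish_uminus by blast+
  have r: "raising (m - 2) (ad (- \<eta>))" using chi vanish_uminus [of m \<eta>] by (intro raising_ad_minus) auto
  define \<delta> where "\<delta> = lexp (ad (- \<eta>)) H - H"
  have "vanish (n + (2 * (m - 2))) (lexp (ad (- \<eta>)) H - (H + br H (- \<eta>)))"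
    using opcongD [OF opcong_lexp_2 [OF r] H(1)] chi by simp
  then have \<delta>1: "vanish (d + 2) (\<delta> - br \<eta> H)"
    using chi d by (auto simp: \<delta>_def br_uminus_right br_antisym [of H \<eta>] algebra_simps elim!: vanish_mono)
  have "vanish (m + (n - 2)) (br \<eta> H)"
    using raising_vanish [OF raising_ad_minus [OF H(1)] chi(1)] H(2) by simp
  then have "vanish (d + 1) (br \<eta> H)" by (rule vanish_mono) (use d H in auto)
  then have \<delta>: "vanish (d + 1) \<delta>"
    using vanish_diff_iff [OF vanish_mono [OF \<delta>1, of "d + 1"]] by simp
  have "lexp (ad (- \<eta>)) (lexp (ad H) (lexp (ad \<eta>) Q)) = lexp (ad (H + \<delta>)) Q" for Q
    using gsubst2_lexp_ad [OF canon_flow [OF chi3(2)] H3, of "lexp (ad \<eta>) Q"]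
    by (simp add: gsubst2_flow [OF chi3(2)] lexp_ad_inverse [OF chi3(1)] \<delta>_def)
  then have eq: "lexp (ad (- \<eta>)) (lexp (ad H) (lexp (ad \<eta>) Q) + br (lexp (ad \<eta>) Q) g) =
      lexp (ad (H + \<delta>)) Q + lexp (ad (- \<eta>)) (br (lexp (ad \<eta>) Q) g)" for Q
    by (simp add: raising_add [OF raising_lexp_ad [OF chi3(2)]])
  have dd: "d \<ge> 2" "Suc (d - 1) = d" using assms by auto
  have 1: "opcong d (lexp (ad (H + \<delta>))) (\<lambda>Q. lexp (ad H) Q + br Q \<delta>)"
    by (rule opcong_perturb_ad [OF H3 \<delta> dd(1)])
  have 2: "opcong d (\<lambda>Q. lexp (ad H) Q + br Q \<delta>) (\<lambda>Q. lexp (ad H) Q + br Q (br \<eta> H))"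
    by (intro opcong_add opcong_refl opcong_ad \<delta>1)
  have rg: "raising (d - 1) (ad g)" by (rule raising_ad) (use g dd in simp)
  have c1: "opcong 1 (lexp (ad \<eta>)) (\<lambda>P. P)" "opcong 1 (lexp (ad (- \<eta>))) (\<lambda>P. P)"
    using opcong_lexp_1 [OF raising_ad3 [OF chi3(1)]] opcong_lexp_1 [OF raising_ad3 [OF chi3(2)]] by simp_all
  have "raising (d - 1) (\<lambda>Q. br (lexp (ad \<eta>) Q) g)"
    using raising_compose [OF rg raising_lexp_ad [OF chi3(1)]] by simp
  from opcong_trans [OF opcong_absorb [OF c1(2) this] opcong_absorb_right [OF c1(1) rg]]
  have 3: "opcong d (\<lambda>Q. lexp (ad (- \<eta>)) (br (lexp (ad \<eta>) Q) g)) (ad g)"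
    unfolding dd(2) .
  have "opcong d (\<lambda>Q. lexp (ad (H + \<delta>)) Q + lexp (ad (- \<eta>)) (br (lexp (ad \<eta>) Q) g))
      (\<lambda>Q. lexp (ad H) Q + br Q (br \<eta> H) + br Q g)"
    by (intro opcong_add [OF opcong_trans [OF 1 2] 3])
  then show ?thesis unfolding eq by (simp add: br_add_right algebra_simps)
qed

text \<open>If the Hamiltonians first differ by \<open>\<delta>\<close>, then the
  \<open>n\<close>-th powers differ to leading order by \<open>n\<close> times the bracket with
  \<open>\<delta>\<close>. Applied to the coordinates this makes the gradient of the leading part of
  \<open>\<delta>\<close> vanish.\<close>

lemma lexp_ad_power_inj:
  assumes H: "vanish 3 H" and K: "vanish 3 K" and n: "n > 0"
    and eq: "\<And>P. (lexp (ad H) ^^ n) P = (lexp (ad K) ^^ n) P"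
  shows "H = K"
proof -
  have "vanish (k + 3) (H - K)" for k
  proof (induction k)
    case 0
    show ?case using vanish_diff [OF H K] by simp
  next
    case (Suc k)
    define \<delta> where "\<delta> = H - K"
    have "k + 1 + 2 = k + 3" by simp
    then have \<delta>: "vanish (k + 1 + 2) \<delta>" unfolding \<delta>_def using Suc.IH by (simp only:)
    have S: "raising (k + 1) (ad \<delta>)" by (rule raising_ad [OF \<delta>])
    let ?X = "lexp (ad H)" and ?Y = "lexp (ad K)"
    have XY: "opcong (k + 2) ?X (\<lambda>P. ?Y P + br P \<delta>)"
      using opcong_perturb_ad [OF K, of "k + 2" \<delta>] \<delta> by (simp add: \<delta>_def)
    have X1: "opcong 1 ?X (\<lambda>P. P)" by (rule opcong_lexp_1 [OF raising_ad3 [OF H]]) simp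
    have Y1: "opcong 1 ?Y (\<lambda>P. P)" by (rule opcong_lexp_1 [OF raising_ad3 [OF K]]) simp
    note rX = raising_lexp_ad [OF H] and rY = raising_lexp_ad [OF K]
    have rYj: "raising 0 (?Y ^^ j)" for j using raising_funpow [OF rY, of j] by simp
    have Yj1: "opcong 1 (?Y ^^ j) (\<lambda>P. P)" for j
    proof (induction j)
      case (Suc j)
      then show ?case using opcong_comp [OF Y1 Suc.IH raising_id rYj] by (simp add: comp_def)
    qed (simp add: opcong_refl id_def)
    have cS: "raising (k + 1) (\<lambda>P. const2 c * br P \<delta>)" for c
      by (rule raising_const_mult [OF S])
    have "opcong (k + 2) (?X ^^ j) (\<lambda>P. (?Y ^^ j) P + const2 (real j) * br P \<delta>)" for j
    proof (induction j)
      case 0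
      then show ?case by (simp add: opcong_refl id_def)
    next
      case (Suc j)
      have "opcong (k + 2) (\<lambda>P. ?X ((?X ^^ j) P)) (\<lambda>P. ?X ((?Y ^^ j) P + const2 (real j) * br P \<delta>))"
        using opcong_comp_left [OF Suc.IH rX] by simp
      also have "(\<lambda>P. ?X ((?Y ^^ j) P + const2 (real j) * br P \<delta>)) = (\<lambda>P. ?X ((?Y ^^ j) P) + ?X (const2 (real j) * br P \<delta>))"
        by (simp add: raising_add [OF rX])
      also have "opcong (k + 2) (\<lambda>P. ?X ((?Y ^^ j) P) + ?X (const2 (real j) * br P \<delta>))
          (\<lambda>P. (?Y ((?Y ^^ j) P) + br ((?Y ^^ j) P) \<delta>) + const2 (real j) * br P \<delta>)"
        by (intro opcong_add) (use opcong_comp_right [OF XY rYj] opcong_absorb [OF X1 cS, of "real j"] in simp_all)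
      also have "opcong (k + 2) (\<lambda>P. (?Y ((?Y ^^ j) P) + br ((?Y ^^ j) P) \<delta>) + const2 (real j) * br P \<delta>)
          (\<lambda>P. (?Y ((?Y ^^ j) P) + br P \<delta>) + const2 (real j) * br P \<delta>)"
        using opcong_absorb_right [OF Yj1 S, of j] by (intro opcong_add opcong_refl) simp
      finally show ?case
        by (simp add: comp_def algebra_simps)
    qed
    note Xn = this [of n]
    have "?X ^^ n = ?Y ^^ n" using eq by (intro ext)
    with Xn have Yn: "opcong (k + 2) (?Y ^^ n) (\<lambda>P. (?Y ^^ n) P + const2 (real n) * br P \<delta>)"
      by (simp only:)
    have v: "vanish (j + (k + 2)) (br P \<delta>)" if "vanish j P" for j P
      using opcongD [OF Yn that] n by (simp add: vanish_def)
    have "vanish (k + 3) (gdY \<delta>)" "vanish (k + 3) (gdX \<delta>)"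
      using v [OF vanish_X2] v [OF vanish_Y2] by (simp_all add: br_X2 br_Y2 vanish_def)
    then show ?case
      using vanish_Suc_gradient [of "k + 3" \<delta>] vanish_mono [OF \<delta>, of 1] by (simp add: \<delta>_def)
  qed
  then have "vanish k (H - K)" for k using vanish_mono [of "k + 3" "H - K" k] by simp
  then show ?thesis using vanish_all by fastforce
qed

subsection \<open>Limits of canonical maps\<close>

text \<open>The coefficients of degree \<open>i + j\<close> are stationary from the index
  \<open>i + j\<close> on, provided that the terms \<open>k\<close> and \<open>k + 1\<close> agree
  up to degree \<open>k\<close>.\<close>

definition limit2 :: "(nat \<Rightarrow> fps2) \<Rightarrow> fps2" where
  "limit2 f = mk_fps2 (\<lambda>i j. coeff2 (f (i + j)) i j)"

lemma limit2_vanish: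
  assumes "\<And>k. vanish (Suc k) (f (Suc k) - f k)"
  shows "vanish (Suc k) (limit2 f - f k)"
proof (rule vanishI)
  fix i j :: nat assume ij: "i + j < Suc k"
  have "i + j \<le> l \<Longrightarrow> coeff2 (f l) i j = coeff2 (f (i + j)) i j" for l
  proof (induction l)
    case (Suc l)
    show ?case
    proof (cases "i + j = Suc l")
      case False
      with Suc.prems have "i + j \<le> l" by simp
      then show ?thesis using Suc.IH vanishD [OF assms, of i j l] by simp
    qed simp
  qed simp
  from this [of k] show "coeff2 (limit2 f - f k) i j = 0"
    using ij by (simp add: limit2_def)
qed

definition limit_map :: "(nat \<Rightarrow> fmap) \<Rightarrow> fmap" where
  "limit_map C = (limit2 (\<lambda>k. fst (C k)), limit2 (\<lambda>k. snd (C k)))"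

lemma limit_map_agree:
  assumes "\<And>k. agree (Suc k) (C (Suc k)) (C k)"
  shows "agree (Suc k) (limit_map C) (C k)"
  unfolding agree_def limit_map_def fst_conv snd_conv
  by (intro conjI limit2_vanish) (use assms in \<open>simp_all add: agree_def\<close>)

lemma canon_limit_map:
  assumes C: "\<And>k. canon (C k)" and ag: "\<And>k. agree (Suc k) (C (Suc k)) (C k)"
  shows "canon (limit_map C)"
proof -
  have "\<forall>k. \<exists>D. canon D \<and> gcomp (C k) D = (X2, Y2) \<and> gcomp D (C k) = (X2, Y2)"
    using canon_inverse [OF C] by metis
  then obtain D where D: "\<And>k. canon (D k)" "\<And>k. gcomp (C k) (D k) = (X2, Y2)"
    "\<And>k. gcomp (D k) (C k) = (X2, Y2)" by metis
  note n = canon_nc [OF C] canon_nc [OF D(1)]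
  have agD: "agree (Suc k) (D (Suc k)) (D k)" for k
    by (rule agree_inverse [OF n(1) n(1) n(2) n(2) ag D(2) D(3)])
  let ?C = "limit_map C" and ?D = "limit_map D"
  note aC = limit_map_agree [of C, OF ag] and aD = limit_map_agree [of D, OF agD]
  have nc_limit: "nc E" if "agree (Suc 0) E E'" "nc E'" for E E' :: fmap
    using that vanish_diff_iff [of "Suc 0"] by (simp add: agree_def nc_def) blast
  have nC: "nc ?C" and nD: "nc ?D"
    using nc_limit [OF aC n(1)] nc_limit [OF aD n(2)] by auto
  have "agree d (gcomp ?C ?D) (X2, Y2)" for d
    using agree_gcomp [OF nC nD n(2) aC aD, of d] D(2) agree_mono [of "Suc d" _ _ d] by simp
  moreover have "agree d (gcomp ?D ?C) (X2, Y2)" for d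
    using agree_gcomp [OF nD nC n(1) aD aC, of d] D(3) agree_mono [of "Suc d" _ _ d] by simp
  moreover have "vanish d (br (fst ?C) (snd ?C) - 1)" for d
  proof -
    \<comment> \<open>Two extra orders compensate for the derivatives in the bracket.\<close>
    have ag2: "agree (d + 2) ?C (C (d + 1))" using aC [of "d + 1"] by simp
    have "br (fst ?C) (snd ?C) - 1 = br (fst ?C - fst (C (d + 1))) (snd ?C) + br (fst (C (d + 1))) (snd ?C - snd (C (d + 1)))"
      using C [of "d + 1"] by (simp add: canon_def br_diff_left br_diff_right)
    moreover have "vanish d (br (fst ?C - fst (C (d + 1))) (snd ?C))"
      using vanish_br_sub [of "d + 2" "fst ?C - fst (C (d + 1))" 0 "snd ?C"] ag2 by (simp add: agree_def)
    moreover have "vanish d (br (fst (C (d + 1))) (snd ?C - snd (C (d + 1))))"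
      using vanish_br_sub [of 0 "fst (C (d + 1))" "d + 2" "snd ?C - snd (C (d + 1))"] ag2 by (simp add: agree_def)
    ultimately show ?thesis by (simp add: vanish_add)
  qed
  then have "br (fst ?C) (snd ?C) = 1" using vanish_all by fastforce
  ultimately show ?thesis
    unfolding canon_def using nC nD agree_all by blast
qed

subsection \<open>Complex coordinates\<close>

definition cx :: "fps2 \<Rightarrow> complex fps fps" where
  "cx P = mk_fps2 (\<lambda>i j. complex_of_real (coeff2 P i j))"

definition re2 :: "complex fps fps \<Rightarrow> fps2" where
  "re2 Q = mk_fps2 (\<lambda>i j. Re (coeff2 Q i j))"

definition cj :: "complex fps fps \<Rightarrow> complex fps fps" where
  "cj Q = mk_fps2 (\<lambda>i j. cnj (coeff2 Q i j))"

text \<open>Complex conjugation of functions in the variables \<open>z\<close>, \<open>w\<close>: it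
  conjugates coefficients and exchanges \<open>z\<close> with \<open>w\<close>. The fixed series are
  those that come from real ones.\<close>

definition swc :: "complex fps fps \<Rightarrow> complex fps fps" where
  "swc Q = mk_fps2 (\<lambda>i j. cnj (coeff2 Q j i))"

text \<open>In the target of \<open>zw\<close> the variables \<open>X2\<close>, \<open>Y2\<close> stand for \<open>z = x + \<i>y\<close> and \<open>w = x - \<i>y\<close>.\<close>

definition xy_of_zw :: "complex fps fps \<times> complex fps fps" where
  "xy_of_zw = (const2 (1/2) * (X2 + Y2), const2 (- \<i>/2) * (X2 - Y2))"

definition zw_of_xy :: "complex fps fps \<times> complex fps fps" where
  "zw_of_xy = (X2 + const2 \<i> * Y2, X2 - const2 \<i> * Y2)"

definition zw :: "fps2 \<Rightarrow> complex fps fps" where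
  "zw P = gsubst2 (cx P) xy_of_zw"

definition zwinv :: "complex fps fps \<Rightarrow> fps2" where
  "zwinv Q = re2 (gsubst2 Q zw_of_xy)"

lemma nc_xy_of_zw: "nc xy_of_zw" and nc_zw_of_xy: "nc zw_of_xy"
  unfolding nc_def xy_of_zw_def zw_of_xy_def fst_conv snd_conv
  by (intro conjI vanish_const2_mult vanish_add vanish_diff vanish_X2 vanish_Y2)+

lemmas coeff2_lin = coeff2_X2 coeff2_Y2 coeff2_const2
lemmas coeff2_linear = coeff2_add coeff2_diff coeff2_uminus coeff2_const_mult coeff2_lin coeff2_1

lemma xy_zw_inverse:
  "gcomp zw_of_xy xy_of_zw = (X2, Y2)" "gcomp xy_of_zw zw_of_xy = (X2, Y2)"
  unfolding gcomp_def prod_eq_iff fst_conv snd_conv zw_of_xy_def [THEN arg_cong [where f = fst], simplified]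
    zw_of_xy_def [THEN arg_cong [where f = snd], simplified]
    xy_of_zw_def [THEN arg_cong [where f = fst], simplified fst_conv]
    xy_of_zw_def [THEN arg_cong [where f = snd], simplified snd_conv]
    gsubst2_add gsubst2_diff [OF nc_xy_of_zw] gsubst2_diff [OF nc_zw_of_xy]
    gsubst2_const_mult [OF nc_xy_of_zw] gsubst2_const_mult [OF nc_zw_of_xy]
    gsubst2_basic [OF nc_xy_of_zw] gsubst2_basic [OF nc_zw_of_xy]
  by (intro conjI; rule fps2_eqI; simp only: coeff2_linear; simp)+

lemma coeff2_cx [simp]: "coeff2 (cx P) i j = complex_of_real (coeff2 P i j)"
  and coeff2_re2 [simp]: "coeff2 (re2 Q) i j = Re (coeff2 Q i j)"
  and coeff2_cj [simp]: "coeff2 (cj Q) i j = cnj (coeff2 Q i j)"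
  and coeff2_swc [simp]: "coeff2 (swc Q) i j = cnj (coeff2 Q j i)"
  by (simp_all add: cx_def re2_def cj_def swc_def)

lemma cx_basic:
  "cx (P + Q) = cx P + cx Q" "cx (P * Q) = cx P * cx Q" "cx X2 = X2" "cx Y2 = Y2"
  "cx (const2 c) = const2 (complex_of_real c)" "cx (gdX P) = gdX (cx P)" "cx (gdY P) = gdY (cx P)"
  "cx (P - Q) = cx P - cx Q"
  by (rule fps2_eqI; simp add: coeff2_mult coeff2_lin coeff2_gdX coeff2_gdY)+

lemma cj_basic:
  "cj (P + Q) = cj P + cj Q" "cj (P * Q) = cj P * cj Q" "cj X2 = X2" "cj Y2 = Y2"
  "cj (const2 c) = const2 (cnj c)" "cj (P - Q) = cj P - cj Q" "cj 1 = 1"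
  by (rule fps2_eqI; simp add: coeff2_mult coeff2_lin coeff2_1)+

lemma swc_mult: "swc (P * Q) = swc P * swc Q"
  by (rule fps2_eqI) (simp add: coeff2_mult, subst sum.swap, rule refl)

lemma swc_basic:
  "swc (P + Q) = swc P + swc Q" "swc X2 = Y2" "swc Y2 = X2"
  "swc (const2 c) = const2 (cnj c)" "swc (P - Q) = swc P - swc Q" "swc 1 = 1"
  by (rule fps2_eqI; auto simp: coeff2_lin coeff2_1)+

lemma swc_power: "swc (P ^ k) = swc P ^ k"
  by (induction k) (simp_all add: swc_basic swc_mult)

lemma cj_power: "cj (P ^ k) = cj P ^ k"
  by (induction k) (simp_all add: cj_basic)

lemma cx_power: "cx (P ^ k) = cx P ^ k"
proof (induction k)
  case 0
  show ?case using cx_basic(5) [of 1] by simp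
qed (simp add: cx_basic)

lemma fcont_cx: "fcont cx" and fcont_cj: "fcont cj" and fcont_swc: "fcont swc"
  by (rule fcontI [of _ 0]; auto simp: cx_basic cj_basic swc_basic vanish_def)+

lemma fcont_zw: "fcont zw"
  using fcont_compose [OF fcont_gsubst2 [OF nc_xy_of_zw] fcont_cx] by (simp add: zw_def [abs_def])

lemmas zw_sum = fcont_sum [OF fcont_zw] and zw_zero = fcont_zero [OF fcont_zw]
  and zw_uminus = fcont_uminus [OF fcont_zw]

lemma zw_basic:
  "zw (P + Q) = zw P + zw Q" "zw (P - Q) = zw P - zw Q" "zw (P * Q) = zw P * zw Q"
  "zw (const2 c) = const2 (complex_of_real c)"
  "zw X2 = const2 (1/2) * (X2 + Y2)" "zw Y2 = const2 (- \<i>/2) * (X2 - Y2)"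
  by (simp_all add: zw_def cx_basic gsubst2_add gsubst2_diff gsubst2_mult gsubst2_basic nc_xy_of_zw)
     (simp_all add: xy_of_zw_def)

lemma zw_one: "zw 1 = 1"
  using zw_basic(4) [of 1] by simp

lemma zw_power: "zw (P ^ k) = zw P ^ k"
  by (simp add: zw_def cx_power gsubst2_power nc_xy_of_zw)

lemma zw_mono2: "zw (mono2 c i j) = const2 (complex_of_real c) * (zw X2 ^ i * zw Y2 ^ j)"
  by (simp only: mono2_def zw_basic(3,4) zw_power)

lemma zw_inverse: "gsubst2 (zw P) zw_of_xy = cx P"
  unfolding zw_def gsubst2_gcomp [OF nc_xy_of_zw nc_zw_of_xy, symmetric] xy_zw_inverse by simp

lemma vanish_zw_iff: "vanish k (zw P) \<longleftrightarrow> vanish k P"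
proof
  assume "vanish k (zw P)"
  then have "vanish k (cx P)"
    using vanish_gsubst2 [OF nc_zw_of_xy] by (simp flip: zw_inverse)
  then show "vanish k P" by (simp add: vanish_def)
next
  assume "vanish k P"
  then have "vanish k (cx P)" by (simp add: vanish_def)
  then show "vanish k (zw P)" unfolding zw_def by (rule vanish_gsubst2 [OF nc_xy_of_zw])
qed

lemma zw_inj: "zw P = zw Q \<Longrightarrow> P = Q"
  by (metis eq_iff_diff_eq_0 vanish_all vanish_zero vanish_zw_iff zw_basic(2))

lemma swc_zw: "swc (zw P) = zw P"
proof (rule fcont_eqI [of "\<lambda>P. swc (zw P)" zw])
  have "swc (zw X2) = zw X2" "swc (zw Y2) = zw Y2"
    unfolding zw_basic by (rule fps2_eqI; simp only: coeff2_swc coeff2_linear; simp)+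
  then show "swc (zw (mono2 c i j)) = zw (mono2 c i j)" for c i j
    by (simp add: zw_mono2 swc_mult swc_power swc_basic)
qed (rule fcont_compose [OF fcont_swc fcont_zw] fcont_zw)+

lemma zw_hermitian: "coeff2 (zw P) l k = cnj (coeff2 (zw P) k l)"
  using coeff2_swc [of "zw P" l k] by (simp add: swc_zw)

text \<open>Hermitian symmetry says that the series has real coefficients in \<open>x\<close>,
  \<open>y\<close>. The real part in \<open>zwinv\<close> then discards nothing and only changes the
  type.\<close>

lemma zw_zwinv:
  assumes "\<And>k l. coeff2 Q l k = cnj (coeff2 Q k l)"
  shows "zw (zwinv Q) = Q"
proof -
  have "cj (gsubst2 Q zw_of_xy) = gsubst2 (swc Q) zw_of_xy" for Q
  proof (rule fcont_eqI [of "\<lambda>Q. cj (gsubst2 Q zw_of_xy)" "\<lambda>Q. gsubst2 (swc Q) zw_of_xy"])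
    fix c i j
    have "swc (mono2 c i j) = mono2 (cnj c) j i"
      by (rule fps2_eqI) (auto simp: coeff2_mono2)
    then show "cj (gsubst2 (mono2 c i j) zw_of_xy) = gsubst2 (swc (mono2 c i j)) zw_of_xy"
      by (simp only: gsubst2_mono2 [OF nc_zw_of_xy])
         (simp add: cj_basic cj_power zw_of_xy_def mult.commute)
  qed (rule fcont_compose [OF fcont_cj fcont_gsubst2 [OF nc_zw_of_xy]]
      fcont_compose [OF fcont_gsubst2 [OF nc_zw_of_xy] fcont_swc])+
  moreover have "swc Q = Q" by (rule fps2_eqI) (simp add: assms [symmetric])
  ultimately have c: "cj (gsubst2 Q zw_of_xy) = gsubst2 Q zw_of_xy" by metis
  have "cx (re2 (gsubst2 Q zw_of_xy)) = gsubst2 Q zw_of_xy"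
  proof (rule fps2_eqI)
    fix i j
    have "cnj (coeff2 (gsubst2 Q zw_of_xy) i j) = coeff2 (gsubst2 Q zw_of_xy) i j"
      using arg_cong [OF c, of "\<lambda>P. coeff2 P i j"] by simp
    then show "coeff2 (cx (re2 (gsubst2 Q zw_of_xy))) i j = coeff2 (gsubst2 Q zw_of_xy) i j"
      by (simp add: complex_eq_iff)
  qed
  then show ?thesis
    by (simp add: zw_def zwinv_def gsubst2_gcomp [OF nc_zw_of_xy nc_xy_of_zw, symmetric] xy_zw_inverse)
qed

text \<open>The factor is the reciprocal of the Jacobian \<open>\<i> / 2\<close> of
  \<open>xy_of_zw\<close>. It makes the later equations pair real parts of one side with imaginary
  parts of the other.\<close>

lemma zw_br: "zw (br P Q) = const2 (- 2 * \<i>) * br (zw P) (zw Q)"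
proof -
  have "br (fst xy_of_zw) (snd xy_of_zw) = const2 (\<i> / 2)"
    unfolding xy_of_zw_def br_def fst_conv snd_conv gdX_const_mult gdY_const_mult gdX_add gdY_add gdX_diff gdY_diff gd_basic
    by (rule fps2_eqI) (simp only: coeff2_linear mult.assoc mult_1_left diff_0 diff_0_right add_0_left add_0_right, simp)
  then have "br (zw P) (zw Q) = zw (br P Q) * const2 (\<i> / 2)"
    unfolding zw_def gsubst2_br_nc [OF nc_xy_of_zw] by (simp add: br_def cx_basic)
  then have "const2 (- 2 * \<i>) * br (zw P) (zw Q) = const2 (- 2 * \<i>) * (const2 (\<i> / 2) * zw (br P Q))"
    by (simp only: mult.commute)
  then show ?thesis by (simp only: const2_mult_mult) simp
qed

section \<open>Rotations in complex coordinates\<close>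

lemma nc_frotation: "nc (frotation \<alpha>)"
  unfolding nc_def frotation_def fst_conv snd_conv
  by (intro conjI vanish_const2_mult vanish_add vanish_diff vanish_X2 vanish_Y2)

lemma coeff2_gsubst2_diagonal:
  "coeff2 (gsubst2 Q (const2 u * X2, const2 v * Y2)) k l = u ^ k * v ^ l * coeff2 Q k l"
proof -
  let ?G = "(const2 u * X2, const2 v * Y2)"
  have n: "nc ?G" by (simp add: nc_def vanish_const2_mult vanish_X2 [simplified] vanish_Y2 [simplified])
  have "gsubst2 Q ?G = mk_fps2 (\<lambda>k l. u ^ k * v ^ l * coeff2 Q k l)"
  proof (rule fcont_eqI [of "\<lambda>Q. gsubst2 Q ?G" "\<lambda>Q. mk_fps2 (\<lambda>k l. u ^ k * v ^ l * coeff2 Q k l)"])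
    show "fcont (\<lambda>Q. gsubst2 Q ?G)" by (rule fcont_gsubst2 [OF n])
    show "fcont (\<lambda>Q. mk_fps2 (\<lambda>k l. u ^ k * v ^ l * coeff2 Q k l))"
      by (rule fcontI [of _ 0]) (rule fps2_eqI, simp add: algebra_simps, simp add: vanish_def)
    fix c i j
    have "gsubst2 (mono2 c i j) ?G = const2 (u ^ i * v ^ j) * mono2 c i j"
      unfolding gsubst2_mono2 [OF n] fst_conv snd_conv
      by (simp add: mono2_def power_mult_distrib mult_ac)
    then show "gsubst2 (mono2 c i j) ?G = mk_fps2 (\<lambda>k l. u ^ k * v ^ l * coeff2 (mono2 c i j) k l)"
      by (intro fps2_eqI) (simp add: coeff2_mono2 del: const2_simps const2_power)
  qed
  then show ?thesis by simp
qed

lemma zw_rotation: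
  "zw (gsubst2 P (frotation \<alpha>)) = gsubst2 (zw P) (const2 (cis \<alpha>) * X2, const2 (cis (- \<alpha>)) * Y2)"
proof -
  let ?G = "(const2 (cis \<alpha>) * X2, const2 (cis (- \<alpha>)) * Y2) :: complex fps fps \<times> complex fps fps"
  have n: "nc ?G" by (simp add: nc_def vanish_const2_mult vanish_X2 [simplified] vanish_Y2 [simplified])
  show ?thesis
  proof (rule fcont_eqI [of "\<lambda>P. zw (gsubst2 P (frotation \<alpha>))" "\<lambda>P. gsubst2 (zw P) ?G"])
    have "zw (fst (frotation \<alpha>)) = gsubst2 (zw X2) ?G" "zw (snd (frotation \<alpha>)) = gsubst2 (zw Y2) ?G"
      unfolding frotation_def fst_conv snd_conv zw_basic gsubst2_const_mult [OF n] gsubst2_add gsubst2_diff [OF n]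
        gsubst2_basic [OF n]
      by (rule fps2_eqI; simp only: coeff2_linear; simp add: complex_eq_iff)+
    then show "zw (gsubst2 (mono2 c i j) (frotation \<alpha>)) = gsubst2 (zw (mono2 c i j)) ?G" for c i j
      by (simp only: gsubst2_mono2 [OF nc_frotation] zw_mono2 zw_basic(3,4) zw_power gsubst2_mult [OF n]
          gsubst2_basic [OF n] gsubst2_power [OF n])
  qed (rule fcont_compose [OF fcont_zw fcont_gsubst2 [OF nc_frotation]]
      fcont_compose [OF fcont_gsubst2 [OF n] fcont_zw])+
qed

text \<open>The reason for using \<open>z\<close> and \<open>w\<close>: their monomials are
  eigenvectors of rotations.\<close>

lemma coeff2_zw_rotation:
  "coeff2 (zw (gsubst2 P (frotation \<alpha>))) k l = cis \<alpha> ^ k * cis (- \<alpha>) ^ l * coeff2 (zw P) k l"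
  by (simp add: zw_rotation coeff2_gsubst2_diagonal)

lemma frotation_add: "gcomp (frotation \<alpha>) (frotation \<beta>) = frotation (\<alpha> + \<beta>)"
  unfolding gcomp_def frotation_def [of \<alpha>] frotation_def [of "\<alpha> + \<beta>"] prod_eq_iff fst_conv snd_conv
    gsubst2_add gsubst2_diff [OF nc_frotation] gsubst2_const_mult [OF nc_frotation] gsubst2_basic [OF nc_frotation]
  by (intro conjI; rule fps2_eqI; simp only: frotation_def fst_conv snd_conv coeff2_linear cos_add sin_add; simp add: algebra_simps)

lemma frotation_0: "frotation 0 = (X2, Y2)"
  by (simp add: frotation_def)

lemma canon_frotation: "canon (frotation \<alpha>)"
proof -
  have "br (const2 c * X2 - const2 s * Y2) (const2 s * X2 + const2 c * Y2) = const2 (c\<^sup>2 + s\<^sup>2)" for c s :: real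
    unfolding br_def gdX_add gdY_add gdX_diff gdY_diff gdX_const_mult gdY_const_mult gd_basic
    by (simp add: power2_eq_square)
  from this [of "cos \<alpha>" "sin \<alpha>"]
  have "br (fst (frotation \<alpha>)) (snd (frotation \<alpha>)) = const2 ((cos \<alpha>)\<^sup>2 + (sin \<alpha>)\<^sup>2)"
    by (simp only: frotation_def fst_conv snd_conv)
  then have "br (fst (frotation \<alpha>)) (snd (frotation \<alpha>)) = 1"
    by (simp only: sin_cos_squared_add2 const2_simps)
  moreover have "gcomp (frotation \<alpha>) (frotation (- \<alpha>)) = (X2, Y2)" "gcomp (frotation (- \<alpha>)) (frotation \<alpha>) = (X2, Y2)"
    by (simp_all add: frotation_add frotation_0)
  ultimately show ?thesis
    unfolding canon_def using nc_frotation by blast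
qed

subsection \<open>The normal form in complex coordinates\<close>

lemma zw_action2: "zw action2 = const2 (1/2) * (X2 * Y2)"
proof -
  have "zw action2 = const2 (1/2) * ((const2 (1/2) * (X2 + Y2))\<^sup>2 + (const2 (- \<i>/2) * (X2 - Y2))\<^sup>2)"
    unfolding action2_def zw_basic zw_power by simp
  also have "(const2 (1/2) * (X2 + Y2))\<^sup>2 + (const2 (- \<i>/2) * (X2 - Y2))\<^sup>2 =
      const2 (1/4) * (X2 + Y2)\<^sup>2 + const2 (- 1/4) * (X2 - Y2 :: complex fps fps)\<^sup>2"
    unfolding power_mult_distrib const2_power [symmetric] by (simp add: power2_eq_square)
  also have "\<dots> = const2 (1/4) * ((X2 + Y2)\<^sup>2 - (X2 - Y2)\<^sup>2)"
    using const2_simps(5) [of "1/4 :: complex"] by (simp add: right_diff_distrib)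
  also have "(X2 + Y2)\<^sup>2 - (X2 - Y2)\<^sup>2 = const2 4 * (X2 * Y2 :: complex fps fps)"
    using const2_simps(3) [of "2::complex" 2] const2_simps(3) [of "1::complex" 1]
    by (simp add: power2_eq_square algebra_simps)
  finally show ?thesis by (simp add: const2_mult_mult del: const2_simps(4))
qed

lemma zw_resonant_term:
  "zw (resonant_term n) = const2 (complex_of_real (2 powr (- real n / 2) / 2)) * (X2 ^ n + Y2 ^ n)"
proof -
  define Q where "Q = fst zw_of_xy ^ n"
  have "cx (re2 Q) = const2 (1/2) * (Q + cj Q)"
    by (rule fps2_eqI) (simp add: complex_eq_iff)
  also have "cj Q = snd zw_of_xy ^ n"
    by (simp add: Q_def cj_power zw_of_xy_def cj_basic)
  finally have "zw (re2 Q) = const2 (1/2) * (X2 ^ n + Y2 ^ n)"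
    using xy_zw_inverse(1)
    by (simp add: zw_def gsubst2_mult gsubst2_basic gsubst2_add gsubst2_power nc_xy_of_zw Q_def gcomp_def)
  moreover have "resonant_term n = const2 (2 powr (- real n / 2)) * re2 Q"
    by (simp add: resonant_term_def re2_def Q_def zw_of_xy_def)
  ultimately show ?thesis
    by (simp only: zw_basic const2_mult_mult) simp
qed

lemma vanish_action2: "vanish 2 action2"
proof -
  have "vanish (1 + 1) (X2 * Y2 :: complex fps fps)" by (rule vanish_mult [OF vanish_X2 vanish_Y2])
  then show ?thesis
    unfolding vanish_zw_iff [of 2 action2, symmetric] zw_action2
    by (intro vanish_const2_mult) (simp add: numeral_2_eq_2)
qed

lemma coeff2_zw_subst1:
  "coeff2 (zw (subst1 A action2)) k l = (if k = l then complex_of_real (fps_nth A k / 2 ^ k) else 0)"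
proof -
  define N where "N = k + l + 1"
  have v: "vanish (2 * m) (action2 ^ m)" for m
    using vanish_power [OF vanish_action2] by (simp add: mult.commute)
  have "vanish N (subst1 A action2 - (\<Sum>m<N. const2 (fps_nth A m) * action2 ^ m))"
  proof (rule vanishI)
    fix i j assume ij: "i + j < N"
    have "(\<Sum>m\<le>i + j. fps_nth A m * coeff2 (action2 ^ m) i j) = (\<Sum>m<N. fps_nth A m * coeff2 (action2 ^ m) i j)"
      using ij vanishD [OF v, of i j] by (intro sum.mono_neutral_left) auto
    then show "coeff2 (subst1 A action2 - (\<Sum>m<N. const2 (fps_nth A m) * action2 ^ m)) i j = 0"
      by (simp add: subst1_def)
  qed
  then have "vanish N (zw (subst1 A action2) - (\<Sum>m<N. zw (const2 (fps_nth A m) * action2 ^ m)))"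
    by (simp flip: vanish_zw_iff add: zw_basic(2) zw_sum)
  then have "coeff2 (zw (subst1 A action2)) k l = (\<Sum>m<N. coeff2 (zw (const2 (fps_nth A m) * action2 ^ m)) k l)"
    using vanishD [of N _ k l] by (force simp: N_def)
  also have "\<dots> = (\<Sum>m<N. if k = m \<and> l = m then complex_of_real (fps_nth A m / 2 ^ m) else 0)"
  proof (intro sum.cong refl)
    fix m
    have "zw (const2 (fps_nth A m) * action2 ^ m) = const2 (complex_of_real (fps_nth A m)) * (const2 ((1/2) ^ m) * (X2 ^ m * Y2 ^ m))"
      by (simp only: zw_basic zw_power zw_action2 power_mult_distrib const2_power)
    also have "\<dots> = mono2 (complex_of_real (fps_nth A m / 2 ^ m)) m m"
      unfolding const2_mult_mult mono2_def by (simp add: power_one_over)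
    finally show "coeff2 (zw (const2 (fps_nth A m) * action2 ^ m)) k l =
        (if k = m \<and> l = m then complex_of_real (fps_nth A m / 2 ^ m) else 0)"
      by (simp add: coeff2_mono2)
  qed
  also have "\<dots> = (if k = l then complex_of_real (fps_nth A k / 2 ^ k) else 0)"
    by (cases "k = l") (auto simp: N_def intro: sum.neutral)
  finally show ?thesis .
qed

text \<open>The extra division by 2 comes from \<open>Re (z^n) = (z^n + w^n) / 2\<close>.\<close>

definition res_factor :: "nat \<Rightarrow> real" where
  "res_factor n = 2 powr (- real n / 2) / 2"

lemma res_factor_pos: "res_factor n > 0"
  by (simp add: res_factor_def)

lemma coeff2_zw_nf:
  "coeff2 (zw (nf_hamiltonian n A B)) k l =
     (if k = l \<and> k \<ge> 2 then complex_of_real (fps_nth A (k - 2) / 2 ^ k) else 0) +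
     complex_of_real (res_factor n) *
       ((if k = l + n then complex_of_real (fps_nth B l / 2 ^ l) else 0) +
        (if l = k + n then complex_of_real (fps_nth B k / 2 ^ k) else 0))"
proof -
  have four: "(2::complex)\<^sup>2 = 4" by simp
  have eq: "zw (nf_hamiltonian n A B) = const2 (1/4) * (X2 ^ 2 * (Y2 ^ 2 * zw (subst1 A action2))) +
      const2 (complex_of_real (res_factor n)) * (X2 ^ n * zw (subst1 B action2) + Y2 ^ n * zw (subst1 B action2))"
    unfolding nf_hamiltonian_def zw_basic zw_power zw_action2 zw_resonant_term res_factor_def
      power_mult_distrib const2_power [symmetric] power_divide one_power2
    by (simp only: mult.assoc distrib_right four)
  show ?thesis
    unfolding eq coeff2_add coeff2_const_mult coeff2_X_power_mult coeff2_Y_power_mult coeff2_zw_subst1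
  proof (intro arg_cong2 [of _ _ _ _ "(+)"] arg_cong2 [of _ _ _ _ "(*)"] refl)
    show "1/4 * (if k < 2 then 0 else if l < 2 then 0
        else if k - 2 = l - 2 then complex_of_real (fps_nth A (k - 2) / 2 ^ (k - 2)) else 0) =
      (if k = l \<and> 2 \<le> k then complex_of_real (fps_nth A (k - 2) / 2 ^ k) else 0)"
    proof (cases "k = l \<and> 2 \<le> k")
      case True
      then obtain m where "k = m + 2" "l = m + 2" by (metis le_add_diff_inverse2)
      then show ?thesis by simp
    qed auto
  qed auto
qed

text \<open>Here \<open>k\<close> is the exponent of \<open>z w\<close>; the coefficient belongs to
  \<open>A\<close> with index \<open>k - 2\<close> because of the prefactor \<open>I^2\<close>. In
  \<open>okB\<close> there is no such shift.\<close>

definition okA :: "nat \<Rightarrow> nat \<Rightarrow> bool" where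
  "okA n k \<longleftrightarrow> k \<ge> 2 \<and> (n = 3 \<longrightarrow> (k - 2) mod 3 \<noteq> 0) \<and> (n = 4 \<longrightarrow> (k - 2) mod 4 \<noteq> 1)"

definition okB :: "nat \<Rightarrow> nat \<Rightarrow> bool" where
  "okB n k \<longleftrightarrow> (n = 3 \<longrightarrow> k mod 3 \<noteq> 2) \<and> (n = 4 \<longrightarrow> k mod 4 \<noteq> 3)"

text \<open>The normal form as a condition on single coefficients in \<open>z\<close>,
  \<open>w\<close>. In this shape it passes to sums and to limits.\<close>

definition nfp :: "nat \<Rightarrow> fps2 \<Rightarrow> bool" where
  "nfp n H \<longleftrightarrow> (\<forall>k l. coeff2 (zw H) k l \<noteq> 0 \<longrightarrow> Im (coeff2 (zw H) k l) = 0 \<and>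
     (k = l \<and> okA n k \<or> k = l + n \<and> okB n l \<or> l = k + n \<and> okB n k))"

lemma nfp_nf_hamiltonian:
  assumes "nf_coeffs n A B" and n: "n > 0"
  shows "nfp n (nf_hamiltonian n A B)"
  unfolding nfp_def
proof (intro allI impI)
  fix k l assume ne: "coeff2 (zw (nf_hamiltonian n A B)) k l \<noteq> 0"
  have "okA n k" if "k = l"
    using that n ne assms by (auto simp: coeff2_zw_nf okA_def nf_coeffs_def split: if_splits)
  moreover have "okB n l" if "k = l + n"
    using that n ne assms by (auto simp: coeff2_zw_nf okB_def nf_coeffs_def split: if_splits)
  moreover have "okB n k" if "l = k + n"
    using that n ne assms by (auto simp: coeff2_zw_nf okB_def nf_coeffs_def split: if_splits)
  moreover have "k = l \<or> k = l + n \<or> l = k + n"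
    using ne by (auto simp: coeff2_zw_nf split: if_splits)
  moreover have "Im (coeff2 (zw (nf_hamiltonian n A B)) k l) = 0"
    by (simp add: coeff2_zw_nf)
  ultimately show "Im (coeff2 (zw (nf_hamiltonian n A B)) k l) = 0 \<and>
      (k = l \<and> okA n k \<or> k = l + n \<and> okB n l \<or> l = k + n \<and> okB n k)"
    by auto
qed

lemma nfp_imp_nf_hamiltonian:
  assumes H: "nfp n H" and n: "n > 0"
  obtains A B where "nf_coeffs n A B" "H = nf_hamiltonian n A B"
proof -
  define c where "c k l = Re (coeff2 (zw H) k l)" for k l
  have re: "coeff2 (zw H) k l = complex_of_real (c k l)" for k l
    using H unfolding nfp_def c_def by (cases "coeff2 (zw H) k l = 0") (auto simp: complex_eq_iff)
  have sym: "c l k = c k l" for k l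
    using zw_hermitian [of H l k] by (simp add: re)
  have z: "c k l = 0" if "\<not> (k = l \<and> okA n k \<or> k = l + n \<and> okB n l \<or> l = k + n \<and> okB n k)" for k l
    using H that unfolding nfp_def re by auto
  \<comment> \<open>The powers of 2 undo \<open>I = z w / 2\<close>.\<close>
  define A where "A = Abs_fps (\<lambda>k. 2 ^ (k + 2) * c (k + 2) (k + 2))"
  define B where "B = Abs_fps (\<lambda>k. 2 ^ k * c (k + n) k / res_factor n)"
  have "nf_coeffs n A B"
    unfolding nf_coeffs_def A_def B_def using n by (auto simp: z okA_def okB_def)
  moreover have "zw H = zw (nf_hamiltonian n A B)"
  proof (rule fps2_eqI)
    fix k l
    have A: "fps_nth A (k - 2) / 2 ^ k = c k k" if "k \<ge> 2"
    proof -
      have "k - 2 + 2 = k" using that by simp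
      then show ?thesis unfolding A_def fps_nth_Abs_fps by (simp only:) simp
    qed
    have B: "res_factor n * (fps_nth B i / 2 ^ i) = c (i + n) i" for i
      using res_factor_pos [of n] by (simp add: B_def)
    consider "k = l" "k < 2" | "k = l" "k \<ge> 2" | "k = l + n" | "l = k + n"
      | "k \<noteq> l" "k \<noteq> l + n" "l \<noteq> k + n" by linarith
    then have "complex_of_real (c k l) = coeff2 (zw (nf_hamiltonian n A B)) k l"
    proof cases
      case 1
      then have "c k l = 0" using n by (intro z) (auto simp: okA_def)
      then show ?thesis using 1 n by (simp add: coeff2_zw_nf)
    next
      case 2
      then show ?thesis using A n by (simp add: coeff2_zw_nf)
    next
      case 3
      then show ?thesis using n by (simp add: coeff2_zw_nf B [of l, symmetric])
    next
      case 4
      then show ?thesis using n by (simp add: coeff2_zw_nf sym [of k "k + n"] B [of k, symmetric])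
    next
      case 5
      then have "c k l = 0" by (intro z) auto
      then show ?thesis using 5 by (simp add: coeff2_zw_nf)
    qed
    then show "coeff2 (zw H) k l = coeff2 (zw (nf_hamiltonian n A B)) k l" by (simp only: re)
  qed
  ultimately show ?thesis using that zw_inj by blast
qed

lemma nf_hamiltonian_inj:
  assumes eq: "nf_hamiltonian n A B = nf_hamiltonian n A' B'" and n: "n > 0"
  shows "A = A'" "B = B'"
proof -
  have c: "coeff2 (zw (nf_hamiltonian n A B)) k l = coeff2 (zw (nf_hamiltonian n A' B')) k l" for k l
    by (simp add: eq)
  show "A = A'"
  proof (rule fps_ext)
    fix k show "fps_nth A k = fps_nth A' k"
      using c [of "k + 2" "k + 2"] n by (simp add: coeff2_zw_nf complex_eq_iff)
  qed
  show "B = B'"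
  proof (rule fps_ext)
    fix k show "fps_nth B k = fps_nth B' k"
      using c [of "k + n" k] n res_factor_pos [of n] by (simp add: coeff2_zw_nf complex_eq_iff)
  qed
qed

subsection \<open>The homological recursion\<close>

text \<open>Let \<open>c j\<close> be the coefficient of \<open>z^k w^l\<close> with
  \<open>k + l = m\<close>, \<open>k - l = n j\<close>, and take the bracket with
  \<open>a (z w)^2 + \<beta> (z^n + w^n)\<close>. Twice the coefficient of the result in degree
  \<open>m + n - 2\<close> with exponent difference \<open>n j\<close>, divided by \<open>n\<close>,
  is this expression.\<close>

definition hop :: "nat \<Rightarrow> nat \<Rightarrow> real \<Rightarrow> real \<Rightarrow> (nat \<Rightarrow> real) \<Rightarrow> nat \<Rightarrow> real" where
  "hop n m a \<beta> c j = 4 * a * real j * c j +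
     \<beta> * ((real m + real n + real n * real j) * c (j + 1) - (real m + real n - real n * real j) * c (j - 1))"

lemma hop_linear: "hop n m a \<beta> (\<lambda>j. c j + s * c' j) j = hop n m a \<beta> c j + s * hop n m a \<beta> c' j"
  by (simp add: hop_def algebra_simps)

lemma hop_uminus: "hop n m a \<beta> (\<lambda>j. - c j) j = - hop n m a \<beta> c j"
  by (simp add: hop_def algebra_simps)

lemma hop_cong:
  "c (j - 1) = c' (j - 1) \<Longrightarrow> c j = c' j \<Longrightarrow> c (j + 1) = c' (j + 1) \<Longrightarrow> hop n m a \<beta> c j = hop n m a \<beta> c' j"
  by (simp add: hop_def)

text \<open>Downward induction: once the entries above \<open>j\<close> vanish, the equation at
  \<open>j + 1\<close> reduces to \<open>(m - n j) c j = 0\<close>. The parity condition settles the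
  case \<open>n j + 1 = m\<close>, in which the equation at \<open>j + 1\<close> would lie outside
  the range where it is assumed.\<close>

lemma hop_zero_seq:
  assumes n: "n \<ge> 2" and beta: "\<beta> \<noteq> 0"
    and top: "\<And>j. n * j \<ge> m \<Longrightarrow> c j = 0" and par: "\<And>j. odd (m + n * j) \<Longrightarrow> c j = 0"
    and rec: "\<And>j. j > j0 \<Longrightarrow> n * j \<le> m + n - 2 \<Longrightarrow> hop n m a \<beta> c j = 0"
  shows "j0 \<le> j \<Longrightarrow> c j = 0"
proof (induction "Suc m - j" arbitrary: j rule: less_induct)
  case less
  show ?case
  proof (cases "n * j \<ge> m \<or> odd (m + n * j)")
    case True
    then show ?thesis using top par by blast
  next
    case False
    have "n * j + 2 \<le> m"
    proof -
      have "n * j + 1 \<noteq> m" using False by auto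
      then show ?thesis using False by linarith
    qed
    then have jm: "j < m" using n by (metis add_leD1 le_trans less_le mult_le_mono1 nat_mult_1 not_less_eq_eq one_le_numeral plus_nat.add_0 add_2_eq_Suc' lessI)
    have c1: "c (j + 1) = 0" "c (j + 2) = 0"
      using less.hyps [of "j + 1"] less.hyps [of "j + 2"] less.prems jm by auto
    have "hop n m a \<beta> c (j + 1) = 0"
      using less.prems \<open>n * j + 2 \<le> m\<close> n by (intro rec) (auto simp: algebra_simps)
    then have "\<beta> * ((real m - real n * real j) * c j) = 0"
      using c1 by (auto simp: hop_def algebra_simps)
    moreover have "real m - real n * real j \<noteq> 0"
      using \<open>n * j + 2 \<le> m\<close> by (metis add_leD1 add_le_same_cancel1 eq_iff_diff_eq_0 not_numeral_le_zero of_nat_eq_iff of_nat_mult)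
    ultimately show ?thesis using beta by simp
  qed
qed

text \<open>Brought into a form with \<open>c (j - 1)\<close> alone on one side, the recursion has
  positive factors at \<open>c (j - 1)\<close> and \<open>c (j + 1)\<close> and a nonnegative one at
  \<open>a * c j\<close>. Going down from the top, entries at even distance therefore stay positive,
  and those at odd distance have weakly the sign of \<open>a\<close>, whatever the ratio of
  \<open>a\<close> to \<open>\<beta>\<close>.\<close>

lemma hop_sign:
  assumes n: "n \<ge> 2" and beta: "\<beta> > 0" and top: "c J > 0" "c (Suc J) = 0"
    and rec: "\<And>j. j > j0 \<Longrightarrow> j \<le> J \<Longrightarrow> hop n (n * J) a \<beta> c j = 0"
  shows "j0 + i \<le> J \<Longrightarrow> (even i \<longrightarrow> c (J - i) > 0) \<and> (odd i \<longrightarrow> a * c (J - i) \<ge> 0)"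
proof (induction i rule: less_induct)
  case (less i)
  show ?case
  proof (cases i)
    case 0
    then show ?thesis using top by simp
  next
    case (Suc i')
    define j where "j = J - i'"
    have j: "j > j0" "j \<le> J" "J - i = j - 1" using less.prems Suc by (auto simp: j_def)
    define p q where "p = \<beta> * (real (n * J) + real n + real n * real j)"
      and "q = \<beta> * (real (n * J) + real n - real n * real j)"
    have "real n * real j \<le> real n * real J" using j by (intro mult_left_mono) auto
    moreover have "real n > 0" "real n * real J \<ge> 0" "real n * real j \<ge> 0" using n by simp_all
    ultimately have "real n * real J + real n + real n * real j > 0" "real n * real J + real n - real n * real j > 0"
      by linarith+
    then have pq: "p > 0" "q > 0" using beta by (simp_all add: p_def q_def)
    have "hop n (n * J) a \<beta> c j = 0" by (rule rec [OF j(1,2)])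
    then have eq: "q * c (j - 1) = p * c (j + 1) + 4 * real j * (a * c j)"
      by (simp add: hop_def p_def q_def algebra_simps)
    have IH1: "(even i' \<longrightarrow> c j > 0) \<and> (odd i' \<longrightarrow> a * c j \<ge> 0)"
      unfolding j_def using less Suc by simp
    show ?thesis
    proof (cases "even i")
      case True
      then obtain i'' where i'': "i' = Suc i''" "even i''" using Suc by (cases i') auto
      have "j + 1 = J - i''" using less.prems Suc i'' by (simp add: j_def)
      moreover have "c (J - i'') > 0" using less.IH [of i''] less.prems Suc i'' by simp
      ultimately have "p * c (j + 1) > 0" using pq by simp
      moreover have "4 * real j * (a * c j) \<ge> 0" using IH1 i'' by simp
      ultimately have "q * c (j - 1) > 0" unfolding eq by linarith
      then show ?thesis using True pq j(3) by (simp add: zero_less_mult_iff)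
    next
      case False
      have "a * c (j + 1) \<ge> 0"
      proof (cases i')
        case 0
        then show ?thesis using top(2) by (simp add: j_def)
      next
        case (Suc i'')
        have "j + 1 = J - i''" using less.prems \<open>i = Suc i'\<close> Suc by (simp add: j_def)
        moreover have "a * c (J - i'') \<ge> 0"
          using less.IH [of i''] less.prems \<open>i = Suc i'\<close> Suc False by simp
        ultimately show ?thesis by simp
      qed
      then have "p * (a * c (j + 1)) \<ge> 0" using pq by simp
      moreover have "a * (4 * real j * (a * c j)) \<ge> 0"
      proof -
        have "a * (4 * real j * (a * c j)) = (4 * real j * c j) * (a * a)" by simp
        moreover have "c j > 0" using IH1 False Suc by simp
        ultimately show ?thesis by (metis less_imp_le mult_nonneg_nonneg of_nat_0_le_iff zero_le_numeral zero_le_square)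
      qed
      moreover have "q * (a * c (j - 1)) = p * (a * c (j + 1)) + a * (4 * real j * (a * c j))"
        using arg_cong [OF eq, of "\<lambda>x. a * x"] by (simp add: algebra_simps)
      ultimately have "q * (a * c (j - 1)) \<ge> 0" by linarith
      then show ?thesis using False pq j(3) by (simp add: zero_le_mult_iff)
    qed
  qed
qed

text \<open>If the top entry were nonzero, \<open>hop_sign\<close> for \<open>c\<close> or
  \<open>- c\<close> would give a nonzero entry at even distance from it: entry 1 for odd
  \<open>J\<close>, entry 0 for even \<open>J\<close>. In the even case the equation at 1 is what
  allows the last step down to 0.\<close>

lemma hop_top_zero:
  assumes n: "n \<ge> 2" and beta: "\<beta> > 0" and J: "J \<ge> 1" and top: "c (Suc J) = 0"
    and rec: "\<And>j. j \<ge> 2 \<Longrightarrow> j \<le> J \<Longrightarrow> hop n (n * J) a \<beta> c j = 0"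
    and bot: "odd J \<Longrightarrow> c 1 = 0" "even J \<Longrightarrow> c 0 = 0" "even J \<Longrightarrow> hop n (n * J) a \<beta> c 1 = 0"
  shows "c J = 0"
proof -
  have "\<not> d J > 0" if d: "d (Suc J) = 0" "\<And>j. j \<ge> 2 \<Longrightarrow> j \<le> J \<Longrightarrow> hop n (n * J) a \<beta> d j = 0"
      "odd J \<Longrightarrow> d 1 = 0" "even J \<Longrightarrow> d 0 = 0" "even J \<Longrightarrow> hop n (n * J) a \<beta> d 1 = 0" for d
  proof
    assume pos: "d J > 0"
    show False
    proof (cases "odd J")
      case True
      have "d (J - (J - 1)) > 0"
        using hop_sign [OF n beta pos d(1), of 1 a "J - 1"] d(2) J True by simp
      then show False using d(3) True J by simp
    next
      case False
      have "hop n (n * J) a \<beta> d j = 0" if "j > 0" "j \<le> J" for j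
        using d(2) [of j] d(5) False that by (cases "j = 1") auto
      then have "d (J - J) > 0"
        using hop_sign [OF n beta pos d(1), of 0 a J] False by simp
      then show False using d(4) False by simp
    qed
  qed
  from this [of c] this [of "\<lambda>j. - c j"] have "\<not> c J > 0" "\<not> - c J > 0"
    using assms by (auto simp: hop_uminus)
  then show ?thesis by linarith
qed

text \<open>The equation at \<open>j\<close> is solved for \<open>c (j - 1)\<close>, so the top
  value \<open>\<sigma>\<close> is free. The bound on \<open>J\<close> keeps the divisor
  \<open>m + n - n j\<close> away from 0.\<close>

lemma hop_solve:
  assumes n: "n \<ge> 2" and beta: "\<beta> \<noteq> 0" and J: "n * J \<le> m + n - 2" "m + n \<ge> 2"
  obtains c where "c J = \<sigma>" "\<And>j. j > J \<Longrightarrow> c j = 0" "\<And>j. j \<ge> 1 \<Longrightarrow> j \<le> J \<Longrightarrow> hop n m a \<beta> c j = d j"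
proof -
  have "i \<le> J \<Longrightarrow> \<exists>c. c J = \<sigma> \<and> (\<forall>j>J. c j = 0) \<and> (\<forall>j. J - i < j \<and> j \<le> J \<longrightarrow> hop n m a \<beta> c j = d j)" for i
  proof (induction i)
    case 0
    show ?case by (rule exI [of _ "\<lambda>j. if j = J then \<sigma> else 0"]) auto
  next
    case (Suc i)
    then obtain c where c: "c J = \<sigma>" "\<forall>j>J. c j = 0" "\<forall>j. J - i < j \<and> j \<le> J \<longrightarrow> hop n m a \<beta> c j = d j"
      by auto
    define j where "j = J - i"
    have j: "j \<ge> 1" "j \<le> J" "J - Suc i = j - 1" using Suc.prems by (auto simp: j_def)
    define q where "q = \<beta> * (real m + real n - real n * real j)"
    have "n * j \<le> m + n - 2" using J j by (meson le_trans mult_le_mono2)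
    then have "real (n * j) \<le> real (m + n - 2)" by (simp only: of_nat_le_iff)
    then have "real m + real n - real n * real j \<noteq> 0" using J(2) by (simp add: of_nat_diff)
    then have q: "q \<noteq> 0" using beta by (simp add: q_def)
    define x where "x = (4 * a * real j * c j + \<beta> * (real m + real n + real n * real j) * c (j + 1) - d j) / q"
    let ?c = "c(j - 1 := x)"
    have "hop n m a \<beta> ?c j = 4 * a * real j * c j + \<beta> * (real m + real n + real n * real j) * c (j + 1) - q * x"
    proof -
      have "?c j = c j" "?c (j + 1) = c (j + 1)" "?c (j - 1) = x" using j by auto
      then show ?thesis unfolding hop_def q_def by (simp only: algebra_simps)
    qed
    then have "hop n m a \<beta> ?c j = d j" using q by (simp add: x_def)
    moreover have "hop n m a \<beta> ?c k = d k" if "j < k" "k \<le> J" for k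
    proof -
      have "hop n m a \<beta> ?c k = hop n m a \<beta> c k" using that j by (intro hop_cong) auto
      then show ?thesis using c(3) that by (simp add: j_def)
    qed
    ultimately have "hop n m a \<beta> ?c k = d k" if "J - Suc i < k" "k \<le> J" for k
      using that j by (cases "k = j") auto
    moreover have "?c J = \<sigma>" "\<forall>k>J. ?c k = 0" using c j by auto
    ultimately show ?case by blast
  qed
  from this [of J] that show ?thesis by auto
qed

text \<open>With \<open>J\<close> the largest index of an equation, every \<open>j < J\<close>
  satisfies \<open>n j \<le> m - 2\<close>. Choosing the value 0 at \<open>J\<close> thus clears all
  indices that carry no monomial of degree \<open>m\<close> because they are too large.\<close>

lemma hop_solve_bounded:
  assumes n: "n \<ge> 2" and beta: "\<beta> \<noteq> 0" and m: "m \<ge> 1"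
  obtains c where "\<And>j. n * j > m \<Longrightarrow> c j = 0"
    "\<And>j. j \<ge> 1 \<Longrightarrow> n * j \<le> m + n - 2 \<Longrightarrow> hop n m a \<beta> c j = d j"
proof -
  define J where "J = (m + n - 2) div n"
  have J: "n * J \<le> m + n - 2" by (simp add: J_def)
  have J': "j \<le> J" if "n * j \<le> m + n - 2" for j
    using that n by (simp add: J_def less_eq_div_iff_mult_less_eq mult.commute)
  obtain c where c: "c J = 0" "\<And>j. j > J \<Longrightarrow> c j = 0" "\<And>j. j \<ge> 1 \<Longrightarrow> j \<le> J \<Longrightarrow> hop n m a \<beta> c j = d j"
    using hop_solve [OF n beta J, of 0 a d] m n by auto
  have "c j = 0" if "n * j > m" for j
  proof (cases "j < J")
    case True
    then have "n * (j + 1) \<le> n * J" by (intro mult_le_mono2) simp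
    then have "n * j + n \<le> m + n - 2" using J by simp
    then show ?thesis using that by simp
  next
    case False
    then show ?thesis using c(1,2) by (cases "j = J") auto
  qed
  with c(3) J' that show ?thesis by blast
qed

text \<open>In the degrees \<open>m = n J\<close> the kernel of the homological operator, spanned by the \<open>J\<close>-th power of
  the leading Hamiltonian, leaves a free parameter; it serves to satisfy one more condition at
  the bottom of the recursion.\<close>

lemma hop_solve_odd_part:
  assumes n: "n \<ge> 2" and beta: "\<beta> > 0" and m: "m \<ge> 1"
  obtains s where "s 0 = 0" "\<And>j. n * j > m \<Longrightarrow> s j = 0"
    "\<And>j. j \<ge> 2 \<Longrightarrow> n * j \<le> m + n - 2 \<Longrightarrow> hop n m a \<beta> s j = d j"
    "\<And>J. m = n * J \<Longrightarrow> odd J \<Longrightarrow> s 1 = \<delta>"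
    "\<And>J. m = n * J \<Longrightarrow> even J \<Longrightarrow> hop n m a \<beta> s 1 = d 1"
proof -
  have b0: "\<beta> \<noteq> 0" using beta by simp
  obtain c where c: "\<And>j. n * j > m \<Longrightarrow> c j = 0"
    "\<And>j. j \<ge> 1 \<Longrightarrow> n * j \<le> m + n - 2 \<Longrightarrow> hop n m a \<beta> c j = d j"
    using hop_solve_bounded [OF n b0 m, of a d] by blast
  \<comment> \<open>No equation from 2 on contains entry 0, so resetting it is harmless for
    them.\<close>
  have upd: "hop n m a \<beta> (c'(0 := 0)) j = hop n m a \<beta> c' j" if "j \<ge> 2" for c' j
    using that by (intro hop_cong) auto
  show ?thesis
  proof (cases "\<exists>J. m = n * J")
    case False
    have "(c(0 := 0)) j = 0" if "n * j > m" for j using that c(1) by simp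
    moreover have "hop n m a \<beta> (c(0 := 0)) j = d j" if "j \<ge> 2" "n * j \<le> m + n - 2" for j
      using c(2) that by (simp add: upd)
    ultimately show ?thesis using False that [of "c(0 := 0)"] by auto
  next
    case True
    then obtain J where J: "m = n * J" by blast
    then have J1: "J \<ge> 1" using m by (cases J) auto
    have JJ: "n * J \<le> m + n - 2" "m + n \<ge> 2" using J n by auto
    have le: "j \<le> J" if "n * j \<le> m + n - 2" for j
    proof -
      have "n * j < n * (J + 1)" using that J n by (simp add: algebra_simps)
      then have "j < J + 1" by (simp only: mult_less_cancel1)
      then show ?thesis by simp
    qed
    have bnd: "n * j \<le> m + n - 2" if "j \<le> J" for j
      using mult_le_mono2 [OF that, of n] JJ(1) by linarith
    obtain k where k: "k J = 1" "\<And>j. j > J \<Longrightarrow> k j = 0" "\<And>j. j \<ge> 1 \<Longrightarrow> j \<le> J \<Longrightarrow> hop n m a \<beta> k j = 0"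
      using hop_solve [OF n b0 JJ, of 1 a "\<lambda>_. 0"] by blast
    have kpos: "even i \<Longrightarrow> i \<le> J \<Longrightarrow> k (J - i) > 0" for i
      using hop_sign [OF n beta, of k J 0 a i] k J by auto
    \<comment> \<open>The lowest index of the parity of \<open>J\<close>, where
      \<open>hop_sign\<close> gives strict positivity of the homogeneous solution \<open>k\<close>.
      Adding a multiple of \<open>k\<close> can therefore prescribe the entry there:
      \<open>\<delta>\<close> at 1 or, for even \<open>J\<close>, the value 0 at 0, which saves the
      equation at 1.\<close>
    define p where "p = (if odd J then 1 else 0 :: nat)"
    have kp: "k p > 0"
      using kpos [of "J - 1"] kpos [of J] J1 by (auto simp: p_def)
    define \<epsilon> where "\<epsilon> = ((if odd J then \<delta> else 0) - c p) / k p"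
    define s where "s = (\<lambda>j. c j + \<epsilon> * k j)"
    have sp: "s p = (if odd J then \<delta> else 0)" using kp by (simp add: s_def \<epsilon>_def)
    have hs: "hop n m a \<beta> s j = d j" if "j \<ge> 1" "n * j \<le> m + n - 2" for j
      unfolding s_def hop_linear using that c(2) k(3) le by simp
    have s0: "(s(0 := 0)) j = 0" if "n * j > m" for j
      using that c(1) k(2) [of j] J by (auto simp: s_def)
    have h2: "hop n m a \<beta> (s(0 := 0)) j = d j" if "j \<ge> 2" "n * j \<le> m + n - 2" for j
      using that hs by (simp add: upd)
    have "J' = J" if "m = n * J'" for J' using that J n by simp
    moreover have "(s(0 := 0)) 1 = \<delta>" if "odd J" using that sp by (simp add: p_def)
    moreover have "hop n m a \<beta> (s(0 := 0)) 1 = d 1" if "even J"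
    proof -
      have "s(0 := 0) = s" using that sp by (auto simp: p_def)
      then show ?thesis using hs [of 1] bnd [OF J1] by simp
    qed
    ultimately show ?thesis using that [of "s(0 := 0)"] s0 h2 by (metis fun_upd_same)
  qed
qed

subsection \<open>The homological operator in complex coordinates\<close>

definition hlead :: "nat \<Rightarrow> real \<Rightarrow> real \<Rightarrow> complex fps fps" where
  "hlead n a \<beta> = mono2 (complex_of_real a) 2 2 + mono2 (complex_of_real \<beta>) n 0 + mono2 (complex_of_real \<beta>) 0 n"

text \<open>For \<open>n = 3\<close> the term with \<open>a\<close> has degree \<open>n + 1\<close>
  and is not leading, hence \<open>a = 0\<close>. The restriction also keeps parities apart in the
  recursion: \<open>c j\<close> occurs beside \<open>c (j - 1)\<close> and \<open>c (j + 1)\<close>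
  only for \<open>n = 4\<close>, where the parity of \<open>m + n j\<close> does not depend on
  \<open>j\<close>.\<close>

definition lead :: "nat \<Rightarrow> real \<Rightarrow> real \<Rightarrow> fps2 \<Rightarrow> bool" where
  "lead n a \<beta> H \<longleftrightarrow> (a = 0 \<or> n = 4) \<and> vanish (n + 1) (zw H - hlead n a \<beta>)"

text \<open>Nonnegative \<open>j\<close> suffice because real series have hermitian coefficients.
  The value 0 where no monomial of degree \<open>m\<close> with difference \<open>n j\<close> exists
  makes the recursion valid up to its ends.\<close>

definition cseq :: "nat \<Rightarrow> nat \<Rightarrow> complex fps fps \<Rightarrow> nat \<Rightarrow> complex" where
  "cseq n m Q j = (if even (m + n * j) \<and> n * j \<le> m
     then coeff2 Q ((m + n * j) div 2) ((m - n * j) div 2) else 0)"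

lemma cseq_coeff2:
  assumes "k + l = m" "k = l + n * j"
  shows "coeff2 Q k l = cseq n m Q j"
proof -
  have "m + n * j = 2 * k" "m - n * j = 2 * l" "n * j \<le> m" using assms by auto
  then show ?thesis by (simp add: cseq_def)
qed

lemma cseq_0: "n * j > m \<Longrightarrow> cseq n m Q j = 0" and cseq_odd: "odd (m + n * j) \<Longrightarrow> cseq n m Q j = 0"
  by (auto simp: cseq_def)

lemma coeff2_br_hlead:
  assumes n: "n \<ge> 2"
  shows "coeff2 (br Q (hlead n a \<beta>)) k l =
    2 * complex_of_real a * ((if k \<ge> 2 \<and> l \<ge> 1 then of_nat (k - 1) * coeff2 Q (k - 1) (l - 1) else 0) -
       (if k \<ge> 1 \<and> l \<ge> 2 then of_nat (l - 1) * coeff2 Q (k - 1) (l - 1) else 0)) +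
    of_nat n * complex_of_real \<beta> *
      ((if l \<ge> n - 1 then of_nat (k + 1) * coeff2 Q (k + 1) (l - (n - 1)) else 0) -
       (if k \<ge> n - 1 then of_nat (l + 1) * coeff2 Q (k - (n - 1)) (l + 1) else 0))"
proof -
  have s: "Suc (k - 2) = k - Suc 0" if "2 \<le> k" for k :: nat using that by simp
  have "br Q (hlead n a \<beta>) = (gdX Q * mono2 (2 * complex_of_real a) 2 1 - gdY Q * mono2 (2 * complex_of_real a) 1 2) +
      (gdX Q * mono2 (of_nat n * complex_of_real \<beta>) 0 (n - 1) - gdY Q * mono2 (of_nat n * complex_of_real \<beta>) (n - 1) 0)"
  proof -
    have "gdX (hlead n a \<beta>) = mono2 (2 * complex_of_real a) 1 2 + mono2 (of_nat n * complex_of_real \<beta>) (n - 1) 0"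
      "gdY (hlead n a \<beta>) = mono2 (2 * complex_of_real a) 2 1 + mono2 (of_nat n * complex_of_real \<beta>) 0 (n - 1)"
      unfolding hlead_def gdX_add gdY_add gdX_mono2 gdY_mono2
      by (rule fps2_eqI; simp add: coeff2_mono2 mult.commute)+
    then show ?thesis unfolding br_def by (simp only: distrib_left) simp
  qed
  then show ?thesis
    by (simp only: coeff2_add coeff2_diff coeff2_mult_mono2 coeff2_gdX coeff2_gdY)
       (simp add: s right_diff_distrib mult.assoc del: of_nat_add of_nat_Suc)
qed

text \<open>From \<open>k + l + 2 = m + n\<close> and \<open>k - l = n j\<close> follow
  \<open>2 (k + 1) = m + n + n j\<close> and \<open>2 (l + 1) = m + n - n j\<close>, the two factors
  in \<open>hop\<close>; the left-hand side is doubled to avoid fractions.\<close>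

lemma br_hlead_cseq:
  assumes n: "n \<ge> 2" and a: "a = 0 \<or> n = 4" and kl: "k = l + n * j" "k + l + 2 = m + n" and j: "j \<ge> 1"
  shows "2 * coeff2 (br Q (hlead n a \<beta>)) k l = of_nat n *
    (4 * complex_of_real a * of_nat j * cseq n m Q j + complex_of_real \<beta> *
      ((of_nat m + of_nat n + of_nat n * of_nat j) * cseq n m Q (j + 1) -
       (of_nat m + of_nat n - of_nat n * of_nat j) * cseq n m Q (j - 1)))"
proof -
  obtain j' where j': "j = Suc j'" using j by (cases j) auto
  define p where "p = n * j'"
  have k: "k = l + n + p" and m: "m + n = 2 * l + n + p + 2" using kl j' by (auto simp: p_def)
  have nj: "n * j = n + p" "n * (j + 1) = n + n + p" by (simp_all add: j' p_def)
  have eA: "2 * complex_of_real a * ((if k \<ge> 2 \<and> l \<ge> 1 then of_nat (k - 1) * coeff2 Q (k - 1) (l - 1) else 0) -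
       (if k \<ge> 1 \<and> l \<ge> 2 then of_nat (l - 1) * coeff2 Q (k - 1) (l - 1) else 0)) =
       2 * complex_of_real a * (of_nat (n + p) * cseq n m Q j)"
  proof (cases "a = 0")
    case False
    then have n4: "n = 4" using a by simp
    show ?thesis
    proof (cases "l = 0")
      case True
      then show ?thesis using k m n4 cseq_0 [of m n j Q] nj by simp
    next
      case l: False
      then obtain l' where l': "l = Suc l'" by (cases l) auto
      have c: "coeff2 Q (k - 1) (l - 1) = cseq n m Q j"
        using k m n4 nj l' by (intro cseq_coeff2) auto
      have "(if k \<ge> 1 \<and> l \<ge> 2 then of_nat (l - 1) * coeff2 Q (k - 1) (l - 1) else 0) = of_nat l' * cseq n m Q j"
        unfolding c using l' k by auto
      moreover have "(if k \<ge> 2 \<and> l \<ge> 1 then of_nat (k - 1) * coeff2 Q (k - 1) (l - 1) else 0) = of_nat (l' + n + p) * cseq n m Q j"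
        unfolding c using l' k n by auto
      ultimately show ?thesis by (simp add: algebra_simps)
    qed
  qed simp
  have eB: "(if l \<ge> n - 1 then of_nat (k + 1) * coeff2 Q (k + 1) (l - (n - 1)) else 0) = of_nat (k + 1) * cseq n m Q (j + 1)"
  proof (cases "l \<ge> n - 1")
    case True
    have "coeff2 Q (k + 1) (l - (n - 1)) = cseq n m Q (j + 1)"
      using k m nj True n by (intro cseq_coeff2) auto
    then show ?thesis using True by simp
  next
    case False
    then have "cseq n m Q (j + 1) = 0" using k m nj n by (intro cseq_0) auto
    then show ?thesis using False by simp
  qed
  have eC: "(if k \<ge> n - 1 then of_nat (l + 1) * coeff2 Q (k - (n - 1)) (l + 1) else 0) = of_nat (l + 1) * cseq n m Q (j - 1)"
  proof -
    have "coeff2 Q (k - (n - 1)) (l + 1) = cseq n m Q (j - 1)"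
      using k m n by (intro cseq_coeff2) (auto simp: j' p_def)
    then show ?thesis using k by simp
  qed
  have r: "(of_nat n :: complex) * of_nat j = of_nat n + of_nat p"
    "(of_nat m :: complex) + of_nat n = 2 * of_nat l + of_nat n + of_nat p + 2"
    using arg_cong [OF nj(1), of "of_nat :: nat \<Rightarrow> complex"] arg_cong [OF m, of "of_nat :: nat \<Rightarrow> complex"]
    by simp_all
  have x: "of_nat n * (4 * complex_of_real a * of_nat j * z) = 4 * complex_of_real a * (of_nat n + of_nat p) * z" for z
    unfolding r(1) [symmetric] by (simp add: mult_ac)
  show ?thesis
    unfolding coeff2_br_hlead [OF n] eA eB eC distrib_left x r
    by (simp add: k algebra_simps)
qed

lemma coeff2_zw_br_lead:
  assumes H: "lead n a \<beta> H" and chi: "vanish m \<eta>" and kl: "k + l + 2 = m + n"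
  shows "coeff2 (zw (br \<eta> H)) k l = - 2 * \<i> * coeff2 (br (zw \<eta>) (hlead n a \<beta>)) k l"
proof -
  have "vanish (m + (n + 1) - 2) (br (zw \<eta>) (zw H - hlead n a \<beta>))"
    using H chi by (intro vanish_br_sub) (simp_all add: lead_def vanish_zw_iff)
  then have "coeff2 (br (zw \<eta>) (zw H - hlead n a \<beta>)) k l = 0"
    by (rule vanishD) (use kl in simp)
  then show ?thesis by (simp only: zw_br coeff2_const_mult br_diff_right coeff2_diff) simp
qed

text \<open>The factor \<open>- 2 * \<i>\<close> from \<open>zw_br\<close> interchanges real and
  imaginary parts: the real coefficients that a normal form may keep are influenced only by the
  imaginary parts of the generator.\<close>

lemma zw_br_lead_pos:
  assumes n: "n \<ge> 2" and H: "lead n a \<beta> H" and chi: "vanish m \<eta>"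
    and kl: "k = l + n * j" "k + l + 2 = m + n" and j: "j \<ge> 1"
  shows "Re (coeff2 (zw (br \<eta> H)) k l) = real n * hop n m a \<beta> (\<lambda>j. Im (cseq n m (zw \<eta>) j)) j"
    and "Im (coeff2 (zw (br \<eta> H)) k l) = - real n * hop n m a \<beta> (\<lambda>j. Re (cseq n m (zw \<eta>) j)) j"
proof -
  have a: "a = 0 \<or> n = 4" using H by (simp add: lead_def)
  define q where "q = coeff2 (br (zw \<eta>) (hlead n a \<beta>)) k l"
  note eq = br_hlead_cseq [OF n a kl j, of "zw \<eta>" \<beta>, folded q_def]
  have "2 * Re q = real n * hop n m a \<beta> (\<lambda>j. Re (cseq n m (zw \<eta>) j)) j"
    using arg_cong [OF eq, of Re] by (simp add: hop_def)
  moreover have "2 * Im q = real n * hop n m a \<beta> (\<lambda>j. Im (cseq n m (zw \<eta>) j)) j"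
    using arg_cong [OF eq, of Im] by (simp add: hop_def)
  moreover have "coeff2 (zw (br \<eta> H)) k l = - 2 * \<i> * q"
    unfolding q_def by (rule coeff2_zw_br_lead [OF H chi kl(2)])
  ultimately show "Re (coeff2 (zw (br \<eta> H)) k l) = real n * hop n m a \<beta> (\<lambda>j. Im (cseq n m (zw \<eta>) j)) j"
    "Im (coeff2 (zw (br \<eta> H)) k l) = - real n * hop n m a \<beta> (\<lambda>j. Re (cseq n m (zw \<eta>) j)) j"
    by simp_all
qed

text \<open>On the diagonal the entry of index -1 is the conjugate of that of index 1, so their
  difference is \<open>2 * \<i>\<close> times an imaginary part.\<close>

lemma zw_br_lead_diag:
  assumes n: "n \<ge> 2" and H: "lead n a \<beta> H" and chi: "vanish m \<eta>" and k: "2 * k + 2 = m + n"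
  shows "coeff2 (zw (br \<eta> H)) k k = complex_of_real (2 * real n * \<beta> * (real m + real n) * Im (cseq n m (zw \<eta>) 1))"
proof -
  let ?Q = "zw \<eta>"
  have q: "coeff2 (br ?Q (hlead n a \<beta>)) k k = of_nat n * complex_of_real \<beta> *
      (of_nat (k + 1) * cseq n m ?Q 1 - of_nat (k + 1) * cnj (cseq n m ?Q 1))"
  proof (cases "k \<ge> n - 1")
    case True
    then have "coeff2 ?Q (k + 1) (k - (n - 1)) = cseq n m ?Q 1"
      using k n by (intro cseq_coeff2) auto
    then show ?thesis
      using True zw_hermitian [of \<eta> "k - (n - 1)" "k + 1"] by (auto simp: coeff2_br_hlead [OF n])
  next
    case False
    then have "cseq n m ?Q 1 = 0" using k n by (intro cseq_0) auto
    then show ?thesis using False by (auto simp: coeff2_br_hlead [OF n])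
  qed
  have kk: "real m + real n = 2 * (real k + 1)"
    using arg_cong [OF k, of real] by simp
  have "coeff2 (zw (br \<eta> H)) k k = - 2 * \<i> * coeff2 (br ?Q (hlead n a \<beta>)) k k"
    by (rule coeff2_zw_br_lead [OF H chi]) (use k in simp)
  then show ?thesis
    unfolding q kk by (simp add: complex_eq_iff algebra_simps)
qed

subsection \<open>Resonances\<close>

definition resonant :: "nat \<Rightarrow> nat \<Rightarrow> nat \<Rightarrow> bool" where
  "resonant n k l \<longleftrightarrow> (\<exists>j. k = l + n * j \<or> l = k + n * j)"

locale resonance =
  fixes n :: nat and \<alpha> :: real
  assumes n34: "n = 3 \<or> n = 4"
    and cis_n: "cis \<alpha> ^ n = 1"
    and cis_k: "\<And>k. 1 \<le> k \<Longrightarrow> k < n \<Longrightarrow> cis \<alpha> ^ k \<noteq> 1"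
begin

lemma cis_power_eq_1_iff: "cis \<alpha> ^ p = 1 \<longleftrightarrow> n dvd p"
proof -
  have "cis \<alpha> ^ p = cis \<alpha> ^ (n * (p div n) + p mod n)" by simp
  also have "\<dots> = cis \<alpha> ^ (p mod n)"
    unfolding power_add power_mult cis_n by simp
  finally have eq: "cis \<alpha> ^ p = cis \<alpha> ^ (p mod n)" .
  have "p mod n < n" using n34 by auto
  then show ?thesis unfolding eq using cis_k [of "p mod n"] by (cases "p mod n = 0") (auto simp: mod_eq_0_iff_dvd)
qed

lemma cis_mult_uminus: "cis \<alpha> ^ k * cis (- \<alpha>) ^ k = 1"
  by (simp add: power_mult_distrib [symmetric] cis_mult)

lemma resonant_iff: "cis \<alpha> ^ k * cis (- \<alpha>) ^ l = 1 \<longleftrightarrow> resonant n k l"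
proof (cases "k \<ge> l")
  case True
  then obtain p where p: "k = l + p" using le_Suc_ex by blast
  have "cis \<alpha> ^ k * cis (- \<alpha>) ^ l = cis \<alpha> ^ p * (cis \<alpha> ^ l * cis (- \<alpha>) ^ l)"
    by (simp add: p power_add mult_ac)
  then have "cis \<alpha> ^ k * cis (- \<alpha>) ^ l = 1 \<longleftrightarrow> n dvd p"
    by (simp add: cis_mult_uminus cis_power_eq_1_iff)
  then show ?thesis by (auto simp: resonant_def p dvd_def intro: exI [of _ 0])
next
  case False
  then obtain p where p: "l = k + p" using le_Suc_ex nat_le_linear by blast
  have "cis \<alpha> ^ p * (cis \<alpha> ^ k * cis (- \<alpha>) ^ l) = (cis \<alpha> ^ k * cis (- \<alpha>) ^ k) * (cis \<alpha> ^ p * cis (- \<alpha>) ^ p)"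
    by (simp add: p power_add mult_ac)
  then have "cis \<alpha> ^ p * (cis \<alpha> ^ k * cis (- \<alpha>) ^ l) = 1" by (simp add: cis_mult_uminus)
  then have "cis \<alpha> ^ k * cis (- \<alpha>) ^ l = 1 \<longleftrightarrow> n dvd p"
    by (metis cis_power_eq_1_iff mult.right_neutral mult_1)
  then show ?thesis by (auto simp: resonant_def p dvd_def intro: exI [of _ 0])
qed

lemma invariant_iff:
  "gsubst2 P (frotation \<alpha>) = P \<longleftrightarrow> (\<forall>k l. coeff2 (zw P) k l \<noteq> 0 \<longrightarrow> resonant n k l)"
proof
  assume eq: "gsubst2 P (frotation \<alpha>) = P"
  show "\<forall>k l. coeff2 (zw P) k l \<noteq> 0 \<longrightarrow> resonant n k l"
    using coeff2_zw_rotation [of P \<alpha>] unfolding eq resonant_iff [symmetric] by (metis mult_cancel_right1)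
next
  assume "\<forall>k l. coeff2 (zw P) k l \<noteq> 0 \<longrightarrow> resonant n k l"
  then have "zw (gsubst2 P (frotation \<alpha>)) = zw P"
    by (intro fps2_eqI) (metis coeff2_zw_rotation mult_1 mult_zero_right resonant_iff)
  then show "gsubst2 P (frotation \<alpha>) = P" by (rule zw_inj)
qed

lemma nfp_invariant: "nfp n H \<Longrightarrow> gsubst2 H (frotation \<alpha>) = H"
  unfolding invariant_iff nfp_def resonant_def by (metis add.right_neutral mult_0_right mult_1_right)

text \<open>For a generator of degree \<open>m\<close> the bracket has degree
  \<open>m + n - 2\<close>, whose diagonal exponent is \<open>k\<close>. The free parameter of the
  recursion, present for \<open>m = n J\<close>, is spent on the diagonal term when \<open>J\<close>
  is odd; this is the origin of the congruence in \<open>okA\<close>.\<close>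

lemma okA_iff:
  assumes "2 * k + 2 = m + n" "m \<ge> 3"
  shows "okA n k \<longleftrightarrow> (\<nexists>J. odd J \<and> m = n * J)"
proof -
  consider "n = 3" | "n = 4" using n34 by blast
  then show ?thesis
  proof cases
    case 1
    have A: "\<exists>J. odd J \<and> m = 3 * J" if "(k - 2) mod 3 = 0"
    proof -
      from that obtain i where "k - 2 = 3 * i" by (meson mod_0_imp_dvd dvdE)
      then have "m = 3 * (2 * i + 1)" using assms 1 by simp
      then show ?thesis by (intro exI [of _ "2 * i + 1"]) simp
    qed
    have B: "(k - 2) mod 3 = 0" if "odd J" "m = 3 * J" for J
    proof -
      from that obtain i where "J = 2 * i + 1" by (elim oddE)
      then have "k - 2 = 3 * i" using that assms 1 by simp
      then show ?thesis by simp
    qed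
    have "(k - 2) mod 3 = 0 \<longleftrightarrow> (\<exists>J. odd J \<and> m = 3 * J)"
      by (rule iffI) (erule A, elim exE conjE, erule (1) B)
    moreover have "2 \<le> k" using assms 1 by linarith
    then have "okA n k \<longleftrightarrow> (k - 2) mod 3 \<noteq> 0" by (simp add: okA_def 1)
    ultimately show ?thesis unfolding 1 by (simp only:)
  next
    case 2
    have A: "\<exists>J. odd J \<and> m = 4 * J" if "(k - 2) mod 4 = 1"
    proof -
      have "k - 2 = 4 * ((k - 2) div 4) + 1" using that mult_div_mod_eq [of 4 "k - 2"] by linarith
      then have "m = 4 * (2 * ((k - 2) div 4) + 1)" using assms 2 by simp
      then show ?thesis by (intro exI [of _ "2 * ((k - 2) div 4) + 1"]) simp
    qed
    have B: "(k - 2) mod 4 = 1" if "odd J" "m = 4 * J" for J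
    proof -
      from that obtain i where "J = 2 * i + 1" by (elim oddE)
      then have "k - 2 = 4 * i + 1" using that assms 2 by simp
      then show ?thesis by simp
    qed
    have "(k - 2) mod 4 = 1 \<longleftrightarrow> (\<exists>J. odd J \<and> m = 4 * J)"
      by (rule iffI) (erule A, elim exE conjE, erule (1) B)
    moreover have "2 \<le> k" using assms 2 by linarith
    then have "okA n k \<longleftrightarrow> (k - 2) mod 4 \<noteq> 1" by (simp add: okA_def 2)
    ultimately show ?thesis unfolding 2 by (simp only:)
  qed
qed

text \<open>The counterpart for cosine terms: the exponents \<open>l + n\<close> and
  \<open>l\<close> have sum \<open>m + n - 2\<close> exactly if \<open>2 l + 2 = m\<close>, and the
  free parameter is spent here when \<open>J\<close> is even.\<close>

lemma okB_iff:
  assumes "2 * l + 2 = m" "m \<ge> 3"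
  shows "okB n l \<longleftrightarrow> (\<nexists>J. even J \<and> m = n * J)"
proof -
  consider "n = 3" | "n = 4" using n34 by blast
  then show ?thesis
  proof cases
    case 1
    have A: "\<exists>J. even J \<and> m = 3 * J" if "l mod 3 = 2"
    proof -
      have "l = 3 * (l div 3) + 2" using that mult_div_mod_eq [of 3 l] by linarith
      then have "m = 3 * (2 * (l div 3 + 1))" using assms 1 by simp
      then show ?thesis by (intro exI [of _ "2 * (l div 3 + 1)"]) simp
    qed
    have B: "l mod 3 = 2" if J: "even J" "m = 3 * J" for J
    proof -
      from J obtain i where i: "J = 2 * i" by (elim evenE)
      then obtain i' where "i = Suc i'" using J assms(2) by (cases i) auto
      then have "l = 3 * i' + 2" using i J assms 1 by simp
      then show ?thesis by presburger
    qed
    have "l mod 3 = 2 \<longleftrightarrow> (\<exists>J. even J \<and> m = 3 * J)"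
      by (rule iffI) (erule A, elim exE conjE, erule (1) B)
    moreover have "okB n l \<longleftrightarrow> l mod 3 \<noteq> 2" using 1 unfolding okB_def by simp
    ultimately show ?thesis unfolding 1 by (simp only:)
  next
    case 2
    have A: "\<exists>J. even J \<and> m = 4 * J" if "l mod 4 = 3"
    proof -
      have "l = 4 * (l div 4) + 3" using that mult_div_mod_eq [of 4 l] by linarith
      then have "m = 4 * (2 * (l div 4 + 1))" using assms 2 by simp
      then show ?thesis by (intro exI [of _ "2 * (l div 4 + 1)"]) simp
    qed
    have B: "l mod 4 = 3" if J: "even J" "m = 4 * J" for J
    proof -
      from J obtain i where i: "J = 2 * i" by (elim evenE)
      then obtain i' where "i = Suc i'" using J assms(2) by (cases i) auto
      then have "l = 4 * i' + 3" using i J assms 2 by simp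
      then show ?thesis by presburger
    qed
    have "l mod 4 = 3 \<longleftrightarrow> (\<exists>J. even J \<and> m = 4 * J)"
      by (rule iffI) (erule A, elim exE conjE, erule (1) B)
    moreover have "okB n l \<longleftrightarrow> l mod 4 \<noteq> 3" using 2 unfolding okB_def by simp
    ultimately show ?thesis unfolding 2 by (simp only:)
  qed
qed

end

text \<open>An equation that belongs to an actual monomial involves only indices of the parity for
  which monomials of degree \<open>m\<close> exist; at other indices a solution of the recursion may
  be nonzero while \<open>cseq\<close> is 0.\<close>

lemma hop_parity_cong:
  assumes a: "a = 0 \<or> n = 4" and par: "even (m + n + n * j)" and j: "j \<ge> 1"
    and c: "\<And>i. even (m + n * i) \<Longrightarrow> c i = c' i"
  shows "hop n m a \<beta> c j = hop n m a \<beta> c' j"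
proof -
  obtain j' where j': "j = Suc j'" using j by (cases j) auto
  have "even (m + n * (j + 1))" using par by (simp add: add_ac)
  moreover have "even (m + n * (j - 1))"
  proof -
    have "m + n + n * j = m + n * (j - 1) + 2 * n" by (simp add: j')
    then show ?thesis using par by (metis dvd_triv_left even_add)
  qed
  moreover have "a * c j = a * c' j"
  proof (cases "a = 0")
    case False
    then have "n = 4" using a by simp
    then have "even (m + n * j)" using par by simp
    then show ?thesis using c by simp
  qed simp
  ultimately have e: "c (j + 1) = c' (j + 1)" "c (j - 1) = c' (j - 1)" "a * c j = a * c' j"
    using c by blast+
  have "4 * a * real j * x = 4 * real j * (a * x)" for x by simp
  then show ?thesis unfolding hop_def by (simp only: e)
qed

lemma lead_vanish: "lead n a \<beta> H \<Longrightarrow> n \<le> 4 \<Longrightarrow> vanish n H"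
proof -
  assume H: "lead n a \<beta> H" and n: "n \<le> 4"
  have "vanish n (hlead n a \<beta>)"
    unfolding hlead_def using n by (intro vanish_add vanish_mono2) auto
  moreover have "vanish n (zw H - hlead n a \<beta>)"
    using H vanish_mono unfolding lead_def by (metis le_add1)
  ultimately have "vanish n ((zw H - hlead n a \<beta>) + hlead n a \<beta>)" by (intro vanish_add)
  then show "vanish n H" by (simp add: vanish_zw_iff)
qed

context resonance
begin

abbreviation R :: fmap where "R \<equiv> frotation \<alpha>"

text \<open>The error is split in three: \<open>\<eta>\<close> absorbs the non-resonant monomials,
  \<open>\<theta>\<close> the resonant ones not kept in the normal form, and \<open>h\<close> the
  rest. All three are built in \<open>z\<close>, \<open>w\<close> with hermitian coefficients, so
  that they come from real series.\<close>

lemma homological_solve: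
  assumes H: "lead n a \<beta> H" and beta: "\<beta> > 0" and inv: "gsubst2 H R = H"
    and m: "m \<ge> 3" and g: "vanish (m + n - 2) g"
  obtains \<eta> \<theta> h where "vanish (m + n - 2) \<eta>" "vanish m \<theta>" "gsubst2 \<theta> R = \<theta>" "nfp n h"
    "vanish (m + n - 2) h" "vanish (m + n - 1) (g + gsubst2 \<eta> R - \<eta> + br \<theta> H - h)"
proof -
  define M where "M = m + n - 2"
  have M: "M + 2 = m + n" using n34 m by (auto simp: M_def)
  have n2: "n \<ge> 2" "n > 0" using n34 by auto
  have m1: "m \<ge> 1" using m by simp
  have a: "a = 0 \<or> n = 4" using H by (simp add: lead_def)
  define \<gamma> where "\<gamma> k l = coeff2 (zw g) k l" for k l
  define \<rho> where "\<rho> k l = cis \<alpha> ^ k * cis (- \<alpha>) ^ l" for k l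
  have rho_cnj: "cnj (\<rho> k l) = \<rho> l k" for k l by (simp add: \<rho>_def cis_cnj mult.commute)
  have rho1: "\<rho> k l = 1 \<longleftrightarrow> resonant n k l" for k l by (simp add: \<rho>_def resonant_iff)
  have \<gamma>h: "\<gamma> l k = cnj (\<gamma> k l)" for k l unfolding \<gamma>_def by (rule zw_hermitian)
  \<comment> \<open>The rotation multiplies a monomial by \<open>\<rho> k l\<close>, so off
    resonance the operator taking \<open>\<eta>\<close> to \<open>gsubst2 \<eta> R - \<eta>\<close>
    is inverted by division.\<close>
  define Q1 where "Q1 = mk_fps2 (\<lambda>k l. if k + l = M \<and> \<rho> k l \<noteq> 1 then \<gamma> k l / (1 - \<rho> k l) else 0)"
  define \<eta> where "\<eta> = zwinv Q1"
  have zeta: "zw \<eta> = Q1"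
    unfolding \<eta>_def
  proof (rule zw_zwinv)
    show "coeff2 Q1 l k = cnj (coeff2 Q1 k l)" for k l
      using rho_cnj [of k l] \<gamma>h [of l k] by (auto simp: Q1_def add.commute complex_cnj_divide)
  qed
  define kk ll where "kk j = (M + n * j) div 2" and "ll j = (M - n * j) div 2" for j
  \<comment> \<open>The right-hand sides for \<open>r\<close> and \<open>s\<close> carry the signs
    of \<open>zw_br_lead_pos\<close>: the real parts \<open>r\<close> of the generator cancel
    \<open>Im \<gamma>\<close>, its imaginary parts \<open>s\<close> cancel
    \<open>Re \<gamma>\<close>.\<close>
  obtain r where r: "\<And>j. n * j > m \<Longrightarrow> r j = 0"
    "\<And>j. j \<ge> 1 \<Longrightarrow> n * j \<le> m + n - 2 \<Longrightarrow> hop n m a \<beta> r j = Im (\<gamma> (kk j) (ll j)) / real n"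
    using hop_solve_bounded [of n \<beta> m a "\<lambda>j. Im (\<gamma> (kk j) (ll j)) / real n"] n2 beta m by auto
  \<comment> \<open>The value of \<open>s 1\<close> for which, by \<open>zw_br_lead_diag\<close>,
    the bracket cancels the diagonal coefficient.\<close>
  define \<delta> where "\<delta> = - Re (\<gamma> (M div 2) (M div 2)) / (2 * real n * \<beta> * (real m + real n))"
  obtain s where s: "s 0 = 0" "\<And>j. n * j > m \<Longrightarrow> s j = 0"
    "\<And>j. j \<ge> 2 \<Longrightarrow> n * j \<le> m + n - 2 \<Longrightarrow> hop n m a \<beta> s j = - Re (\<gamma> (kk j) (ll j)) / real n"
    "\<And>J. m = n * J \<Longrightarrow> odd J \<Longrightarrow> s 1 = \<delta>"
    "\<And>J. m = n * J \<Longrightarrow> even J \<Longrightarrow> hop n m a \<beta> s 1 = - Re (\<gamma> (kk 1) (ll 1)) / real n"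
    using hop_solve_odd_part [OF n2(1) beta m1, of a "\<lambda>j. - Re (\<gamma> (kk j) (ll j)) / real n" \<delta>] by blast
  define c where "c j = Complex (r j) (s j)" for j
  define Q2 where "Q2 = mk_fps2 (\<lambda>k l. if k + l = m \<and> resonant n k l
    then if l \<le> k then c ((k - l) div n) else cnj (c ((l - k) div n)) else 0)"
  define \<theta> where "\<theta> = zwinv Q2"
  have res_sym: "resonant n l k = resonant n k l" for k l by (auto simp: resonant_def)
  have ztheta: "zw \<theta> = Q2"
    unfolding \<theta>_def
  proof (rule zw_zwinv)
    have "cnj (c 0) = c 0" by (simp add: c_def s(1) complex_eq_iff)
    then show "coeff2 Q2 l k = cnj (coeff2 Q2 k l)" for k l
      by (cases "k = l") (auto simp: Q2_def add.commute res_sym)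
  qed
  have cs: "cseq n m Q2 j = c j" if "even (m + n * j)" for j
  proof (cases "n * j \<le> m")
    case True
    then have "even (m - n * j)" using that by simp
    then obtain l where "m - n * j = 2 * l" by (elim evenE)
    then have l: "m = n * j + 2 * l" using True by simp
    have "coeff2 Q2 (l + n * j) l = cseq n m Q2 j" by (rule cseq_coeff2) (use l in auto)
    moreover have "coeff2 Q2 (l + n * j) l = c j"
      using l n2 by (auto simp: Q2_def resonant_def)
    ultimately show ?thesis by simp
  next
    case False
    then show ?thesis using r(1) [of j] s(2) [of j] by (simp add: cseq_def c_def complex_eq_iff)
  qed
  have th: "vanish m \<theta>" unfolding vanish_zw_iff [symmetric] ztheta by (simp add: vanish_def Q2_def)
  have th_inv: "gsubst2 \<theta> R = \<theta>" unfolding invariant_iff ztheta by (simp add: Q2_def)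
  have eta: "vanish M \<eta>" unfolding vanish_zw_iff [symmetric] zeta by (simp add: vanish_def Q1_def)
  define B where "B k l = coeff2 (zw (br \<theta> H)) k l" for k l
  have Bh: "B l k = cnj (B k l)" for k l unfolding B_def by (rule zw_hermitian)
  define ok where "ok k l \<longleftrightarrow> k = l \<and> okA n k \<or> k = l + n \<and> okB n l \<or> l = k + n \<and> okB n k" for k l
  \<comment> \<open>What is left on the kept monomials; its imaginary part has been cancelled by
    \<open>r\<close>, or is zero on the diagonal by symmetry.\<close>
  define Qh where "Qh = mk_fps2 (\<lambda>k l. if k + l = M \<and> ok k l then complex_of_real (Re (\<gamma> k l + B k l)) else 0)"
  define h where "h = zwinv Qh"
  have zh: "zw h = Qh"
    unfolding h_def
  proof (rule zw_zwinv)
    have "ok l k = ok k l" for k l by (auto simp: ok_def)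
    then show "coeff2 Qh l k = cnj (coeff2 Qh k l)" for k l
      using \<gamma>h [of l k] Bh [of l k] by (auto simp: Qh_def add.commute)
  qed
  have h: "vanish M h" unfolding vanish_zw_iff [symmetric] zh by (simp add: vanish_def Qh_def)
  have nfp: "nfp n h" unfolding nfp_def zh by (auto simp: Qh_def ok_def)
  have Hn: "vanish n H" using lead_vanish [OF H] n34 by auto
  define E where "E = g + gsubst2 \<eta> R - \<eta> + br \<theta> H - h"
  have zE: "coeff2 (zw E) k l = \<gamma> k l + (\<rho> k l - 1) * coeff2 Q1 k l + B k l - coeff2 Qh k l" for k l
    unfolding E_def zw_basic coeff2_add coeff2_diff coeff2_zw_rotation zeta zh
    by (simp add: \<gamma>_def B_def \<rho>_def algebra_simps)
  have main: "coeff2 (zw E) k l = 0" if kl: "k + l = M" "l \<le> k" for k l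
  proof (cases "resonant n k l")
    case False
    have "gsubst2 (br \<theta> H) R = br \<theta> H"
      by (simp add: gsubst2_br [OF canon_frotation] th_inv inv)
    then have "B k l = 0" using False unfolding invariant_iff B_def by blast
    moreover have "\<not> ok k l"
    proof
      assume "ok k l"
      then have "k = l + n * 0 \<or> k = l + n * 1 \<or> l = k + n * 1" by (auto simp: ok_def)
      then show False using False unfolding resonant_def by blast
    qed
    moreover have "\<rho> k l - 1 \<noteq> 0" using False rho1 by simp
    then have "(\<rho> k l - 1) * (\<gamma> k l / (1 - \<rho> k l)) = - \<gamma> k l" by (simp add: field_simps)
    ultimately show ?thesis using kl False by (simp add: zE Q1_def Qh_def rho1)
  next
    case True
    have "\<exists>j. k = l + n * j"
      using True kl(2) unfolding resonant_def by (metis add.right_neutral le_add1 le_antisym mult_0_right)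
    then obtain j where j: "k = l + n * j" by blast
    have Q10: "coeff2 Q1 k l = 0" using True by (simp add: Q1_def rho1)
    have Mj: "M + n * j = 2 * k" "M - n * j = 2 * l" "n * j \<le> m + n - 2" "k + l + 2 = m + n"
      using kl j M by (auto simp: M_def)
    have kkll: "kk j = k" "ll j = l" by (simp_all add: kk_def ll_def Mj)
    have par: "even (m + n + n * j)"
    proof -
      have "m + n + n * j = M + n * j + 2" using M by simp
      also have "\<dots> = 2 * (k + 1)" using Mj(1) by simp
      finally have "m + n + n * j = 2 * (k + 1)" .
      then show ?thesis by simp
    qed
    have rr: "hop n m a \<beta> (\<lambda>i. Re (cseq n m (zw \<theta>) i)) j = hop n m a \<beta> r j"
      and ss: "hop n m a \<beta> (\<lambda>i. Im (cseq n m (zw \<theta>) i)) j = hop n m a \<beta> s j" if "j \<ge> 1"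
      unfolding ztheta by (rule hop_parity_cong [OF a par that], simp add: cs c_def)+
    have ImB: "Im (B k l) = - Im (\<gamma> k l)" if "j \<ge> 1"
      using zw_br_lead_pos(2) [OF n2(1) H th j Mj(4) that] r(2) [OF that Mj(3)] n2
      by (simp add: B_def rr [OF that] kkll)
    have ReB: "Re (B k l) = - Re (\<gamma> k l)" if "j \<ge> 1" "hop n m a \<beta> s j = - Re (\<gamma> (kk j) (ll j)) / real n"
      using zw_br_lead_pos(1) [OF n2(1) H th j Mj(4) that(1)] that(2) n2
      by (simp add: B_def ss [OF that(1)] kkll)
    consider "j = 0" | "j = 1" | "j \<ge> 2" by linarith
    then have "\<gamma> k l + B k l = coeff2 Qh k l"
    proof cases
      case 1
      then have [simp]: "k = l" using j by simp
      have im: "Im (\<gamma> l l) = 0" "Im (B l l) = 0"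
        using arg_cong [OF \<gamma>h [of l l], of Im] arg_cong [OF Bh [of l l], of Im] by simp_all
      show ?thesis
      proof (cases "okA n l")
        case True
        then show ?thesis using kl im by (simp add: Qh_def ok_def complex_eq_iff)
      next
        case False
        have l2: "2 * l + 2 = m + n" using Mj by simp
        then obtain J where "odd J" "m = n * J" using False okA_iff [OF _ m, of l] by auto
        then have s1: "s 1 = \<delta>" using s(4) by blast
        have "m + n * 1 = 2 * (l + 1)" using l2 by simp
        then have "even (m + n * 1)" by simp
        then have "Im (cseq n m (zw \<theta>) 1) = \<delta>" using cs [of 1] s1 by (simp add: ztheta c_def)
        moreover have "2 * real n * \<beta> * (real m + real n) \<noteq> 0" using n2 beta by simp
        moreover have "M div 2 = l" using kl by simp
        ultimately have "B l l = - complex_of_real (Re (\<gamma> l l))"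
          using zw_br_lead_diag [OF n2(1) H th l2] by (simp add: B_def \<delta>_def del: mult_eq_0_iff)
        then show ?thesis using False im n2 by (simp add: Qh_def ok_def complex_eq_iff)
      qed
    next
      case 2
      then have k: "k = l + n" using j by simp
      show ?thesis
      proof (cases "okB n l")
        case True
        then show ?thesis using kl k ImB 2 by (simp add: Qh_def ok_def complex_eq_iff)
      next
        case False
        have "2 * l + 2 = m" using Mj k by simp
        then obtain J where "even J" "m = n * J" using False okB_iff [OF _ m, of l] by auto
        then have "hop n m a \<beta> s 1 = - Re (\<gamma> (kk 1) (ll 1)) / real n" using s(5) by blast
        then have "Re (B k l) = - Re (\<gamma> k l)" using ReB 2 by simp
        then show ?thesis using False n2 k ImB 2 by (simp add: Qh_def ok_def complex_eq_iff)
      qed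
    next
      case 3
      then have "n * j \<ge> n * 2" by (intro mult_le_mono2)
      then have "\<not> ok k l" using j n2 by (auto simp: ok_def)
      moreover have "Re (B k l) = - Re (\<gamma> k l)" using ReB s(3) [OF 3 Mj(3)] 3 by simp
      ultimately show ?thesis using ImB 3 by (simp add: Qh_def complex_eq_iff)
    qed
    then show ?thesis by (simp add: zE Q10)
  qed
  have "vanish M E"
    unfolding E_def
  proof (intro vanish_diff vanish_add)
    show "vanish M g" using g by (simp add: M_def)
    show "vanish M (gsubst2 \<eta> R)" by (rule vanish_gsubst2 [OF nc_frotation eta])
    show "vanish M (br \<theta> H)" unfolding M_def by (rule vanish_br_sub [OF th Hn])
  qed (fact eta h)+
  then have vE: "vanish M (zw E)" by (simp add: vanish_zw_iff)
  have "vanish (m + n - 1) (zw E)"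
  proof (rule vanishI)
    fix k l assume "k + l < m + n - 1"
    then consider "k + l < M" | "k + l = M" "l \<le> k" | "l + k = M" "k \<le> l" using M by linarith
    then show "coeff2 (zw E) k l = 0"
    proof cases
      case 1
      then show ?thesis using vE by (rule vanishD [rotated])
    next
      case 2
      then show ?thesis by (rule main)
    next
      case 3
      then have "coeff2 (zw E) l k = 0" by (rule main)
      then show ?thesis using zw_hermitian [of E k l] by simp
    qed
  qed
  then have "vanish (m + n - 1) E" by (simp add: vanish_zw_iff)
  with that eta th th_inv nfp h show ?thesis unfolding E_def M_def by blast
qed

text \<open>The equations force the coefficient sequences of \<open>\<eta>\<close> to vanish
  downwards from the top. When \<open>m = n J\<close>, the real top entry, which measures the
  multiple of the \<open>J\<close>-th power of the leading part, is excluded by \<open>top\<close>.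
  The imaginary one is excluded by the sign argument, since both normal forms lack the same
  coefficient.\<close>

lemma homological_unique:
  assumes H: "lead n a \<beta> H" and beta: "\<beta> > 0" and m: "m \<ge> 3"
    and chi: "vanish m \<eta>" and res: "vanish (m + 1) (gsubst2 \<eta> R - \<eta>)"
    and nf: "nfp n h" "nfp n h'" and eq: "vanish (m + n - 1) (br \<eta> H - (h - h'))"
    and top: "\<And>J. m = n * J \<Longrightarrow> Re (coeff2 (zw \<eta>) m 0) = 0"
  shows "vanish (m + 1) \<eta>"
proof -
  have n2: "n \<ge> 2" "n > 0" using n34 by auto
  have a: "a = 0 \<or> n = 4" using H by (simp add: lead_def)
  define c where "c = cseq n m (zw \<eta>)"
  define r s where "r = (\<lambda>j. Re (c j))" and "s = (\<lambda>j. Im (c j))"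
  have rs: "(\<lambda>j. Re (cseq n m (zw \<eta>) j)) = r" "(\<lambda>j. Im (cseq n m (zw \<eta>) j)) = s"
    by (simp_all add: r_def s_def c_def)
  define D where "D k l = coeff2 (zw h) k l - coeff2 (zw h') k l" for k l
  have D: "coeff2 (zw (br \<eta> H)) k l = D k l" if "k + l + 2 = m + n" for k l
  proof -
    have "vanish (m + n - 1) (zw (br \<eta> H - (h - h')))" using eq by (simp add: vanish_zw_iff)
    then have "coeff2 (zw (br \<eta> H - (h - h'))) k l = 0" by (rule vanishD) (use that in simp)
    then show ?thesis by (simp add: zw_basic D_def)
  qed
  have ImD: "Im (D k l) = 0" for k l
    using nf unfolding nfp_def D_def by (metis diff_zero minus_complex.sel(2) zero_complex.sel(2))
  have D0: "D k l = 0" if "\<not> (k = l \<and> okA n k \<or> k = l + n \<and> okB n l \<or> l = k + n \<and> okB n k)" for k l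
    using nf that unfolding nfp_def D_def by (metis diff_zero)
  have c_odd: "c j = 0" if "odd (m + n * j)" for j using that by (simp add: c_def cseq_odd)
  have c_big: "c j = 0" if "n * j > m" for j using that by (simp add: c_def cseq_0)
  have odd0: "hop n m a \<beta> r j = 0" "hop n m a \<beta> s j = 0" if od: "odd (m + n + n * j)" "j \<ge> 1" for j
  proof -
    obtain j' where j': "j = Suc j'" using od(2) by (cases j) auto
    have "c (j + 1) = 0" using od(1) by (intro c_odd) (simp add: add_ac)
    moreover have "m + n + n * j = m + n * (j - 1) + 2 * n" by (simp add: j')
    then have "c (j - 1) = 0" using od(1) by (intro c_odd) (metis dvd_triv_left even_add)
    moreover have "a = 0 \<or> c j = 0"
    proof (cases "a = 0")
      case False
      then have "odd (m + n * j)" using a od by auto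
      then show ?thesis using c_odd by blast
    qed simp
    ultimately show "hop n m a \<beta> r j = 0" "hop n m a \<beta> s j = 0"
      by (auto simp: hop_def r_def s_def)
  qed
  have split: "\<exists>k l. k = l + n * j \<and> k + l + 2 = m + n" if "even (m + n + n * j)" "n * j \<le> m + n - 2" for j
  proof -
    have "even (m + n - 2 - n * j)" using that m by auto
    then obtain l where "m + n - 2 - n * j = 2 * l" by (elim evenE)
    then have "(l + n * j) + l + 2 = m + n" using that m by linarith
    then show ?thesis by blast
  qed
  have rec_r: "hop n m a \<beta> r j = 0" if j: "j \<ge> 1" "n * j \<le> m + n - 2" for j
  proof (cases "even (m + n + n * j)")
    case True
    then obtain k l where kl: "k = l + n * j" "k + l + 2 = m + n" using split [OF True j(2)] by blast
    from zw_br_lead_pos(2) [OF n2(1) H chi kl that(1)] show ?thesis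
      using n2 by (simp add: D [OF kl(2)] ImD rs)
  next
    case False
    then show ?thesis by (rule odd0(1)) (rule that(1))
  qed
  have re_s: "real n * hop n m a \<beta> s j = Re (D k l)" if "j \<ge> 1" "k = l + n * j" "k + l + 2 = m + n" for j k l
    using zw_br_lead_pos(1) [OF n2(1) H chi that(2,3,1)] by (simp add: D [OF that(3)] rs)
  have rec_s: "hop n m a \<beta> s j = 0" if j: "j \<ge> 2" "n * j \<le> m + n - 2" for j
  proof (cases "even (m + n + n * j)")
    case True
    then obtain k l where kl: "k = l + n * j" "k + l + 2 = m + n" using split [OF True j(2)] by blast
    have "n * j \<ge> n * 2" using that by (intro mult_le_mono2)
    then have "D k l = 0" using kl(1) n2 by (intro D0) auto
    then show ?thesis using re_s [OF _ kl] that n2 by simp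
  next
    case False
    then show ?thesis by (rule odd0(2)) (use that in simp)
  qed
  have s0: "s 0 = 0"
  proof -
    have "cseq n m (zw \<eta>) 0 = cnj (cseq n m (zw \<eta>) 0)"
      using zw_hermitian [of \<eta> "m div 2" "m div 2"] by (auto simp: cseq_def)
    from arg_cong [OF this, of Im] show ?thesis by (simp add: s_def c_def)
  qed
  have cJ: "c J = coeff2 (zw \<eta>) m 0" if "m = n * J" for J
    unfolding c_def by (rule cseq_coeff2 [symmetric]) (use that in auto)
  have sJ: "s J = 0" if mJ: "m = n * J" for J
  proof (rule hop_top_zero [where n = n and a = a and \<beta> = \<beta>])
    show J1: "J \<ge> 1" using mJ m by (cases J) auto
    show "s (Suc J) = 0" using c_big [of "Suc J"] mJ n2 by (simp add: s_def)
    show "hop n (n * J) a \<beta> s j = 0" if "2 \<le> j" "j \<le> J" for j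
    proof -
      have "n * j \<le> m + n - 2" using mult_le_mono2 [OF that(2), of n] mJ n2 by linarith
      then show ?thesis using rec_s that mJ by simp
    qed
    show "s 1 = 0" if "odd J"
    proof (cases "even (m + n)")
      case True
      then obtain i where "m + n = 2 * i" by (elim evenE)
      then have k: "2 * (i - 1) + 2 = m + n" using m by simp
      define k where "k = i - 1"
      note k = k [folded k_def]
      have "\<not> okA n k" using okA_iff [OF k m] that mJ by blast
      then have "D k k = 0" using n2 by (intro D0) auto
      then have "complex_of_real (2 * real n * \<beta> * (real m + real n) * Im (cseq n m (zw \<eta>) 1)) = 0"
        using zw_br_lead_diag [OF n2(1) H chi k] D [of k k] k by simp
      then have "2 * real n * \<beta> * (real m + real n) * Im (cseq n m (zw \<eta>) 1) = 0"
        by (simp only: of_real_eq_0_iff)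
      moreover have "2 * real n * \<beta> * (real m + real n) \<noteq> 0" using n2 beta by simp
      ultimately have "Im (cseq n m (zw \<eta>) 1) = 0" by (simp only: mult_eq_0_iff simp_thms)
      then show ?thesis by (simp add: s_def c_def)
    next
      case False
      then show ?thesis using c_odd [of 1] by (simp add: s_def)
    qed
    show "s 0 = 0" by (rule s0)
    show "hop n (n * J) a \<beta> s 1 = 0" if "even J"
    proof -
      have "even m" using that mJ by simp
      then obtain i where "m = 2 * i" by (elim evenE)
      then have l: "2 * (i - 1) + 2 = m" using m by simp
      define l where "l = i - 1"
      note l = l [folded l_def]
      have "\<not> okB n l" using okB_iff [OF l m] that mJ by blast
      then have "D (l + n * 1) l = 0" using n2 by (intro D0) auto
      then show ?thesis using re_s [of 1 "l + n * 1" l] l n2 mJ by simp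
    qed
  qed (use n2 beta in auto)
  have b0: "\<beta> \<noteq> 0" using beta by simp
  have top0: "r j = 0 \<and> s j = 0" if "n * j \<ge> m" for j
  proof (cases "n * j = m")
    case True
    then show ?thesis using sJ [of j] top [of j] cJ [of j] by (simp add: r_def)
  next
    case False
    then show ?thesis using c_big [of j] that by (simp add: r_def s_def)
  qed
  \<comment> \<open>The equations for \<open>r\<close> hold from \<open>j = 1\<close> on, since both
    normal forms are real. For \<open>s\<close> the equation at 1 may contain a kept coefficient, so
    entry 0 is supplied by hermitian symmetry instead.\<close>
  have r0: "r j = 0" for j
    using hop_zero_seq [OF n2(1) b0, of m r 0 a j] top0 c_odd rec_r by (auto simp: r_def)
  have s0': "s j = 0" for j
    using hop_zero_seq [OF n2(1) b0, of m s 1 a j] top0 c_odd rec_s s0 by (cases "j = 0") (auto simp: s_def)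
  have c0: "c j = 0" for j using r0 [of j] s0' [of j] by (simp add: r_def s_def complex_eq_iff)
  have main: "coeff2 (zw \<eta>) k l = 0" if kl: "k + l = m" "l \<le> k" for k l
  proof (cases "resonant n k l")
    case True
    then have "\<exists>j. k = l + n * j"
      using kl(2) unfolding resonant_def by (metis add.right_neutral le_add1 le_antisym mult_0_right)
    then obtain j where "k = l + n * j" by blast
    then show ?thesis using cseq_coeff2 [OF kl(1), of n j "zw \<eta>"] c0 [of j] by (simp add: c_def)
  next
    case False
    have "vanish (m + 1) (zw (gsubst2 \<eta> R - \<eta>))" using res by (simp add: vanish_zw_iff)
    then have "coeff2 (zw (gsubst2 \<eta> R - \<eta>)) k l = 0" by (rule vanishD) (use kl in simp)
    then have "(cis \<alpha> ^ k * cis (- \<alpha>) ^ l - 1) * coeff2 (zw \<eta>) k l = 0"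
      by (simp add: zw_basic coeff2_zw_rotation algebra_simps)
    then show ?thesis using False resonant_iff [of k l] by simp
  qed
  have vz: "vanish m (zw \<eta>)" using chi by (simp add: vanish_zw_iff)
  have "vanish (m + 1) (zw \<eta>)"
  proof (rule vanishI)
    fix k l assume "k + l < m + 1"
    then consider "k + l < m" | "k + l = m" "l \<le> k" | "l + k = m" "k \<le> l" by linarith
    then show "coeff2 (zw \<eta>) k l = 0"
    proof cases
      case 1
      then show ?thesis using vz by (rule vanishD [rotated])
    next
      case 2
      then show ?thesis by (rule main)
    next
      case 3
      then have "coeff2 (zw \<eta>) l k = 0" by (rule main)
      then show ?thesis using zw_hermitian [of \<eta> k l] by simp
    qed
  qed
  then show ?thesis by (simp add: vanish_zw_iff)
qed

end

subsection \<open>One step of the normalisation\<close>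

lemma agree_flow:
  assumes "vanish m H" "m \<ge> 3"
  shows "agree (m - 1) (flow H) (X2, Y2)"
proof -
  have H3: "vanish 3 H" using assms vanish_mono by blast
  have "opcong (m - 2) (lexp (ad H)) (\<lambda>P. P)"
    by (rule opcong_lexp_1 [OF raising_ad_minus [OF assms(1)]]) (use assms in auto)
  then have "opcong (m - 2) (\<lambda>P. gsubst2 P (flow H)) (\<lambda>P. gsubst2 P (X2, Y2))"
    by (simp add: gsubst2_flow [OF H3])
  moreover have "m - 2 + 1 = m - 1" using assms(2) by simp
  ultimately show ?thesis using opcong_agree [OF nc_flow [OF H3] nc_id] by metis
qed

lemma gcomp_cancel:
  assumes "nc A" "nc B" "nc C" "gcomp B C = (X2, Y2)"
  shows "gcomp (gcomp A B) C = A"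
  using assms by (simp add: gcomp_assoc)

lemma gcomp_cancel_left:
  assumes "nc A" "nc B" "nc C" "gcomp A B = (X2, Y2)"
  shows "gcomp A (gcomp B C) = C"
  using assms by (simp add: gcomp_assoc [symmetric] id_gcomp)

lemma nfp_add:
  assumes "nfp n H" "nfp n K"
  shows "nfp n (H + K)"
  unfolding nfp_def zw_basic coeff2_add
proof (intro allI impI)
  fix k l assume ne: "coeff2 (zw H) k l + coeff2 (zw K) k l \<noteq> 0"
  have "Im (coeff2 (zw H) k l) = 0" "Im (coeff2 (zw K) k l) = 0"
    using assms unfolding nfp_def by (metis zero_complex.sel(2))+
  moreover have "coeff2 (zw H) k l \<noteq> 0 \<or> coeff2 (zw K) k l \<noteq> 0" using ne by auto
  ultimately show "Im (coeff2 (zw H) k l + coeff2 (zw K) k l) = 0 \<and>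
      (k = l \<and> okA n k \<or> k = l + n \<and> okB n l \<or> l = k + n \<and> okB n k)"
    using assms unfolding nfp_def by (auto simp only: plus_complex.sel add_0_left)
qed

lemma lead_cong:
  assumes "lead n a \<beta> H" "vanish (n + 1) (K - H)"
  shows "lead n a \<beta> K"
proof -
  have "vanish (n + 1) (zw K - zw H)"
    using assms(2) by (simp add: vanish_zw_iff zw_basic(2) [symmetric])
  then show ?thesis
    using assms(1) vanish_diff_trans unfolding lead_def by blast
qed

context resonance
begin

definition normal_map :: "fps2 \<Rightarrow> fmap" where
  "normal_map H = gcomp R (flow H)"

lemma canon_normal_map: "vanish 3 H \<Longrightarrow> canon (normal_map H)"
  unfolding normal_map_def by (intro canon_gcomp canon_frotation canon_flow)

lemma gsubst2_normal_map: "vanish 3 H \<Longrightarrow> gsubst2 P (normal_map H) = lexp (ad H) (gsubst2 P R)"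
  unfolding normal_map_def by (simp add: gsubst2_gcomp nc_frotation nc_flow gsubst2_flow)

lemma rotation_lexp:
  "vanish 3 H \<Longrightarrow> gsubst2 (lexp (ad H) P) R = lexp (ad (gsubst2 H R)) (gsubst2 P R)"
  by (rule gsubst2_lexp_ad [OF canon_frotation])

lemma lead_vanish3: "lead n a \<beta> H \<Longrightarrow> vanish 3 H"
proof -
  assume "lead n a \<beta> H"
  then have "vanish n H" using lead_vanish n34 by auto
  then show "vanish 3 H" by (rule vanish_mono) (use n34 in auto)
qed

lemma agree_normal_map:
  assumes "vanish 3 H" "vanish 3 K" "vanish (d + 1) (K - H)" "d \<ge> 2"
  shows "agree d (normal_map K) (normal_map H)"
proof -
  have r: "raising (d - 1) (ad (K - H))" using raising_ad_minus [OF assms(3)] assms(4) by simp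
  have "opcong d (lexp (ad K)) (\<lambda>P. lexp (ad H) P + br P (K - H))"
    using opcong_perturb_ad [OF assms(1,3,4)] by simp
  then have "opcong (d - 1) (lexp (ad K)) (\<lambda>P. lexp (ad H) P + br P (K - H))"
    by (rule opcong_mono) simp
  then have "opcong (d - 1) (lexp (ad K)) (lexp (ad H))"
    using opcong_raising0 [OF r] by (rule opcong_trans)
  from opcong_comp_right [OF this raising_gsubst2 [OF nc_frotation, of \<alpha>]]
  have "opcong (d - 1) (\<lambda>P. gsubst2 P (normal_map K)) (\<lambda>P. gsubst2 P (normal_map H))"
    by (simp add: gsubst2_normal_map assms)
  from opcong_agree [OF _ _ this] show ?thesis
    using assms by (simp add: canon_nc canon_normal_map)
qed

text \<open>In the coordinates \<open>C\<close> the map is \<open>normal_map H\<close> composed with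
  a symplectic \<open>D\<close> close to the identity, whose leading Hamiltonian \<open>g\<close> is
  the error to be normalised. Since \<open>\<theta>\<close> has order \<open>d + 3 - n\<close>, the
  change of variables is altered from order \<open>d + 2 - n\<close> on, which still tends to
  infinity with \<open>d\<close>.\<close>

lemma normal_step:
  assumes T: "symp T" and C: "canon C" and H: "lead n a \<beta> H" "nfp n H" and beta: "\<beta> > 0"
    and d: "d \<ge> n" and ag: "agree d (gcomp C T) (gcomp (normal_map H) C)"
  obtains C' h where "canon C'" "agree (d + 2 - n) C' C" "vanish (d + 1) h" "nfp n h"
    "agree (d + 1) (gcomp C' T) (gcomp (normal_map (H + h)) C')"
proof -
  have n3: "n \<ge> 3" "n \<le> 4" using n34 by auto
  have d2: "d \<ge> 2" using d n3 by simp
  note H3 = lead_vanish3 [OF H(1)]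
  note inv = nfp_invariant [OF H(2)]
  let ?N = "normal_map H"
  have N: "canon ?N" by (rule canon_normal_map [OF H3])
  obtain Ci where Ci: "canon Ci" "gcomp C Ci = (X2, Y2)" "gcomp Ci C = (X2, Y2)"
    using canon_inverse [OF C] by metis
  obtain Ni where Ni: "canon Ni" "gcomp ?N Ni = (X2, Y2)" "gcomp Ni ?N = (X2, Y2)"
    using canon_inverse [OF N] by metis
  note nc = symp_nc [OF T] canon_nc [OF C] canon_nc [OF N] canon_nc [OF Ci(1)] canon_nc [OF Ni(1)]
  define F where "F = gcomp (gcomp C T) Ci"
  have F: "symp F" unfolding F_def by (intro symp_gcomp T canon_symp C Ci)
  have FC: "gcomp F C = gcomp C T"
    unfolding F_def by (rule gcomp_cancel [OF nc_gcomp [OF nc(2) nc(1)] nc(4) nc(2) Ci(3)])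
  have "agree d F (gcomp (gcomp ?N C) Ci)"
    unfolding F_def by (intro agree_gcomp ag agree_refl nc nc_gcomp)
  then have agF: "agree d F ?N" using gcomp_cancel [OF nc(3,2,4) Ci(2)] by simp
  define D where "D = gcomp Ni F"
  have D: "symp D" unfolding D_def by (intro symp_gcomp canon_symp Ni F)
  have "agree d D (gcomp Ni ?N)"
    unfolding D_def by (intro agree_gcomp agree_refl agF nc symp_nc [OF F])
  then have agD: "agree d D (X2, Y2)" by (simp add: Ni)
  have FND: "F = gcomp ?N D"
    unfolding D_def using gcomp_cancel_left [OF nc(3,5) symp_nc [OF F] Ni(2)] by simp
  obtain g where g: "hom2 (d + 1) g" "opcong d (\<lambda>P. gsubst2 P D) (\<lambda>P. P + br P g)"
    using symp_leading_op [OF D agD d2] .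
  have vg: "vanish (d + 1) g" by (rule hom2_vanish [OF g(1)])
  \<comment> \<open>The operator of the perturbed flow with the rotation split off: up to precision
    \<open>d\<close>, the operators below are \<open>W\<close> after substitution of
    \<open>R\<close>.\<close>
  define W where "W g = (\<lambda>Q. lexp (ad H) Q + br Q g)" for g
  note rH = raising_lexp_ad [OF H3]
  have rg: "raising (d - 1) (ad g)" using raising_ad_minus [OF vg] d2 by simp
  note rR = raising_gsubst2 [OF nc_frotation, of \<alpha>]
  have SF: "opcong d (\<lambda>P. gsubst2 P F) (\<lambda>P. W g (gsubst2 P R))"
  proof -
    have eq: "gsubst2 P F = gsubst2 (lexp (ad H) (gsubst2 P R)) D" for P
      by (simp add: FND gsubst2_gcomp nc symp_nc [OF D] gsubst2_normal_map [OF H3])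
    have H1: "opcong 1 (lexp (ad H)) (\<lambda>P. P)" by (rule opcong_lexp_1 [OF raising_ad3 [OF H3]]) simp
    have "opcong d (\<lambda>Q. gsubst2 (lexp (ad H) Q) D) (\<lambda>Q. lexp (ad H) Q + br (lexp (ad H) Q) g)"
      using opcong_comp_right [OF g(2) rH] by simp
    also have "opcong d (\<lambda>Q. lexp (ad H) Q + br (lexp (ad H) Q) g) (W g)"
      unfolding W_def using opcong_absorb_right [OF H1 rg] d2 by (intro opcong_add opcong_refl) simp
    finally have "opcong d (\<lambda>Q. gsubst2 (lexp (ad H) Q) D) (W g)" .
    from opcong_comp_right [OF this rR] show ?thesis unfolding eq by simp
  qed
  \<comment> \<open>Chosen so that the bracket of \<open>\<theta>\<close> with the leading part, of
    degree \<open>m + n - 2\<close>, meets the error in degree \<open>d + 1\<close>.\<close>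
  define m where "m = d + 3 - n"
  have m: "m \<ge> 3" "m + n = d + 3" "m + n - 2 = d + 1" "m + n - 1 = d + 2" using d n3 by (auto simp: m_def)
  obtain \<eta> \<theta> h where sol: "vanish (d + 1) \<eta>" "vanish m \<theta>" "gsubst2 \<theta> R = \<theta>" "nfp n h"
    "vanish (d + 1) h" "vanish (d + 2) (g + gsubst2 \<eta> R - \<eta> + br \<theta> H - h)"
    using homological_solve [OF H(1) beta inv m(1), of g] vg unfolding m(3,4) by blast
  have th3: "vanish 3 \<theta>" "vanish 3 (- \<theta>)" using sol(2) m(1) vanish_mono vanish_uminus by blast+
  have "vanish 3 \<eta>" by (rule vanish_mono [OF sol(1)]) (use d2 in simp)
  then have eta3: "vanish 3 \<eta>" "vanish 3 (- \<eta>)" using vanish_uminus by blast+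
  \<comment> \<open>Substitution reverses the order: as an operator, \<open>A\<close> applies the
    exponential of \<open>\<eta>\<close> first. The conjugation by the flow of
    \<open>\<theta>\<close> is thus the inner one, to be treated before that of
    \<open>\<eta>\<close>.\<close>
  define A Ai where "A = gcomp (flow \<eta>) (flow \<theta>)" and "Ai = gcomp (flow (- \<theta>)) (flow (- \<eta>))"
  note cf = canon_flow [OF th3(1)] canon_flow [OF th3(2)] canon_flow [OF eta3(1)] canon_flow [OF eta3(2)]
  note ncf = nc_flow [OF th3(1)] nc_flow [OF th3(2)] nc_flow [OF eta3(1)] nc_flow [OF eta3(2)]
  have A: "canon A" "canon Ai" unfolding A_def Ai_def by (intro canon_gcomp cf)+
  have SA: "gsubst2 P A = lexp (ad \<theta>) (lexp (ad \<eta>) P)" for P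
    by (simp add: A_def gsubst2_gcomp ncf gsubst2_flow th3 eta3)
  have SAi: "gsubst2 P Ai = lexp (ad (- \<eta>)) (lexp (ad (- \<theta>)) P)" for P
    by (simp add: Ai_def gsubst2_gcomp ncf gsubst2_flow th3 eta3)
  have AiA: "gcomp Ai A = (X2, Y2)"
  proof (rule map_eqI)
    show "nc (gcomp Ai A)" using A canon_nc nc_gcomp by blast
    show "gsubst2 P (gcomp Ai A) = gsubst2 P (X2, Y2)" for P
      using lexp_ad_inverse [OF th3(2)] lexp_ad_inverse [OF eta3(2)]
      by (simp add: gsubst2_gcomp A [THEN canon_nc] SA SAi)
  qed simp
  define C' where "C' = gcomp A C"
  define F' where "F' = gcomp A (gcomp F Ai)"
  have C': "canon C'" unfolding C'_def by (rule canon_gcomp [OF A(1) C])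
  have F': "nc F'" unfolding F'_def by (intro nc_gcomp canon_nc A symp_nc F)
  note nA = canon_nc [OF A(1)] canon_nc [OF A(2)] symp_nc [OF F]
  have F'C': "gcomp F' C' = gcomp C' T"
  proof -
    have "gcomp F' C' = gcomp A (gcomp F (gcomp (gcomp Ai A) C))"
      unfolding F'_def C'_def by (simp add: gcomp_assoc nc_gcomp nA nc)
    also have "\<dots> = gcomp A (gcomp F C)" by (simp add: AiA id_gcomp nc)
    also have "\<dots> = gcomp C' T" unfolding FC C'_def by (simp add: gcomp_assoc nc)
    finally show ?thesis .
  qed
  have agC: "agree (d + 2 - n) C' C"
  proof -
    have a1: "agree (d + 2 - n) (flow \<eta>) (X2, Y2)"
      by (rule agree_mono [OF agree_flow [OF sol(1)]]) (use d2 n3 in auto)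
    have a2: "agree (d + 2 - n) (flow \<theta>) (X2, Y2)"
      by (rule agree_mono [OF agree_flow [OF sol(2) m(1)]]) (auto simp: m_def)
    have "agree (d + 2 - n) A (gcomp (X2, Y2) (X2, Y2))"
      unfolding A_def by (intro agree_gcomp a1 a2 ncf nc_id)
    then have "agree (d + 2 - n) C' (gcomp (X2, Y2) C)"
      unfolding C'_def by (intro agree_gcomp nA nc agree_refl) simp
    then show ?thesis by (simp add: id_gcomp nc)
  qed
  define g1 where "g1 = g + br \<theta> H"
  have vbr: "vanish (d + 1) (br \<theta> H)"
  proof -
    have "vanish n H" using lead_vanish [OF H(1)] n3 by simp
    from vanish_br_sub [OF sol(2) this] show ?thesis by (simp only: m(3))
  qed
  have vg1: "vanish (d + 1) g1" unfolding g1_def by (rule vanish_add [OF vg vbr])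
  have vH: "vanish n H" using lead_vanish [OF H(1)] n3 by simp
  have S1: "opcong d (\<lambda>P. lexp (ad (- \<theta>)) (gsubst2 (lexp (ad \<theta>) P) F)) (\<lambda>P. W g1 (gsubst2 P R))"
  proof -
    have "opcong d (\<lambda>P. gsubst2 (lexp (ad \<theta>) P) F) (\<lambda>P. W g (gsubst2 (lexp (ad \<theta>) P) R))"
      using opcong_comp_right [OF SF raising_lexp_ad [OF th3(1)]] by simp
    then have "opcong d (\<lambda>P. lexp (ad (- \<theta>)) (gsubst2 (lexp (ad \<theta>) P) F))
        (\<lambda>P. lexp (ad (- \<theta>)) (W g (gsubst2 (lexp (ad \<theta>) P) R)))"
      using opcong_comp_left [OF _ raising_lexp_ad [OF th3(2)]] by fastforce
    also have "(\<lambda>P. lexp (ad (- \<theta>)) (W g (gsubst2 (lexp (ad \<theta>) P) R))) =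
        (\<lambda>P. lexp (ad (- \<theta>)) (W g (lexp (ad \<theta>) (gsubst2 P R))))"
      by (simp add: rotation_lexp [OF th3(1)] sol(3))
    also have "opcong d (\<lambda>Q. lexp (ad (- \<theta>)) (W g (lexp (ad \<theta>) Q))) (W g1)"
      unfolding W_def g1_def by (rule conj_resonant [OF vH n3(1) sol(2) m(1) vg m(2)])
    from opcong_comp_right [OF this rR]
    have "opcong d (\<lambda>P. lexp (ad (- \<theta>)) (W g (lexp (ad \<theta>) (gsubst2 P R)))) (\<lambda>P. W g1 (gsubst2 P R))" by simp
    finally show ?thesis .
  qed
  define \<eta>' where "\<eta>' = gsubst2 \<eta> R"
  have eta': "vanish (d + 1) \<eta>'" unfolding \<eta>'_def by (rule vanish_gsubst2 [OF nc_frotation sol(1)])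
  have S2: "opcong d (\<lambda>P. gsubst2 P F') (\<lambda>P. W (g1 + \<eta>' - \<eta>) (gsubst2 P R))"
  proof -
    have "gsubst2 P F' = lexp (ad (- \<eta>)) (lexp (ad (- \<theta>)) (gsubst2 (lexp (ad \<theta>) (lexp (ad \<eta>) P)) F))" for P
      by (simp add: F'_def gsubst2_gcomp nA nc_gcomp SA SAi)
    moreover have "opcong d (\<lambda>P. lexp (ad (- \<theta>)) (gsubst2 (lexp (ad \<theta>) (lexp (ad \<eta>) P)) F)) (\<lambda>P. W g1 (gsubst2 (lexp (ad \<eta>) P) R))"
      using opcong_comp_right [OF S1 raising_lexp_ad [OF eta3(1)]] by simp
    from opcong_comp_left [OF this raising_lexp_ad [OF eta3(2)]]
    have "opcong d (\<lambda>P. lexp (ad (- \<eta>)) (lexp (ad (- \<theta>)) (gsubst2 (lexp (ad \<theta>) (lexp (ad \<eta>) P)) F)))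
        (\<lambda>P. lexp (ad (- \<eta>)) (W g1 (gsubst2 (lexp (ad \<eta>) P) R)))" by simp
    moreover have "(\<lambda>P. lexp (ad (- \<eta>)) (W g1 (gsubst2 (lexp (ad \<eta>) P) R))) =
        (\<lambda>P. lexp (ad (- \<eta>)) (W g1 (lexp (ad \<eta>') (gsubst2 P R))))"
      by (simp add: rotation_lexp [OF eta3(1)] \<eta>'_def)
    moreover have "opcong d (\<lambda>Q. lexp (ad (- \<eta>)) (W g1 (lexp (ad \<eta>') Q))) (W (g1 + \<eta>' - \<eta>))"
      unfolding W_def by (rule conj_nonresonant [OF H3 sol(1) eta' vg1 d2])
    from opcong_comp_right [OF this rR]
    have "opcong d (\<lambda>P. lexp (ad (- \<eta>)) (W g1 (lexp (ad \<eta>') (gsubst2 P R)))) (\<lambda>P. W (g1 + \<eta>' - \<eta>) (gsubst2 P R))" by simp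
    ultimately show ?thesis using opcong_trans by auto
  qed
  have Hh3: "vanish 3 (H + h)"
    using H3 sol(5) d2 by (intro vanish_add) (auto elim!: vanish_mono)
  have "opcong d (W (g1 + \<eta>' - \<eta>)) (W h)"
    unfolding W_def
    by (intro opcong_add opcong_refl opcong_ad) (use sol(6) in \<open>simp add: g1_def \<eta>'_def algebra_simps\<close>)
  also have "opcong d (W h) (lexp (ad (H + h)))"
    unfolding W_def by (rule opcong_sym [OF opcong_perturb_ad [OF H3 sol(5) d2]])
  finally have "opcong d (W (g1 + \<eta>' - \<eta>)) (lexp (ad (H + h)))" .
  from opcong_trans [OF S2 opcong_comp_right [OF this rR, simplified]]
  have "opcong d (\<lambda>P. gsubst2 P F') (\<lambda>P. gsubst2 P (normal_map (H + h)))"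
    by (simp add: gsubst2_normal_map [OF Hh3])
  then have agF': "agree (d + 1) F' (normal_map (H + h))"
    by (rule opcong_agree [OF F' canon_nc [OF canon_normal_map [OF Hh3]]])
  have "agree (d + 1) (gcomp F' C') (gcomp (normal_map (H + h)) C')"
    by (intro agree_gcomp agF' agree_refl F' canon_nc canon_normal_map Hh3 C')
  then show ?thesis
    unfolding F'C' using that [OF C' agC sol(5,4)] by blast
qed

end

subsection \<open>Existence and uniqueness of the normal form\<close>

lemma coeff2_gsubst2_linear:
  fixes P :: fps2
  assumes "vanish 1 P"
  shows "coeff2 (gsubst2 P (frotation \<alpha>)) 1 0 = coeff2 P 1 0 * cos \<alpha> + coeff2 P 0 1 * sin \<alpha>"
    and "coeff2 (gsubst2 P (frotation \<alpha>)) 0 1 = - coeff2 P 1 0 * sin \<alpha> + coeff2 P 0 1 * cos \<alpha>"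
proof -
  let ?L = "const2 (coeff2 P 1 0) * X2 + const2 (coeff2 P 0 1) * Y2"
  have "vanish 2 (P - ?L)"
  proof (rule vanishI)
    fix i j :: nat assume "i + j < 2"
    then consider "i = 0" "j = 0" | "i = 1" "j = 0" | "i = 0" "j = 1" by linarith
    then show "coeff2 (P - ?L) i j = 0"
      using vanishD [OF assms, of 0 0] by cases (simp_all add: coeff2_lin)
  qed
  then have v: "vanish 2 (gsubst2 P (frotation \<alpha>) - gsubst2 ?L (frotation \<alpha>))"
    using vanish_gsubst2 [OF nc_frotation] by (simp flip: gsubst2_diff [OF nc_frotation])
  have L: "gsubst2 ?L (frotation \<alpha>) = const2 (coeff2 P 1 0) * fst (frotation \<alpha>) + const2 (coeff2 P 0 1) * snd (frotation \<alpha>)"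
    by (simp add: gsubst2_add gsubst2_const_mult [OF nc_frotation] gsubst2_basic [OF nc_frotation])
  have "coeff2 (gsubst2 ?L (frotation \<alpha>)) 1 0 = coeff2 P 1 0 * cos \<alpha> + coeff2 P 0 1 * sin \<alpha>"
    "coeff2 (gsubst2 ?L (frotation \<alpha>)) 0 1 = - coeff2 P 1 0 * sin \<alpha> + coeff2 P 0 1 * cos \<alpha>"
    unfolding L by (simp_all only: frotation_def fst_conv snd_conv coeff2_linear) simp_all
  then show "coeff2 (gsubst2 P (frotation \<alpha>)) 1 0 = coeff2 P 1 0 * cos \<alpha> + coeff2 P 0 1 * sin \<alpha>"
    "coeff2 (gsubst2 P (frotation \<alpha>)) 0 1 = - coeff2 P 1 0 * sin \<alpha> + coeff2 P 0 1 * cos \<alpha>"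
    using vanishD [OF v, of 1 0] vanishD [OF v, of 0 1] by simp_all
qed

context resonance
begin

lemma sin_nonzero: "sin \<alpha> \<noteq> 0"
proof
  assume "sin \<alpha> = 0"
  then have "cis \<alpha> ^ 2 = 1"
    using sin_cos_squared_add [of \<alpha>] by (simp add: complex_eq_iff power2_eq_square)
  then show False using cis_k [of 2] n34 by auto
qed

text \<open>Stage \<open>k\<close> works at precision \<open>d = n + k\<close>. The Hamiltonians
  then change from degree \<open>n + k + 1\<close> on and the changes of variables from order
  \<open>k + 2\<close> on, so both sequences have limits.\<close>

lemma existence_from_leading:
  assumes T: "symp T" and C0: "canon C0" and H0: "lead n a \<beta> H0" "nfp n H0" and beta: "\<beta> > 0"
    and ag0: "agree n (gcomp C0 T) (gcomp (normal_map H0) C0)"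
  obtains C H where "canon C" "lead n a \<beta> H" "nfp n H" "gcomp C T = gcomp (normal_map H) C"
proof -
  define P where "P k x \<longleftrightarrow> canon (fst x) \<and> lead n a \<beta> (snd x) \<and> nfp n (snd x) \<and>
      agree (n + k) (gcomp (fst x) T) (gcomp (normal_map (snd x)) (fst x))" for k and x :: "fmap \<times> fps2"
  define Q where "Q k x y \<longleftrightarrow> agree (Suc k) (fst y) (fst x) \<and> vanish (n + k + 1) (snd y - snd x)"
    for k and x y :: "fmap \<times> fps2"
  have "\<exists>f. \<forall>k. P k (f k) \<and> Q k (f k) (f (Suc k))"
  proof (rule dependent_nat_choice)
    show "\<exists>x. P 0 x" using C0 H0 ag0 by (intro exI [of _ "(C0, H0)"]) (simp add: P_def)
    fix x k assume x: "P k x"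
    have "canon (fst x)" "lead n a \<beta> (snd x)" "nfp n (snd x)" "n + k \<ge> n"
      "agree (n + k) (gcomp (fst x) T) (gcomp (normal_map (snd x)) (fst x))"
      using x by (simp_all add: P_def)
    from normal_step [OF T this(1-3) beta this(4,5)]
    obtain C' h where s: "canon C'" "agree (n + k + 2 - n) C' (fst x)" "vanish (n + k + 1) h" "nfp n h"
      "agree (n + k + 1) (gcomp C' T) (gcomp (normal_map (snd x + h)) C')" .
    have "lead n a \<beta> (snd x + h)"
      by (rule lead_cong [of n a \<beta> "snd x"]) (use x s(3) in \<open>auto simp: P_def elim!: vanish_mono\<close>)
    moreover have "nfp n (snd x + h)" using x s(4) by (intro nfp_add) (simp_all add: P_def)
    moreover have "agree (Suc k) C' (fst x)" by (rule agree_mono [OF s(2)]) simp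
    ultimately show "\<exists>y. P (Suc k) y \<and> Q k x y"
      using s by (intro exI [of _ "(C', snd x + h)"]) (simp add: P_def Q_def)
  qed
  then obtain f where f: "\<And>k. P k (f k)" "\<And>k. Q k (f k) (f (Suc k))" by blast
  define Cs Hs where "Cs k = fst (f k)" and "Hs k = snd (f k)" for k
  have Cs: "canon (Cs k)" and Hs: "lead n a \<beta> (Hs k)" "nfp n (Hs k)"
    and ag: "agree (n + k) (gcomp (Cs k) T) (gcomp (normal_map (Hs k)) (Cs k))" for k
    using f(1) [of k] by (simp_all add: P_def Cs_def Hs_def)
  have agC: "agree (Suc k) (Cs (Suc k)) (Cs k)" and vH: "vanish (n + k + 1) (Hs (Suc k) - Hs k)" for k
    using f(2) [of k] by (simp_all add: Q_def Cs_def Hs_def)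
  define C H where "C = limit_map Cs" and "H = limit2 Hs"
  have C: "canon C" unfolding C_def by (rule canon_limit_map [OF Cs agC])
  have aC: "agree (Suc k) C (Cs k)" for k unfolding C_def by (rule limit_map_agree [OF agC])
  have "vanish (Suc k) (Hs (Suc k) - Hs k)" for k by (rule vanish_mono [OF vH]) simp
  then have aH: "vanish (Suc k) (H - Hs k)" for k unfolding H_def by (rule limit2_vanish)
  have H: "lead n a \<beta> H" by (rule lead_cong [OF Hs(1) [of n]]) (use aH [of n] in simp)
  have "nfp n H"
    unfolding nfp_def
  proof (intro allI impI)
    fix k l assume ne: "coeff2 (zw H) k l \<noteq> 0"
    have "vanish (Suc (k + l)) (zw (H - Hs (k + l)))" by (simp only: vanish_zw_iff aH)
    then have "coeff2 (zw H) k l = coeff2 (zw (Hs (k + l))) k l"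
      using vanishD [of "Suc (k + l)" _ k l] by (fastforce simp: zw_basic)
    then show "Im (coeff2 (zw H) k l) = 0 \<and> (k = l \<and> okA n k \<or> k = l + n \<and> okB n l \<or> l = k + n \<and> okB n k)"
      using ne Hs(2) [of "k + l"] unfolding nfp_def by metis
  qed
  moreover have "gcomp C T = gcomp (normal_map H) C"
  proof (rule agree_all)
    fix d :: nat
    define k where "k = d + 2"
    note ncN = canon_nc [OF canon_normal_map [OF lead_vanish3 [OF H]]]
      canon_nc [OF canon_normal_map [OF lead_vanish3 [OF Hs(1) [of k]]]]
    note n = canon_nc [OF C] canon_nc [OF Cs [of k]] symp_nc [OF T] ncN
    have aCk: "agree k C (Cs k)" by (rule agree_mono [OF aC]) simp
    have "agree k (normal_map H) (normal_map (Hs k))"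
      by (rule agree_normal_map) (use lead_vanish3 [OF H] lead_vanish3 [OF Hs(1)] aH [of k] in \<open>auto simp: k_def\<close>)
    then have "agree k (gcomp (normal_map H) C) (gcomp (normal_map (Hs k)) (Cs k))"
      by (intro agree_gcomp n aCk)
    moreover have "agree k (gcomp C T) (gcomp (Cs k) T)"
      by (intro agree_gcomp n aCk agree_refl)
    moreover have "agree k (gcomp (Cs k) T) (gcomp (normal_map (Hs k)) (Cs k))"
      by (rule agree_mono [OF ag]) simp
    ultimately have "agree k (gcomp C T) (gcomp (normal_map H) C)"
      using agree_trans agree_sym by blast
    then show "agree d (gcomp C T) (gcomp (normal_map H) C)" by (rule agree_mono) (simp add: k_def)
  qed
  ultimately show ?thesis using that C H by blast
qed

section \<open>Uniqueness: conjugacies between two normal forms\<close>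

lemma rotation_power: "((\<lambda>P. gsubst2 P R) ^^ n) P = P"
proof (rule zw_inj, rule fps2_eqI)
  fix k l
  have "coeff2 (zw (((\<lambda>P. gsubst2 P R) ^^ i) P)) k l = (cis \<alpha> ^ k * cis (- \<alpha>) ^ l) ^ i * coeff2 (zw P) k l" for i
    by (induction i) (simp_all add: coeff2_zw_rotation)
  moreover have "cis (- \<alpha>) ^ n = 1" using cis_mult_uminus [of n] cis_n by simp
  then have "(cis \<alpha> ^ k * cis (- \<alpha>) ^ l) ^ n = 1"
    by (simp add: power_mult_distrib power_mult [symmetric] mult.commute [of _ n]) (simp add: power_mult cis_n)
  ultimately show "coeff2 (zw (((\<lambda>P. gsubst2 P R) ^^ n) P)) k l = coeff2 (zw P) k l" by simp
qed

text \<open>Invariance of the Hamiltonians lets rotation and flow commute, so the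
  \<open>n\<close>-th iterates are powers of the exponentials alone. Comparing them identifies the
  Hamiltonians by \<open>lexp_ad_power_inj\<close>; cancelling the common flow from the conjugacy
  equation then leaves commutation with \<open>R\<close>.\<close>

lemma conjugacy_imp_equal_hamiltonian:
  assumes C: "canon C" and H: "vanish 3 H" "gsubst2 H R = H" and H': "vanish 3 H'" "gsubst2 H' R = H'"
    and eq: "gcomp C (normal_map H) = gcomp (normal_map H') C"
  shows "gsubst2 H' C = H" "gsubst2 (gsubst2 P R) C = gsubst2 (gsubst2 P C) R"
proof -
  let ?S = "\<lambda>P. gsubst2 P C" and ?R = "\<lambda>P. gsubst2 P R"
  let ?E = "lexp (ad H)" and ?E' = "lexp (ad H')"
  define K where "K = ?S H'"
  have K: "vanish 3 K" unfolding K_def by (rule vanish_gsubst2 [OF canon_nc [OF C] H'(1)])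
  have conj: "?E (?R (?S P)) = ?S (?E' (?R P))" for P
  proof -
    have "gsubst2 P (gcomp C (normal_map H)) = gsubst2 P (gcomp (normal_map H') C)" by (simp only: eq)
    then show ?thesis
      by (simp add: gsubst2_gcomp canon_nc C canon_normal_map H H' gsubst2_normal_map)
  qed
  have com: "?R (?E P) = ?E (?R P)" "?R (?E' P) = ?E' (?R P)" for P
    using rotation_lexp [OF H(1)] rotation_lexp [OF H'(1)] H H' by simp_all
  have SE: "?S (?E' P) = lexp (ad K) (?S P)" for P
    unfolding K_def by (rule gsubst2_lexp_ad [OF C H'(1)])
  have pw: "((\<lambda>P. E (?R P)) ^^ i) P = (E ^^ i) ((?R ^^ i) P)" if "\<And>P. ?R (E P) = E (?R P)" for E i P
  proof -
    have c: "?R ((E ^^ i) P) = (E ^^ i) (?R P)" for i P by (induction i) (simp_all add: that)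
    show ?thesis by (induction i) (simp_all add: c)
  qed
  have "((\<lambda>P. ?E (?R P)) ^^ i) (?S P) = ?S (((\<lambda>P. ?E' (?R P)) ^^ i) P)" for i P
    by (induction i) (simp_all add: conj)
  from this [of n] have "(?E ^^ n) (?S P) = ?S ((?E' ^^ n) P)" for P
    by (simp only: pw [of ?E, OF com(1)] pw [of ?E', OF com(2)] rotation_power)
  moreover have "?S ((?E' ^^ i) P) = (lexp (ad K) ^^ i) (?S P)" for i P
    by (induction i) (simp_all add: SE)
  ultimately have ES: "(?E ^^ n) (?S P) = (lexp (ad K) ^^ n) (?S P)" for P by metis
  obtain D where D: "\<And>P. ?S (gsubst2 P D) = P" using canon_inverse [OF C] by metis
  have "(?E ^^ n) P = (lexp (ad K) ^^ n) P" for P using ES [of "gsubst2 P D"] by (simp only: D)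
  moreover have "n > 0" using n34 by auto
  ultimately have HK: "H = K" using lexp_ad_power_inj [OF H(1) K] by blast
  then show "gsubst2 H' C = H" by (simp add: K_def)
  have "?E (?R (?S P)) = ?E (?S (?R P))"
    using conj [of P] SE [of "?R P"] by (simp only: HK)
  then show "gsubst2 (gsubst2 P R) C = gsubst2 (gsubst2 P C) R"
    by (metis lexp_ad_inverse [OF H(1)])
qed

text \<open>A real matrix commuting with a rotation whose sine is nonzero is a multiple of a
  rotation, and the Jacobian normalises the multiple.\<close>

lemma linear_part_rotation:
  assumes C: "canon C" and com: "\<And>P. gsubst2 (gsubst2 P R) C = gsubst2 (gsubst2 P C) R"
  obtains b where "agree 2 C (frotation b)"
proof -
  note nC = canon_nc [OF C]
  have v: "vanish 1 (fst C)" "vanish 1 (snd C)" using nC by (simp_all add: nc_def)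
  define p q r s where "p = coeff2 (fst C) 1 0" and "q = coeff2 (fst C) 0 1"
    and "r = coeff2 (snd C) 1 0" and "s = coeff2 (snd C) 0 1"
  have e1: "gsubst2 (fst C) R = const2 (cos \<alpha>) * fst C - const2 (sin \<alpha>) * snd C"
    using com [of X2]
    by (simp add: gsubst2_basic [OF nC] gsubst2_basic [OF nc_frotation])
       (simp add: frotation_def gsubst2_diff [OF nC] gsubst2_const_mult [OF nC] gsubst2_basic [OF nC])
  have "p * cos \<alpha> + q * sin \<alpha> = cos \<alpha> * p - sin \<alpha> * r"
    using arg_cong [OF e1, of "\<lambda>P. coeff2 P 1 0"] coeff2_gsubst2_linear(1) [OF v(1), of \<alpha>]
    by (simp add: p_def q_def r_def)
  then have "(q + r) * sin \<alpha> = 0" by (simp add: algebra_simps)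
  then have qr: "q = - r" using sin_nonzero by simp
  have "coeff2 (gsubst2 (fst C) R) 0 1 = cos \<alpha> * q - sin \<alpha> * s"
    unfolding e1 by (simp add: q_def s_def)
  then have "(p - s) * sin \<alpha> = 0"
    unfolding coeff2_gsubst2_linear(2) [OF v(1), of \<alpha>] p_def [symmetric] q_def [symmetric]
    by (simp add: left_diff_distrib mult.commute)
  then have ps: "p = s" using sin_nonzero by simp
  have "coeff2 (br (fst C) (snd C)) 0 0 = 1" using C by (simp add: canon_def coeff2_1)
  then have "p * s - q * r = 1"
    by (simp add: br_def coeff2_mult coeff2_gdX coeff2_gdY p_def q_def r_def s_def)
  then have "p\<^sup>2 + r\<^sup>2 = 1" using qr ps by (simp add: power2_eq_square)
  then obtain b where b: "p = cos b" "r = sin b" using sincos_total_2pi by metis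
  have "vanish 2 (fst C - fst (frotation b)) \<and> vanish 2 (snd C - snd (frotation b))"
  proof (intro conjI vanishI)
    fix i j :: nat assume "i + j < 2"
    then consider "i = 0" "j = 0" | "i = 1" "j = 0" | "i = 0" "j = 1" by linarith
    note ij = this
    from ij show "coeff2 (fst C - fst (frotation b)) i j = 0"
    proof cases
      case 1
      then show ?thesis using vanishD [OF v(1), of 0 0] by (simp add: frotation_def coeff2_lin)
    next
      case 2
      then show ?thesis using b by (simp add: frotation_def coeff2_lin p_def)
    next
      case 3
      then show ?thesis using b qr by (simp add: frotation_def coeff2_lin q_def)
    qed
    from ij show "coeff2 (snd C - snd (frotation b)) i j = 0"
    proof cases
      case 1
      then show ?thesis using vanishD [OF v(2), of 0 0] by (simp add: frotation_def coeff2_lin)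
    next
      case 2
      then show ?thesis using b by (simp add: frotation_def coeff2_lin r_def)
    next
      case 3
      then show ?thesis using b ps by (simp add: frotation_def coeff2_lin s_def)
    qed
  qed
  with that show ?thesis by (simp add: agree_def)
qed

lemma coeff2_zw_lead:
  assumes "lead n a \<beta> H"
  shows "coeff2 (zw H) n 0 = complex_of_real \<beta>"
proof -
  have "coeff2 (zw H - hlead n a \<beta>) n 0 = 0"
    using assms unfolding lead_def by (intro vanishD [of "n + 1"]) auto
  then show ?thesis using n34 by (auto simp: hlead_def coeff2_mono2)
qed

text \<open>In degree \<open>n J\<close> a pure power of \<open>z\<close> can only arise from
  \<open>z^n\<close> in each factor. The value fixes which multiple of the power is subtracted in
  the uniqueness proof.\<close>

lemma coeff2_zw_lead_power:
  assumes H: "lead n a \<beta> H"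
  shows "coeff2 (zw (H ^ J)) (n * J) 0 = complex_of_real (\<beta> ^ J)"
proof -
  have low: "coeff2 (zw H) i 0 = 0" if "i < n" for i
  proof -
    have "vanish n H" using lead_vanish [OF H] n34 by auto
    then have "vanish n (zw H)" by (simp add: vanish_zw_iff)
    then show ?thesis using that by (simp add: vanishD)
  qed
  show ?thesis
  proof (induction J)
    case 0
    then show ?case by (simp add: zw_one coeff2_1)
  next
    case (Suc J)
    have lJ: "coeff2 (zw (H ^ J)) i 0 = 0" if "i < n * J" for i
    proof -
      have "vanish n H" using lead_vanish [OF H] n34 by auto
      then have "vanish (J * n) (zw (H ^ J))" by (simp add: vanish_zw_iff vanish_power)
      then show ?thesis using that by (intro vanishD [of "J * n"]) (simp_all add: mult.commute)
    qed
    have "coeff2 (zw (H ^ Suc J)) (n * Suc J) 0 =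
        (\<Sum>i\<le>n * Suc J. coeff2 (zw H) i 0 * coeff2 (zw (H ^ J)) (n * Suc J - i) 0)"
      by (simp add: zw_basic coeff2_mult)
    also have "\<dots> = (\<Sum>i\<in>{n}. coeff2 (zw H) i 0 * coeff2 (zw (H ^ J)) (n * Suc J - i) 0)"
    proof (rule sum.mono_neutral_right)
      show "\<forall>i\<in>{..n * Suc J} - {n}. coeff2 (zw H) i 0 * coeff2 (zw (H ^ J)) (n * Suc J - i) 0 = 0"
      proof
        fix i assume i: "i \<in> {..n * Suc J} - {n}"
        show "coeff2 (zw H) i 0 * coeff2 (zw (H ^ J)) (n * Suc J - i) 0 = 0"
        proof (cases "i < n")
          case False
          then have "n * Suc J - i < n * J \<or> n * J = 0" using i by auto
          then have "coeff2 (zw (H ^ J)) (n * Suc J - i) 0 = 0"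
          proof
            assume "n * J = 0"
            then show ?thesis using i False n34 by auto
          qed (rule lJ)
          then show ?thesis by simp
        qed (simp add: low)
      qed
    qed auto
    also have "\<dots> = complex_of_real (\<beta> ^ Suc J)"
      by (simp add: coeff2_zw_lead [OF H] Suc.IH)
    finally show ?case .
  qed
qed

lemma uniqueness:
  assumes C: "canon C" and H: "lead n a \<beta> H" "nfp n H" "\<beta> > 0" and H': "lead n a' \<beta>' H'" "nfp n H'" "\<beta>' > 0"
    and eq: "gcomp C (normal_map H) = gcomp (normal_map H') C"
  shows "H = H'"
proof -
  note H3 = lead_vanish3 [OF H(1)] and H3' = lead_vanish3 [OF H'(1)]
  note inv = nfp_invariant [OF H(2)] and inv' = nfp_invariant [OF H'(2)]
  have n3: "n \<ge> 3" using n34 by auto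
  have Hn': "vanish n H'" using lead_vanish [OF H'(1)] n34 by auto
  note SC = conjugacy_imp_equal_hamiltonian [OF C H3 inv H3' inv' eq]
  obtain b where b: "agree 2 C (frotation b)" using linear_part_rotation [OF C SC(2)] .
  \<comment> \<open>The coefficients of \<open>z^n\<close> are compared. Because
    \<open>\<beta>\<close> and \<open>\<beta>'\<close> are both positive, they are equal and
    \<open>cis b\<close> is an \<open>n\<close>-th root of unity; the rotation by \<open>b\<close>
    is then a symmetry of \<open>H\<close> and can be divided out of \<open>C\<close>.\<close>
  have "vanish (1 + n) (gsubst2 H' C - gsubst2 H' (frotation b))"
    by (rule gsubst2_agree [OF canon_nc [OF C] nc_frotation _ Hn']) (use b in \<open>simp add: numeral_2_eq_2\<close>)
  then have "vanish (1 + n) (zw (H - gsubst2 H' (frotation b)))" by (simp only: SC(1) vanish_zw_iff)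
  then have "coeff2 (zw (H - gsubst2 H' (frotation b))) n 0 = 0" by (rule vanishD) simp
  then have bb: "complex_of_real \<beta> = cis b ^ n * complex_of_real \<beta>'"
    by (simp add: zw_basic coeff2_zw_rotation coeff2_zw_lead [OF H(1)] coeff2_zw_lead [OF H'(1)])
  have "\<beta> = \<beta>'"
    using arg_cong [OF bb, of norm] H(3) H'(3) by (simp add: norm_mult norm_power)
  then have cb: "cis b ^ n = 1" using bb H(3) by simp
  then have cb': "cis (- b) ^ n = 1"
    by (metis cis_cnj complex_cnj_one complex_cnj_power)
  have cc: "cis b ^ k * cis (- b) ^ k = 1" for k
    by (simp add: power_mult_distrib [symmetric] cis_mult)
  have Hb: "gsubst2 H (frotation (- b)) = H"
  proof (rule zw_inj, rule fps2_eqI)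
    fix k l
    have "cis (- b) ^ k * cis b ^ l = 1" if "coeff2 (zw H) k l \<noteq> 0"
    proof -
      have "k = l \<or> k = l + n \<or> l = k + n" using H(2) that unfolding nfp_def by blast
      then show ?thesis using cc [of k] cc [of l] by (auto simp: power_add cb cb' mult.commute)
    qed
    then show "coeff2 (zw (gsubst2 H (frotation (- b)))) k l = coeff2 (zw H) k l"
      by (cases "coeff2 (zw H) k l = 0") (simp_all add: coeff2_zw_rotation)
  qed
  \<comment> \<open>The conjugacy equation is replaced by two of its consequences, commutation with
    \<open>R\<close> and \<open>gsubst2 H' C = H\<close>; these are what the corrections
    preserve.\<close>
  define P where "P d C \<longleftrightarrow> canon C \<and> (\<forall>P. gsubst2 (gsubst2 P R) C = gsubst2 (gsubst2 P C) R) \<and>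
      gsubst2 H' C = H \<and> agree d C (X2, Y2)" for d C
  have "\<exists>C. P (k + 2) C" for k
  proof (induction k)
    case 0
    define C1 where "C1 = gcomp C (frotation (- b))"
    have "canon C1" unfolding C1_def by (rule canon_gcomp [OF C canon_frotation])
    moreover have S1: "gsubst2 P C1 = gsubst2 (gsubst2 P C) (frotation (- b))" for P
      by (simp add: C1_def gsubst2_gcomp canon_nc C nc_frotation)
    have "gsubst2 (gsubst2 P (frotation (- b))) R = gsubst2 (gsubst2 P R) (frotation (- b))" for P
      by (simp add: gsubst2_gcomp [symmetric] nc_frotation frotation_add add.commute)
    then have "gsubst2 (gsubst2 P R) C1 = gsubst2 (gsubst2 P C1) R" for P
      by (simp add: S1 SC(2))
    moreover have "gsubst2 H' C1 = H" by (simp add: S1 SC(1) Hb)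
    moreover have "agree 2 C1 (gcomp (frotation b) (frotation (- b)))"
      unfolding C1_def by (intro agree_gcomp b agree_refl canon_nc [OF C] nc_frotation)
    then have "agree 2 C1 (X2, Y2)" by (simp add: frotation_add frotation_0)
    ultimately show ?case by (intro exI [of _ C1]) (simp add: P_def numeral_2_eq_2)
  next
    case (Suc k)
    define d m where "d = k + 2" and "m = k + 3"
    have dm: "d \<ge> 2" "m \<ge> 3" "d + 1 = m" "m - 2 = d - 1" by (simp_all add: d_def m_def)
    from Suc obtain C where C: "canon C" "\<And>P. gsubst2 (gsubst2 P R) C = gsubst2 (gsubst2 P C) R"
      "gsubst2 H' C = H" "agree d C (X2, Y2)" by (auto simp: P_def d_def)
    note nC = canon_nc [OF C(1)]
    obtain g where g: "hom2 (d + 1) g" "opcong d (\<lambda>P. gsubst2 P C) (\<lambda>P. P + br P g)"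
      using symp_leading_op [OF canon_symp [OF C(1)] C(4) dm(1)] .
    have vg: "vanish m g" using hom2_vanish [OF g(1)] by (simp only: dm)
    note rR = raising_gsubst2 [OF nc_frotation, of \<alpha>]
    \<comment> \<open>Commutation of \<open>C\<close> with \<open>R\<close> passes to its leading
      Hamiltonian \<open>g\<close>, which is therefore resonant in degree \<open>m\<close>.\<close>
    have resg: "vanish (m + 1) (gsubst2 g R - g)"
    proof -
      let ?\<delta> = "gsubst2 g R - g"
      have "opcong d (\<lambda>P. gsubst2 (gsubst2 P C) R) (\<lambda>P. gsubst2 P R + br (gsubst2 P R) (gsubst2 g R))"
        using opcong_comp_left [OF g(2) rR] by (simp add: gsubst2_add gsubst2_br [OF canon_frotation])
      moreover have "opcong d (\<lambda>P. gsubst2 (gsubst2 P C) R) (\<lambda>P. gsubst2 P R + br (gsubst2 P R) g)"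
        using opcong_comp_right [OF g(2) rR] by (simp add: C(2))
      ultimately have op: "opcong d (\<lambda>P. gsubst2 P R + br (gsubst2 P R) (gsubst2 g R)) (\<lambda>P. gsubst2 P R + br (gsubst2 P R) g)"
        using opcong_sym opcong_trans by blast
      obtain Ri where Ri: "canon Ri" "\<And>P. gsubst2 (gsubst2 P Ri) R = P"
        using canon_inverse [OF canon_frotation, of \<alpha>] by metis
      have "vanish (j + d) (br P ?\<delta>)" if "vanish j P" for j P
        using opcongD [OF op vanish_gsubst2 [OF canon_nc [OF Ri(1)] that]]
        by (simp add: Ri(2) br_diff_right)
      from this [OF vanish_X2] this [OF vanish_Y2]
      have "vanish m (gdY ?\<delta>)" "vanish m (gdX ?\<delta>)"
        using vanish_uminus [of m "- gdX ?\<delta>"] by (simp_all add: br_X2 br_Y2 dm(3) [symmetric])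
      moreover have "vanish 1 ?\<delta>"
        by (rule vanish_mono [of m]) (use vg vanish_gsubst2 [OF nc_frotation vg] dm in \<open>auto intro: vanish_diff\<close>)
      ultimately show ?thesis using vanish_Suc_gradient [of m ?\<delta>] by simp
    qed
    \<comment> \<open>To leading order, \<open>gsubst2 H' C = H\<close> says that the bracket of
      \<open>g\<close> with \<open>H'\<close> is a difference of two normal forms.\<close>
    have eqH: "vanish (m + n - 1) (br g H' - (H' - H))"
    proof -
      have "vanish (n + d) (gsubst2 H' C - (H' + br H' g))" by (rule opcongD [OF g(2) Hn'])
      then have "vanish (n + d) (H - (H' + br H' g))" by (simp only: C(3))
      moreover have "n + d = m + n - 1" using dm by simp
      ultimately show ?thesis
        by (simp add: br_antisym [of H' g] algebra_simps)
    qed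
    \<comment> \<open>Up to higher order \<open>g\<close> is zero or a multiple of a power of
      \<open>H'\<close>. The flow of such a power preserves \<open>H'\<close>, so it can be removed
      from \<open>C\<close> without disturbing the relations in \<open>P\<close>.\<close>
    obtain L where L: "vanish m L" "gsubst2 L R = L" "br H' L = 0" "vanish (m + 1) (g - L)"
    proof (cases "\<exists>J. m = n * J")
      case False
      have "vanish (m + 1) g"
        by (rule homological_unique [OF H'(1,3) dm(2) vg resg H'(2) H(2) eqH]) (use False in blast)
      then show ?thesis by (intro that [of 0]) (simp_all add: gsubst2_zero [OF nc_frotation] br_def)
    next
      case True
      then obtain J where J: "m = n * J" by blast
      define c where "c = Re (coeff2 (zw g) m 0) / \<beta>' ^ J"
      define L where "L = const2 c * H' ^ J"
      have L1: "vanish m L"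
        unfolding L_def using vanish_power [OF Hn', of J] by (intro vanish_const2_mult) (simp add: J mult.commute)
      have L2: "gsubst2 L R = L"
        by (simp add: L_def gsubst2_const_mult [OF nc_frotation] gsubst2_power [OF nc_frotation] inv')
      have bL: "br L H' = 0" by (simp add: L_def br_const_left br_power_self)
      then have L3: "br H' L = 0" by (simp add: br_antisym [of H' L])
      have "vanish (m + 1) (g - L)"
      proof (rule homological_unique [OF H'(1,3) dm(2) _ _ H'(2) H(2)])
        show "vanish m (g - L)" by (rule vanish_diff [OF vg L1])
        show "vanish (m + 1) (gsubst2 (g - L) R - (g - L))"
          using resg by (simp add: gsubst2_diff [OF nc_frotation] L2)
        show "vanish (m + n - 1) (br (g - L) H' - (H' - H))" using eqH by (simp add: br_diff_left bL)
        have "coeff2 (zw L) m 0 = complex_of_real (c * \<beta>' ^ J)"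
          unfolding L_def zw_basic coeff2_const_mult J coeff2_zw_lead_power [OF H'(1)] by simp
        moreover have "c * \<beta>' ^ J = Re (coeff2 (zw g) m 0)" using H'(3) by (simp add: c_def)
        ultimately show "Re (coeff2 (zw (g - L)) m 0) = 0" by (simp add: zw_basic)
      qed
      with L1 L2 L3 show ?thesis by (rule that)
    qed
    have mL: "vanish m (- L)" "vanish 3 (- L)"
      using vanish_uminus [OF L(1)] vanish_mono [OF _ dm(2)] by blast+
    define C' where "C' = gcomp (flow (- L)) C"
    have C': "canon C'" unfolding C'_def by (rule canon_gcomp [OF canon_flow [OF mL(2)] C(1)])
    have SC': "gsubst2 P C' = gsubst2 (lexp (ad (- L)) P) C" for P
      by (simp add: C'_def gsubst2_gcomp nc_flow mL nC gsubst2_flow)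
    have "gsubst2 (- L) R = - L" by (simp add: gsubst2_uminus [OF nc_frotation] L(2))
    then have "gsubst2 (gsubst2 P R) C' = gsubst2 (gsubst2 P C') R" for P
      using rotation_lexp [OF mL(2), of P] by (simp add: SC' C(2) [symmetric])
    moreover have "gsubst2 H' C' = H"
      using lexp_ad_fixed [OF mL(2), of H'] by (simp add: SC' br_uminus_right L(3) C(3))
    moreover have "agree (d + 1) C' (X2, Y2)"
    proof -
      have rL: "raising (d - 1) (ad (- L))" using raising_ad_minus [OF mL(1)] dm by simp
      have rg: "raising (d - 1) (ad g)" using raising_ad_minus [OF vg] dm by simp
      have c1: "opcong d (lexp (ad (- L))) (\<lambda>P. P + br P (- L))"
        by (rule opcong_mono [OF opcong_lexp_2 [OF rL]]) (use dm in auto)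
      have c2: "opcong 1 (\<lambda>P. gsubst2 P C) (\<lambda>P. P)"
        using opcong_trans [OF opcong_mono [OF g(2), of 1] opcong_raising0 [OF raising_mono [OF rg, of 1]]] dm by simp
      have "opcong d (\<lambda>P. gsubst2 (lexp (ad (- L)) P) C) (\<lambda>P. gsubst2 (P + br P (- L)) C)"
        using opcong_comp_left [OF c1 raising_gsubst2 [OF nC]] by simp
      also have "(\<lambda>P. gsubst2 (P + br P (- L)) C) = (\<lambda>P. gsubst2 P C + gsubst2 (br P (- L)) C)"
        by (simp add: gsubst2_add)
      also have "opcong d (\<lambda>P. gsubst2 P C + gsubst2 (br P (- L)) C) (\<lambda>P. (P + br P g) + br P (- L))"
        by (rule opcong_add [OF g(2)]) (use opcong_absorb [OF c2 rL] dm in simp)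
      also have "(\<lambda>P. (P + br P g) + br P (- L)) = (\<lambda>P. P + br P (g - L))"
        by (simp add: br_diff_right br_uminus_right algebra_simps)
      also have "opcong d (\<lambda>P. P + br P (g - L)) (\<lambda>P. P)"
        by (rule opcong_raising0, rule raising_ad) (use L(4) dm in simp)
      finally have "opcong d (\<lambda>P. gsubst2 P C') (\<lambda>P. gsubst2 P (X2, Y2))" by (simp add: SC')
      then show ?thesis by (rule opcong_agree [OF canon_nc [OF C'] nc_id])
    qed
    ultimately have "P (Suc k + 2) C'" using C' by (simp add: P_def d_def)
    then show ?case by blast
  qed
  note ex = this
  have "vanish k (H - H')" for k
  proof -
    obtain C where C: "canon C" "gsubst2 H' C = H" "agree (k + 2) C (X2, Y2)"
      using ex [of k] by (auto simp: P_def)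
    have "vanish (k + 1 + n) (gsubst2 H' C - gsubst2 H' (X2, Y2))"
      by (rule gsubst2_agree [OF canon_nc [OF C(1)] nc_id _ Hn']) (use C(3) in simp)
    then have "vanish (k + 1 + n) (H - H')" by (simp add: C(2))
    then show ?thesis by (rule vanish_mono) simp
  qed
  then show ?thesis using vanish_all by fastforce
qed

end

subsection \<open>The leading order\<close>

text \<open>In complex coordinates \<open>gdY\<close> is the Wirtinger derivative with respect to
  the conjugate variable.\<close>

lemma gdY_zw: "gdY (zw P) = const2 (1/2) * zw (gdX P) + const2 (\<i>/2) * zw (gdY P)"
proof -
  have "gdY (fst xy_of_zw) = const2 (1/2)" "gdY (snd xy_of_zw) = const2 (\<i>/2)"
    unfolding xy_of_zw_def fst_conv snd_conv gdY_const_mult gdY_add gdY_diff gd_basic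
    by (rule fps2_eqI; simp add: coeff2_lin coeff2_1)+
  then show ?thesis
    unfolding zw_def gdY_gsubst2 [OF nc_xy_of_zw] by (simp add: cx_basic mult.commute)
qed

definition zmap :: "fmap \<Rightarrow> complex fps fps" where
  "zmap F = zw (fst F) + const2 \<i> * zw (snd F)"

lemma zmap_id: "zmap (X2, Y2) = X2"
proof (rule fps2_eqI)
  fix i j
  show "coeff2 (zmap (X2, Y2)) i j = coeff2 X2 i j"
    unfolding zmap_def fst_conv snd_conv zw_basic by (simp only: coeff2_linear) simp
qed

lemma zmap_rotation:
  assumes "nc F"
  shows "zmap (gcomp (frotation \<alpha>) F) = const2 (cis \<alpha>) * zmap F"
proof -
  have "zmap (gcomp (frotation \<alpha>) F) = (const2 (complex_of_real (cos \<alpha>)) * zw (fst F) - const2 (complex_of_real (sin \<alpha>)) * zw (snd F)) +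
      const2 \<i> * (const2 (complex_of_real (sin \<alpha>)) * zw (fst F) + const2 (complex_of_real (cos \<alpha>)) * zw (snd F))"
    unfolding zmap_def gcomp_def frotation_def fst_conv snd_conv
    by (simp add: gsubst2_add gsubst2_diff [OF assms] gsubst2_const_mult [OF assms] gsubst2_basic [OF assms] zw_basic)
  also have "\<dots> = const2 (cis \<alpha>) * (zw (fst F) + const2 \<i> * zw (snd F))"
    by (rule fps2_eqI) (simp only: coeff2_add coeff2_diff coeff2_const_mult, simp add: complex_eq_iff algebra_simps)
  finally show ?thesis by (simp add: zmap_def)
qed

text \<open>One complex series controls both real components: hermitian symmetry of
  \<open>zw u\<close> and \<open>zw v\<close> supplies the conjugate equation.\<close>

lemma agree_zmap:
  assumes "vanish d (zmap F - zmap G)"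
  shows "agree d F G"
proof -
  define u v where "u = fst F - fst G" and "v = snd F - snd G"
  have z: "zmap F - zmap G = zw u + const2 \<i> * zw v"
    by (simp add: zmap_def u_def v_def zw_basic algebra_simps)
  have "coeff2 (zw u) i j = 0 \<and> coeff2 (zw v) i j = 0" if ij: "i + j < d" for i j
  proof -
    have 1: "coeff2 (zw u) i j + \<i> * coeff2 (zw v) i j = 0"
      using vanishD [OF assms ij] unfolding z by simp
    have "coeff2 (zw u) j i + \<i> * coeff2 (zw v) j i = 0"
      using vanishD [OF assms, of j i] ij unfolding z by (simp add: add.commute)
    then have 2: "cnj (coeff2 (zw u) i j) + \<i> * cnj (coeff2 (zw v) i j) = 0"
      using zw_hermitian [of u j i] zw_hermitian [of v j i] by simp
    show ?thesis using 1 2 by (auto simp: complex_eq_iff)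
  qed
  then have "vanish d (zw u)" "vanish d (zw v)" by (simp_all add: vanish_def)
  then show ?thesis by (simp add: agree_def vanish_zw_iff u_def v_def)
qed

context resonance
begin

lemma nfp_lead_zwinv_hlead:
  assumes "a = 0 \<or> n = 4"
  shows "lead n a \<beta> (zwinv (hlead n a \<beta>))" "nfp n (zwinv (hlead n a \<beta>))"
proof -
  have z: "zw (zwinv (hlead n a \<beta>)) = hlead n a \<beta>"
    by (rule zw_zwinv) (auto simp: hlead_def coeff2_mono2)
  show "lead n a \<beta> (zwinv (hlead n a \<beta>))" using assms by (simp add: lead_def z)
  show "nfp n (zwinv (hlead n a \<beta>))"
    unfolding nfp_def z using assms n34
    by (auto simp: hlead_def coeff2_mono2 okA_def okB_def split: if_splits)
qed

text \<open>Undoing the rotation leaves a map that is the identity up to order \<open>n - 1\<close>.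
  Its leading Hamiltonian is read off from
  \<open>z \<mapsto> z - 2 \<i> \<partial>g/\<partial>w\<close>: the terms of \<open>T\<close> of
  degree below \<open>n\<close> leave only \<open>z^n\<close>, \<open>w^n\<close> and, for
  \<open>n = 4\<close>, \<open>(z w)^2\<close>. A further rotation commutes with \<open>R\<close>
  and makes the coefficient of \<open>z^n\<close> positive.\<close>

lemma leading_normal_form:
  assumes T: "symp T" and b0: "b0 \<noteq> 0"
    and f: "vanish n (zmap T - (mono2 (cis \<alpha>) 1 0 + mono2 (if n = 4 then a1 else 0) 2 1 + mono2 b0 0 (n - 1)))"
  obtains C0 H0 a \<beta> where "canon C0" "lead n a \<beta> H0" "nfp n H0" "\<beta> > 0"
    "agree n (gcomp C0 T) (gcomp (normal_map H0) C0)"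
proof -
  have n3: "n \<ge> 3" using n34 by auto
  note nT = symp_nc [OF T]
  define D where "D = gcomp (frotation (- \<alpha>)) T"
  have D: "symp D" unfolding D_def by (intro symp_gcomp canon_symp canon_frotation T)
  have RD: "gcomp R D = T"
    unfolding D_def by (rule gcomp_cancel_left) (auto simp: nc_frotation nT frotation_add frotation_0)
  define \<mu> where "\<mu> = cis (- \<alpha>)"
  define a2 where "a2 = (if n = 4 then a1 else 0)"
  have \<mu>: "\<mu> * cis \<alpha> = 1" by (simp add: \<mu>_def cis_mult)
  have zD: "zmap D = const2 \<mu> * zmap T" unfolding D_def \<mu>_def by (rule zmap_rotation [OF nT])
  have fc: "coeff2 (zmap T) k l = (if k = 1 \<and> l = 0 then cis \<alpha> else 0) + (if k = 2 \<and> l = 1 then a2 else 0) +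
      (if k = 0 \<and> l = n - 1 then b0 else 0)" if "k + l < n" for k l
    using vanishD [OF f that] by (simp add: coeff2_mono2 a2_def)
  have Dc: "coeff2 (zmap D) k l = (if k = 1 \<and> l = 0 then 1 else 0) + \<mu> * ((if k = 2 \<and> l = 1 then a2 else 0) +
      (if k = 0 \<and> l = n - 1 then b0 else 0))" if "k + l < n" for k l
    unfolding zD coeff2_const_mult fc [OF that] using \<mu> by (simp add: distrib_left)
  have "agree (n - 1) D (X2, Y2)"
  proof (rule agree_zmap, rule vanishI)
    fix k l assume kl: "k + l < n - 1"
    have "a2 = 0 \<or> n = 4" by (simp add: a2_def)
    then show "coeff2 (zmap D - zmap (X2, Y2)) k l = 0"
      using Dc [of k l] kl by (auto simp: zmap_id coeff2_X2)
  qed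
  note agD1 = this
  have n1: "n - 1 + 1 = n" "n - 1 \<ge> 2" using n3 by auto
  obtain g where g: "hom2 n g" "vanish n (fst D - X2 - gdY g)" "vanish n (snd D - Y2 + gdX g)"
    using symp_leading_hamiltonian [OF D agD1 n1(2), unfolded n1(1)] .
  have vg: "vanish n g" by (rule hom2_vanish [OF g(1)])
  have g3: "vanish 3 g" by (rule vanish_mono [OF vg n3])
  define \<gamma> where "\<gamma> k l = coeff2 (zw g) k l" for k l
  have \<gamma>h: "\<gamma> l k = cnj (\<gamma> k l)" for k l unfolding \<gamma>_def by (rule zw_hermitian)
  have "vanish n (zw (fst D - X2 - gdY g) + const2 \<i> * zw (snd D - Y2 + gdX g))"
    using g by (intro vanish_add vanish_const2_mult) (simp_all add: vanish_zw_iff)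
  moreover have "zw (fst D - X2 - gdY g) + const2 \<i> * zw (snd D - Y2 + gdX g) =
      zmap D - X2 + const2 (2 * \<i>) * gdY (zw g)"
  proof (rule fps2_eqI)
    fix i j
    have "coeff2 (zw X2) i j + \<i> * coeff2 (zw Y2) i j = coeff2 X2 i j"
      using arg_cong [OF zmap_id, of "\<lambda>P. coeff2 P i j"] unfolding zmap_def by simp
    then show "coeff2 (zw (fst D - X2 - gdY g) + const2 \<i> * zw (snd D - Y2 + gdX g)) i j =
        coeff2 (zmap D - X2 + const2 (2 * \<i>) * gdY (zw g)) i j"
      unfolding zmap_def gdY_zw zw_basic(1,2) coeff2_add coeff2_diff coeff2_const_mult
      by (simp add: algebra_simps)
  qed
  ultimately have vD: "vanish n (zmap D - X2 + const2 (2 * \<i>) * gdY (zw g))" by simp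
  have gam: "2 * \<i> * (of_nat (l + 1) * \<gamma> k (l + 1)) = - \<mu> * ((if k = 2 \<and> l = 1 then a2 else 0) +
      (if k = 0 \<and> l = n - 1 then b0 else 0))" if "k + l = n - 1" for k l
  proof -
    have kl: "k + l < n" using that n3 by simp
    have "coeff2 (zmap D) k l - coeff2 X2 k l + 2 * \<i> * (of_nat (l + 1) * \<gamma> k (l + 1)) = 0"
      using vanishD [OF vD kl] by (simp only: coeff2_add coeff2_diff coeff2_const_mult coeff2_gdY \<gamma>_def)
    moreover have "coeff2 (zmap D) k l - coeff2 X2 k l = \<mu> * ((if k = 2 \<and> l = 1 then a2 else 0) +
      (if k = 0 \<and> l = n - 1 then b0 else 0))"
      unfolding Dc [OF kl] coeff2_X2 by simp
    ultimately show ?thesis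
      by (simp only: mult_minus_left eq_neg_iff_add_eq_0) (simp only: add.commute)
  qed
  have g0: "\<gamma> k l = 0" if kl: "k + l = n" "\<not> (k = 2 \<and> l = 2 \<and> n = 4)" "k \<noteq> 0" "l \<noteq> 0" for k l
  proof -
    obtain l' where l': "l = Suc l'" using kl(4) by (cases l) auto
    have a2: "a2 = 0 \<or> n = 4" by (simp add: a2_def)
    have "2 * \<i> * (of_nat (l' + 1) * \<gamma> k (l' + 1)) = 0"
      using gam [of k l'] kl l' a2 by auto
    then show ?thesis using l' by (simp del: of_nat_Suc)
  qed
  have "\<gamma> 0 n \<noteq> 0"
  proof
    assume "\<gamma> 0 n = 0"
    then have "- \<mu> * b0 = 0" using gam [of 0 "n - 1"] n3 by simp
    then show False using b0 by (simp add: \<mu>_def)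
  qed
  then have w0: "\<gamma> n 0 \<noteq> 0" using \<gamma>h [of n 0] by auto
  \<comment> \<open>The coefficient of \<open>z^n\<close> turns by \<open>n\<close> times the angle
    of rotation, hence the division of its argument by \<open>n\<close>.\<close>
  define w \<beta> \<theta> where "w = \<gamma> n 0" and "\<beta> = norm (\<gamma> n 0)" and "\<theta> = Arg (\<gamma> n 0) / real n"
  define a where "a = (if n = 4 then Re (\<gamma> 2 2) else 0)"
  have beta: "\<beta> > 0" using w0 by (simp add: \<beta>_def)
  have wth: "w * cis (- \<theta>) ^ n = complex_of_real \<beta>"
  proof -
    have "w = complex_of_real \<beta> * cis (Arg w)" by (simp add: w_def \<beta>_def cis_Arg rcis_def[symmetric] rcis_cmod_Arg)
    moreover have "cis (- \<theta>) ^ n = cis (- Arg w)"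
      using n3 by (simp add: Complex.DeMoivre \<theta>_def w_def)
    ultimately have "w * cis (- \<theta>) ^ n = complex_of_real \<beta> * (cis (Arg w) * cis (- Arg w))" by simp
    then show ?thesis by (simp add: cis_mult)
  qed
  define H0 where "H0 = zwinv (hlead n a \<beta>)"
  have aa: "a = 0 \<or> n = 4" by (simp add: a_def)
  note H0 = nfp_lead_zwinv_hlead [OF aa, of \<beta>, folded H0_def]
  have zH0: "zw H0 = hlead n a \<beta>"
    unfolding H0_def by (rule zw_zwinv) (auto simp: hlead_def coeff2_mono2)
  define K where "K = gsubst2 g (frotation (- \<theta>))"
  have K3: "vanish 3 K" unfolding K_def by (rule vanish_gsubst2 [OF nc_frotation g3])
  have zK: "coeff2 (zw K) k l = cis (- \<theta>) ^ k * cis \<theta> ^ l * \<gamma> k l" for k l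
    unfolding K_def coeff2_zw_rotation \<gamma>_def by simp
  have KH: "vanish (n + 1) (K - H0)"
  proof -
    have "coeff2 (zw K) k l = coeff2 (hlead n a \<beta>) k l" if kl: "k + l < n + 1" for k l
    proof -
      have vz: "vanish n (zw K)"
        unfolding vanish_zw_iff K_def by (rule vanish_gsubst2 [OF nc_frotation vg])
      have hl: "vanish n (hlead n a \<beta>)"
        unfolding hlead_def using n34 aa by (intro vanish_add vanish_mono2) auto
      consider "k + l < n" | "k = 0" "l = n" | "k = n" "l = 0" | "k = 2" "l = 2" "n = 4"
        | "k + l = n" "k \<noteq> 0" "l \<noteq> 0" "\<not> (k = 2 \<and> l = 2 \<and> n = 4)" using kl by linarith
      then show ?thesis
      proof cases
        case 1
        then show ?thesis using vanishD [OF vz] vanishD [OF hl] by simp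
      next
        case 3
        have "coeff2 (hlead n a \<beta>) n 0 = complex_of_real \<beta>" using n3 by (auto simp: hlead_def coeff2_mono2)
        then show ?thesis using wth 3 by (simp add: zK w_def mult.commute)
      next
        case 2
        have "coeff2 (hlead n a \<beta>) 0 n = complex_of_real \<beta>" using n3 by (auto simp: hlead_def coeff2_mono2)
        moreover have "coeff2 (zw K) n 0 = complex_of_real \<beta>" using wth by (simp add: zK w_def mult.commute)
        ultimately show ?thesis using zw_hermitian [of K 0 n] 2 by simp
      next
        case 4
        have "cis (- \<theta>) ^ 2 * cis \<theta> ^ 2 = 1" by (simp add: power_mult_distrib [symmetric] cis_mult)
        moreover have "\<gamma> 2 2 = complex_of_real (Re (\<gamma> 2 2))"
          using arg_cong [OF \<gamma>h [of 2 2], of Im] by (simp add: complex_eq_iff)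
        ultimately show ?thesis using 4 by (simp add: zK hlead_def coeff2_mono2 a_def)
      next
        case 5
        then have "\<gamma> k l = 0" by (intro g0) auto
        then show ?thesis using 5 aa by (auto simp: zK hlead_def coeff2_mono2)
      qed
    qed
    then have "vanish (n + 1) (zw (K - H0))" by (simp add: vanish_def zw_basic zH0)
    then show ?thesis by (simp only: vanish_zw_iff)
  qed
  define C0 where "C0 = frotation \<theta>"
  have C0: "canon C0" unfolding C0_def by (rule canon_frotation)
  note nC0 = canon_nc [OF C0]
  have gK: "gsubst2 K C0 = g"
    by (simp add: K_def C0_def gsubst2_gcomp [symmetric] nc_frotation frotation_add frotation_0)
  have agD: "agree n D (flow g)"
  proof -
    have rg: "raising (n - 2) (ad g)" by (rule raising_ad_minus [OF vg]) (use n3 in simp)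
    have lex: "opcong (n - 1) (lexp (ad g)) (\<lambda>P. P + br P g)"
      by (rule opcong_mono [OF opcong_lexp_2 [OF rg]]) (use n3 in auto)
    have "1 + (n - 1) = n" using n3 by simp
    then have "vanish n (lexp (ad g) X2 - (X2 + br X2 g))" "vanish n (lexp (ad g) Y2 - (Y2 + br Y2 g))"
      using opcongD [OF lex vanish_X2] opcongD [OF lex vanish_Y2] by simp_all
    from vanish_diff [OF g(2) this(1)] vanish_diff [OF g(3) this(2)] show ?thesis
      by (simp add: agree_def flow_def br_X2 br_Y2 algebra_simps)
  qed
  have ncf: "nc (flow g)" "nc (flow K)" by (simp_all add: nc_flow g3 K3)
  have 1: "agree n (gcomp C0 T) (gcomp C0 (gcomp R (flow g)))"
    unfolding RD [symmetric]
    by (intro agree_gcomp agree_refl agD nC0 nc_gcomp nc_frotation ncf symp_nc [OF D])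
  have 2: "gcomp C0 (gcomp R (flow g)) = gcomp (normal_map K) C0"
  proof (rule map_eqI)
    show "nc (gcomp C0 (gcomp R (flow g)))" by (intro nc_gcomp nC0 nc_frotation ncf)
    show "nc (gcomp (normal_map K) C0)" by (intro nc_gcomp nC0 canon_nc canon_normal_map K3)
    fix P
    have "gsubst2 (gsubst2 P R) C0 = gsubst2 (gsubst2 P C0) R"
      by (simp add: C0_def gsubst2_gcomp [symmetric] nc_frotation frotation_add add.commute)
    then show "gsubst2 P (gcomp C0 (gcomp R (flow g))) = gsubst2 P (gcomp (normal_map K) C0)"
      by (simp add: gsubst2_gcomp nC0 nc_gcomp nc_frotation ncf gsubst2_flow g3 canon_nc canon_normal_map K3
          gsubst2_normal_map gsubst2_lexp_ad [OF C0] gK)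
  qed
  have H03: "vanish 3 H0" by (rule lead_vanish3 [OF H0(1)])
  have 3: "agree n (gcomp (normal_map K) C0) (gcomp (normal_map H0) C0)"
    by (intro agree_gcomp agree_refl agree_normal_map canon_nc [OF canon_normal_map] K3 H03 KH nC0) (use n3 in auto)
  have "agree n (gcomp C0 T) (gcomp (normal_map H0) C0)"
    using 1 3 unfolding 2 by (rule agree_trans)
  with that C0 H0 beta show ?thesis by blast
qed

lemma formal_normal_form_theorem:
  assumes T: "symp T" and b0: "b0 \<noteq> 0"
    and f: "vanish n (zmap T - (mono2 (cis \<alpha>) 1 0 + mono2 (if n = 4 then a1 else 0) 2 1 + mono2 b0 0 (n - 1)))"
  shows "(\<exists>A B. is_normal_form n \<alpha> T A B \<and> fps_nth B 0 > 0) \<and>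
         (\<forall>A B A' B'. is_normal_form n \<alpha> T A B \<and> fps_nth B 0 > 0 \<and>
                      is_normal_form n \<alpha> T A' B' \<and> fps_nth B' 0 > 0 \<longrightarrow> A = A' \<and> B = B')"
proof -
  have n0: "n > 0" using n34 by auto
  \<comment> \<open>As \<open>res_factor\<close> is positive, the normalisation of
    \<open>b_0\<close> is positivity of the leading coefficient.\<close>
  have nf: "\<exists>a. lead n a (res_factor n * fps_nth B 0) (nf_hamiltonian n A B)" if nfc: "nf_coeffs n A B" for A B
  proof -
    define a where "a = (if n = 4 then fps_nth A 0 / 4 else 0)"
    have A0: "n = 3 \<Longrightarrow> fps_nth A 0 = 0" using nfc by (simp add: nf_coeffs_def)
    have "coeff2 (zw (nf_hamiltonian n A B)) k l = coeff2 (hlead n a (res_factor n * fps_nth B 0)) k l"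
      if kl: "k + l < n + 1" for k l
    proof -
      consider "k = l" | "k = l + n" | "l = k + n" | "k \<noteq> l" "k \<noteq> l + n" "l \<noteq> k + n" by linarith
      then show ?thesis
      proof cases
        case 1
        then have "k < 2 \<or> k = 2 \<and> n = 4" using kl n34 by auto
        then show ?thesis using 1 n0 n34 by (auto simp: coeff2_zw_nf hlead_def coeff2_mono2 a_def)
      next
        case 2
        then have "l = 0" using kl by simp
        then show ?thesis using 2 n0 n34 by (auto simp: coeff2_zw_nf hlead_def coeff2_mono2)
      next
        case 3
        then have "k = 0" using kl by simp
        then show ?thesis using 3 n0 n34 by (auto simp: coeff2_zw_nf hlead_def coeff2_mono2)
      next
        case 4
        then show ?thesis using n34 by (auto simp: coeff2_zw_nf hlead_def coeff2_mono2 a_def)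
      qed
    qed
    then have "lead n a (res_factor n * fps_nth B 0) (nf_hamiltonian n A B)"
      by (simp add: lead_def vanish_def a_def)
    then show ?thesis ..
  qed
  have nform: "is_normal_form n \<alpha> T A B \<longleftrightarrow> nf_coeffs n A B \<and>
      (\<exists>C. canon C \<and> gcomp C T = gcomp (normal_map (nf_hamiltonian n A B)) C)" for A B
  proof (cases "nf_coeffs n A B")
    case True
    then obtain a where "lead n a (res_factor n * fps_nth B 0) (nf_hamiltonian n A B)" using nf by blast
    from time_one_map_iff [OF lead_vanish3 [OF this]] True show ?thesis
      unfolding is_normal_form_def formally_conjugate_def formal_canonical_iff fcomp_eq_gcomp normal_map_def
      by simp
  qed (simp add: is_normal_form_def)
  show ?thesis
  proof (intro conjI allI impI)
    obtain C0 H0 a \<beta> where l: "canon C0" "lead n a \<beta> H0" "nfp n H0" "\<beta> > 0"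
      "agree n (gcomp C0 T) (gcomp (normal_map H0) C0)" using leading_normal_form [OF T b0 f] .
    obtain C H where C: "canon C" "lead n a \<beta> H" "nfp n H" "gcomp C T = gcomp (normal_map H) C"
      using existence_from_leading [OF T l] .
    obtain A B where AB: "nf_coeffs n A B" "H = nf_hamiltonian n A B"
      using nfp_imp_nf_hamiltonian [OF C(3) n0] .
    have "complex_of_real \<beta> = coeff2 (zw H) n 0" by (rule coeff2_zw_lead [OF C(2), symmetric])
    also have "\<dots> = complex_of_real (res_factor n * fps_nth B 0)"
      unfolding AB(2) coeff2_zw_nf using n0 by simp
    finally have "res_factor n * fps_nth B 0 = \<beta>" by (simp only: of_real_eq_iff)
    then have "fps_nth B 0 > 0" using l(4) res_factor_pos [of n] by (metis zero_less_mult_pos)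
    then show "\<exists>A B. is_normal_form n \<alpha> T A B \<and> fps_nth B 0 > 0"
      using nform C AB by blast
  next
    fix A B A' B'
    assume h: "is_normal_form n \<alpha> T A B \<and> fps_nth B 0 > 0 \<and> is_normal_form n \<alpha> T A' B' \<and> fps_nth B' 0 > 0"
    define H H' where "H = nf_hamiltonian n A B" and "H' = nf_hamiltonian n A' B'"
    obtain C1 where C1: "nf_coeffs n A B" "canon C1" "gcomp C1 T = gcomp (normal_map H) C1"
      using h nform H_def by blast
    obtain C2 where C2: "nf_coeffs n A' B'" "canon C2" "gcomp C2 T = gcomp (normal_map H') C2"
      using h nform H'_def by blast
    obtain a where a: "lead n a (res_factor n * fps_nth B 0) H" using nf [OF C1(1)] H_def by blast
    obtain a' where a': "lead n a' (res_factor n * fps_nth B' 0) H'" using nf [OF C2(1)] H'_def by blast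
    obtain Ci where Ci: "canon Ci" "gcomp C1 Ci = (X2, Y2)" "gcomp Ci C1 = (X2, Y2)"
      using canon_inverse [OF C1(2)] by metis
    note nc = symp_nc [OF T] canon_nc [OF C1(2)] canon_nc [OF C2(2)] canon_nc [OF Ci(1)]
      canon_nc [OF canon_normal_map [OF lead_vanish3 [OF a]]] canon_nc [OF canon_normal_map [OF lead_vanish3 [OF a']]]
    have "gcomp Ci (normal_map H) = gcomp Ci (gcomp (gcomp (normal_map H) C1) Ci)"
      by (simp add: gcomp_cancel [OF nc(5,2,4) Ci(2)])
    also have "\<dots> = gcomp Ci (gcomp (gcomp C1 T) Ci)" by (simp only: C1(3))
    also have "\<dots> = gcomp Ci (gcomp C1 (gcomp T Ci))" by (simp add: gcomp_assoc nc nc_gcomp)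
    also have "\<dots> = gcomp T Ci" by (rule gcomp_cancel_left [OF nc(4,2) nc_gcomp [OF nc(1,4)] Ci(3)])
    finally have e: "gcomp Ci (normal_map H) = gcomp T Ci" .
    have "gcomp (gcomp C2 Ci) (normal_map H) = gcomp C2 (gcomp T Ci)"
      by (simp add: gcomp_assoc nc e)
    also have "\<dots> = gcomp (gcomp C2 T) Ci" by (simp add: gcomp_assoc nc)
    also have "\<dots> = gcomp (normal_map H') (gcomp C2 Ci)" unfolding C2(3) by (simp add: gcomp_assoc nc)
    finally have "gcomp (gcomp C2 Ci) (normal_map H) = gcomp (normal_map H') (gcomp C2 Ci)" .
    moreover have "nfp n H" "nfp n H'"
      unfolding H_def H'_def by (intro nfp_nf_hamiltonian C1 C2 n0)+
    ultimately have "H = H'"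
      using uniqueness [OF canon_gcomp [OF C2(2) Ci(1)] a _ _ a'] h res_factor_pos [of n] by simp
    then show "A = A'" "B = B'"
      unfolding H_def H'_def using nf_hamiltonian_inj [OF _ n0] by blast+
  qed
qed

end

subsection \<open>Homogeneous parts and convergence\<close>

text \<open>The homogeneous part of degree \<open>d\<close> evaluated at \<open>(x, y)\<close>,
  obtained as the coefficient of \<open>t^d\<close> along the ray \<open>(t x, t y)\<close>. In this
  form products become Cauchy products by multiplicativity of substitution.\<close>

definition hp :: "'a::comm_ring_1 fps fps \<Rightarrow> nat \<Rightarrow> 'a \<Rightarrow> 'a \<Rightarrow> 'a" where
  "hp P d x y = coeff2 (gsubst2 P (const2 x * X2, const2 y * X2)) d 0"

lemma nc_ray: "nc (const2 x * X2, const2 y * X2)"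
  unfolding nc_def fst_conv snd_conv by (intro conjI vanish_const2_mult vanish_X2)

lemma hp_expand: "hp P d x y = (\<Sum>i\<le>d. coeff2 P i (d - i) * (x ^ i * y ^ (d - i)))"
proof -
  have m: "(const2 x * X2) ^ i * (const2 y * X2) ^ j = mono2 (x ^ i * y ^ j) (i + j) 0" for i j
    by (simp add: mono2_def power_mult_distrib power_add mult_ac)
  have "hp P d x y = (\<Sum>i\<le>d. \<Sum>j\<le>d. if j = d - i then coeff2 P i j * (x ^ i * y ^ j) else 0)"
    unfolding hp_def gsubst2_def coeff2_mk fst_conv snd_conv m coeff2_mono2
    by (intro sum.cong) auto
  also have "\<dots> = (\<Sum>i\<le>d. coeff2 P i (d - i) * (x ^ i * y ^ (d - i)))"
    by (intro sum.cong refl) (simp add: sum.delta)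
  finally show ?thesis .
qed

lemma hp_add: "hp (P + Q) d x y = hp P d x y + hp Q d x y"
  and hp_diff: "hp (P - Q) d x y = hp P d x y - hp Q d x y"
  and hp_const_mult: "hp (const2 c * P) d x y = c * hp P d x y"
  by (simp_all add: hp_def gsubst2_add gsubst2_diff [OF nc_ray] gsubst2_const_mult [OF nc_ray])

lemma hp_mult: "hp (P * Q) d x y = (\<Sum>k\<le>d. hp P k x y * hp Q (d - k) x y)"
  by (simp add: hp_def gsubst2_mult [OF nc_ray] coeff2_mult)

lemma hp_scale: "hp P d (t * x) (t * y) = t ^ d * hp P d x y"
proof -
  have "coeff2 P i (d - i) * ((t * x) ^ i * (t * y) ^ (d - i)) = t ^ d * (coeff2 P i (d - i) * (x ^ i * y ^ (d - i)))"
    if "i \<le> d" for i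
  proof -
    have "coeff2 P i (d - i) * ((t * x) ^ i * (t * y) ^ (d - i)) =
        (t ^ i * t ^ (d - i)) * (coeff2 P i (d - i) * (x ^ i * y ^ (d - i)))"
      by (simp add: power_mult_distrib mult_ac)
    then show ?thesis using that by (simp flip: power_add)
  qed
  then show ?thesis
    unfolding hp_expand sum_distrib_left by (intro sum.cong) simp_all
qed

lemma hp_swap: "hp (mk_fps2 (\<lambda>i j. coeff2 P j i)) d x y = hp P d y x"
  unfolding hp_expand coeff2_mk
  by (rule sum.reindex_bij_witness [of _ "\<lambda>i. d - i" "\<lambda>i. d - i"]) (auto simp: mult.commute)

lemma hp_cx: "hp (cx P) d (complex_of_real x) (complex_of_real y) = complex_of_real (hp P d x y)"
  by (simp add: hp_expand)

lemma hp_re2: "hp (re2 P) d x y = Re (hp P d (complex_of_real x) (complex_of_real y))"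
proof -
  have "Re (c * (complex_of_real u * complex_of_real v)) = Re c * (u * v)" for c u v
    by (simp flip: of_real_mult)
  then show ?thesis by (simp add: hp_expand flip: of_real_power)
qed

text \<open>A Cauchy estimate, with \<open>1 / K\<close> in the role of a radius of
  convergence.\<close>

definition geo :: "fps2 \<Rightarrow> real \<Rightarrow> real \<Rightarrow> bool" where
  "geo P M K \<longleftrightarrow> M \<ge> 0 \<and> K > 0 \<and> (\<forall>i j. \<bar>coeff2 P i j\<bar> \<le> M * K ^ (i + j))"

lemma Suc_le_two_power: "real (Suc k) \<le> 2 ^ k"
  using less_exp [of k] by (metis Suc_leI of_nat_le_iff of_nat_numeral of_nat_power)

text \<open>Differentiation costs a factor of at most \<open>i + j + 1 \<le> 2 ^ (i + j)\<close>
  beside one more power of \<open>K\<close>; the doubled ratio absorbs the former.\<close>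

lemma geo_gdX:
  assumes "geo P M K"
  shows "geo (gdX P) (M * K) (2 * K)" and "geo (gdY P) (M * K) (2 * K)"
proof -
  have MK: "M \<ge> 0" "K > 0" and c: "\<And>i j. \<bar>coeff2 P i j\<bar> \<le> M * K ^ (i + j)"
    using assms by (auto simp: geo_def)
  have b: "real (Suc k) * (M * K ^ (Suc (i + j))) \<le> M * K * (2 * K) ^ (i + j)" if "k \<le> i + j" for i j k
  proof -
    have "real (Suc k) \<le> 2 ^ (i + j)"
      using Suc_le_two_power [of k] that power_increasing [of k "i + j" "2::real"] by linarith
    then have "real (Suc k) * (M * K * K ^ (i + j)) \<le> 2 ^ (i + j) * (M * K * K ^ (i + j))"
      using MK by (intro mult_right_mono) auto
    then show ?thesis by (simp add: power_mult_distrib mult_ac)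
  qed
  have "\<bar>coeff2 (gdX P) i j\<bar> \<le> M * K * (2 * K) ^ (i + j)" for i j
  proof -
    have "\<bar>coeff2 (gdX P) i j\<bar> = real (Suc i) * \<bar>coeff2 P (i + 1) j\<bar>"
      by (simp add: coeff2_gdX abs_mult)
    also have "\<dots> \<le> real (Suc i) * (M * K ^ (Suc (i + j)))" using c [of "i + 1" j] by (intro mult_left_mono) auto
    also have "\<dots> \<le> M * K * (2 * K) ^ (i + j)" by (rule b) simp
    finally show ?thesis .
  qed
  moreover have "\<bar>coeff2 (gdY P) i j\<bar> \<le> M * K * (2 * K) ^ (i + j)" for i j
  proof -
    have "\<bar>coeff2 (gdY P) i j\<bar> = real (Suc j) * \<bar>coeff2 P i (j + 1)\<bar>"
      by (simp add: coeff2_gdY abs_mult)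
    also have "\<dots> \<le> real (Suc j) * (M * K ^ (Suc (i + j)))" using c [of i "j + 1"] by (intro mult_left_mono) auto
    also have "\<dots> \<le> M * K * (2 * K) ^ (i + j)" by (rule b) simp
    finally show ?thesis .
  qed
  ultimately show "geo (gdX P) (M * K) (2 * K)" "geo (gdY P) (M * K) (2 * K)"
    using MK by (simp_all add: geo_def)
qed

lemma geo_hp_bound:
  assumes g: "geo P M K" and xy: "\<bar>x\<bar> \<le> \<rho>" "\<bar>y\<bar> \<le> \<rho>"
  shows "\<bar>hp P d x y\<bar> \<le> M * (2 * K * \<rho>) ^ d"
proof -
  have MK: "M \<ge> 0" "K > 0" and c: "\<And>i j. \<bar>coeff2 P i j\<bar> \<le> M * K ^ (i + j)"
    using g by (auto simp: geo_def)
  have r: "\<rho> \<ge> 0" using xy by linarith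
  have "\<bar>hp P d x y\<bar> \<le> (\<Sum>i\<le>d. \<bar>coeff2 P i (d - i) * (x ^ i * y ^ (d - i))\<bar>)"
    unfolding hp_expand by (rule sum_abs)
  also have "\<dots> \<le> (\<Sum>i\<le>d. M * (K * \<rho>) ^ d)"
  proof (rule sum_mono)
    fix i assume "i \<in> {..d}"
    then have "i + (d - i) = d" by simp
    then have dd: "\<rho> ^ i * \<rho> ^ (d - i) = \<rho> ^ d" "\<bar>coeff2 P i (d - i)\<bar> \<le> M * K ^ d"
      using c [of i "d - i"] by (simp_all flip: power_add)
    have "\<bar>x ^ i * y ^ (d - i)\<bar> \<le> \<rho> ^ i * \<rho> ^ (d - i)"
      unfolding abs_mult power_abs using xy r by (intro mult_mono power_mono) auto
    then have "\<bar>coeff2 P i (d - i)\<bar> * \<bar>x ^ i * y ^ (d - i)\<bar> \<le> (M * K ^ d) * \<rho> ^ d"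
      unfolding dd using dd(2) MK by (intro mult_mono) auto
    then show "\<bar>coeff2 P i (d - i) * (x ^ i * y ^ (d - i))\<bar> \<le> M * (K * \<rho>) ^ d"
      by (simp add: abs_mult power_mult_distrib mult_ac)
  qed
  also have "\<dots> = real (Suc d) * (M * (K * \<rho>) ^ d)" by simp
  also have "\<dots> \<le> 2 ^ d * (M * (K * \<rho>) ^ d)"
    using MK r by (intro mult_right_mono Suc_le_two_power) auto
  finally show ?thesis by (simp add: power_mult_distrib mult_ac)
qed

lemma geo_hp_summable:
  assumes g: "geo P M K" and xy: "\<bar>x\<bar> \<le> \<rho>" "\<bar>y\<bar> \<le> \<rho>" and r: "2 * K * \<rho> < 1"
  shows "summable (\<lambda>d. norm (hp P d x y))"
proof (rule summable_comparison_test')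
  have "\<rho> \<ge> 0" "K > 0" using g xy by (auto simp: geo_def)
  then show "summable (\<lambda>d. M * (2 * K * \<rho>) ^ d)" using r by (intro summable_mult summable_geometric) simp
  show "norm (norm (hp P d x y)) \<le> M * (2 * K * \<rho>) ^ d" if "d \<ge> 0" for d
    using geo_hp_bound [OF g xy] by simp
qed

lemma norm_real2: "norm (v :: real^2) \<le> \<bar>v $ 1\<bar> + \<bar>v $ 2\<bar>"
  using norm_le_l1_cart [of v] by (simp add: sum_2)

text \<open>Unconditional summability permits regrouping by total degree. The geometric bound comes
  from boundedness of the terms at the single point \<open>(r / 4, r / 4)\<close>, which lies inside
  the domain.\<close>

lemma power_series_sums:
  assumes "has_power_series_at f P 0"
  obtains r M K where "r > 0" "geo P M K"
    "\<And>x y. \<bar>x\<bar> + \<bar>y\<bar> < r \<Longrightarrow> (\<lambda>d. hp P d x y) sums f (vector [x, y])"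
proof -
  obtain r where r: "r > 0" and hs: "\<And>v. norm v < r \<Longrightarrow>
     ((\<lambda>(i, j). coeff2 P i j * (v $ 1) ^ i * (v $ 2) ^ j) has_sum f (0 + v)) UNIV"
    using assms unfolding has_power_series_at_def by blast
  have hs2: "((\<lambda>(i, j). coeff2 P i j * x ^ i * y ^ j) has_sum f (vector [x, y])) UNIV"
    if "\<bar>x\<bar> + \<bar>y\<bar> < r" for x y
    using hs [of "vector [x, y]"] norm_real2 [of "vector [x, y]"] that by simp
  have sums: "(\<lambda>d. hp P d x y) sums f (vector [x, y])" if xy: "\<bar>x\<bar> + \<bar>y\<bar> < r" for x y
  proof (rule has_sum_imp_sums, rule has_sum_SigmaD)
    have bij: "bij_betw (\<lambda>(d, i). (i, d - i)) (SIGMA d:UNIV. {..d}) (UNIV :: (nat \<times> nat) set)"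
      by (rule bij_betw_byWitness [of _ "\<lambda>(i, j). (i + j, i)"]) auto
    show "((\<lambda>(d, i). coeff2 P i (d - i) * (x ^ i * y ^ (d - i))) has_sum f (vector [x, y])) (SIGMA d:UNIV. {..d})"
      using has_sum_reindex_bij_betw [OF bij, of "\<lambda>(i, j). coeff2 P i j * x ^ i * y ^ j" "f (vector [x, y])"]
        hs2 [OF xy] by (simp add: case_prod_unfold mult.assoc)
    show "((\<lambda>i. case (d, i) of (d, i) \<Rightarrow> coeff2 P i (d - i) * (x ^ i * y ^ (d - i))) has_sum hp P d x y) {..d}" for d
      unfolding hp_expand by (auto intro!: has_sum_finiteI)
  qed
  define \<rho> where "\<rho> = r / 4"
  have \<rho>: "\<rho> > 0" "\<bar>\<rho>\<bar> + \<bar>\<rho>\<bar> < r" using r by (simp_all add: \<rho>_def)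
  let ?f = "\<lambda>(i, j). coeff2 P i j * \<rho> ^ i * \<rho> ^ j"
  have "?f summable_on UNIV" using hs2 [OF \<rho>(2)] by (auto simp: summable_on_def)
  then have s: "(\<lambda>p. norm (?f p)) summable_on UNIV" using summable_on_iff_abs_summable_on_real by blast
  define M where "M = infsum (\<lambda>p. norm (?f p)) UNIV"
  have fM: "norm (?f p) \<le> M" for p
    using finite_sum_le_infsum [OF s, of "{p}"] by (simp add: M_def)
  then have b: "\<bar>coeff2 P i j\<bar> * \<rho> ^ (i + j) \<le> M" for i j
  proof -
    have "norm (?f (i, j)) \<le> M" by (rule fM)
    moreover have "norm (?f (i, j)) = \<bar>coeff2 P i j\<bar> * \<rho> ^ (i + j)"
      using \<rho>(1) by (simp add: abs_mult power_add mult.assoc)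
    ultimately show ?thesis by (simp only:)
  qed
  have "M \<ge> 0" using b [of 0 0] by simp
  moreover have "\<bar>coeff2 P i j\<bar> \<le> M * (1 / \<rho>) ^ (i + j)" for i j
    using b [of i j] \<rho>(1) by (simp add: power_one_over field_simps)
  ultimately have "geo P M (1 / \<rho>)" using \<rho>(1) by (simp add: geo_def)
  with r sums that show ?thesis by blast
qed

section \<open>Termwise differentiation of the homogeneous expansion\<close>

lemma hp_has_derivative:
  "((\<lambda>x. hp P (Suc d) x y) has_field_derivative hp (gdX P) d x y) (at x within S)" for P :: fps2
proof -
  have "((\<lambda>x. hp P (Suc d) x y) has_field_derivative
      (\<Sum>i\<le>Suc d. coeff2 P i (Suc d - i) * (real i * x ^ (i - 1) * y ^ (Suc d - i)))) (at x within S)"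
    unfolding hp_expand
  proof (intro DERIV_sum DERIV_cmult)
    fix i
    show "((\<lambda>x. x ^ i * y ^ (Suc d - i)) has_field_derivative real i * x ^ (i - 1) * y ^ (Suc d - i)) (at x within S)"
      by (auto intro!: derivative_eq_intros)
  qed
  also have "(\<Sum>i\<le>Suc d. coeff2 P i (Suc d - i) * (real i * x ^ (i - 1) * y ^ (Suc d - i))) = hp (gdX P) d x y"
    unfolding hp_expand coeff2_gdX
    by (subst sum.atMost_Suc_shift) (simp add: mult_ac del: of_nat_Suc)
  finally show ?thesis .
qed

lemma hp_0_has_derivative: "((\<lambda>x. hp P 0 x y) has_field_derivative 0) (at x within S)" for P :: fps2
  by (simp add: hp_expand)

lemma partial_derivative_sums:
  assumes g: "geo P M K" and r: "r > 0"
    and s: "\<And>x y. \<bar>x\<bar> + \<bar>y\<bar> < r \<Longrightarrow> (\<lambda>d. hp P d x y) sums F x y"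
  obtains \<sigma> where "\<sigma> > 0"
    "\<And>x y. \<bar>x\<bar> < \<sigma> \<Longrightarrow> \<bar>y\<bar> < \<sigma> \<Longrightarrow> \<exists>D. (\<lambda>d. hp (gdX P) d x y) sums D \<and> ((\<lambda>x. F x y) has_real_derivative D) (at x)"
proof -
  \<comment> \<open>The bound \<open>r / 2\<close> keeps the square inside the domain;
    \<open>1 / (8 * K)\<close> makes the ratio \<open>2 * (2 * K) * \<sigma>\<close> in the estimate
    of the derivative at most 1/2.\<close>
  define \<sigma> where "\<sigma> = min (r / 2) (1 / (8 * K))"
  have K: "K > 0" using g by (simp add: geo_def)
  have \<sigma>: "\<sigma> > 0" "2 * \<sigma> \<le> r" using r K by (auto simp: \<sigma>_def)
  have "K * \<sigma> \<le> K * (1 / (8 * K))" using K by (intro mult_left_mono) (auto simp: \<sigma>_def)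
  then have K\<sigma>: "2 * (2 * K) * \<sigma> < 1" using K by simp
  note gX = geo_gdX(1) [OF g]
  have "\<exists>D. (\<lambda>d. hp (gdX P) d x y) sums D \<and> ((\<lambda>x. F x y) has_real_derivative D) (at x)"
    if x: "\<bar>x\<bar> < \<sigma>" and y: "\<bar>y\<bar> < \<sigma>" for x y
  proof -
    define S where "S = {-\<sigma><..<\<sigma>}"
    \<comment> \<open>The index is shifted because differentiation lowers the degree of a
      homogeneous part by one and removes the constant part.\<close>
    define f' where "f' d x = (case d of 0 \<Rightarrow> 0 | Suc d \<Rightarrow> hp (gdX P) d x y)" for d x
    have S: "\<bar>z\<bar> < \<sigma>" if "z \<in> S" for z using that by (auto simp: S_def)
    have ul: "uniform_limit S (\<lambda>n x. \<Sum>i<n. f' i x) (\<lambda>x. \<Sum>i. f' i x) sequentially"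
    proof (rule Weierstrass_m_test)
      show "norm (f' d z) \<le> (case d of 0 \<Rightarrow> 0 | Suc d \<Rightarrow> M * K * (2 * (2 * K) * \<sigma>) ^ d)" if "z \<in> S" for d z
        using geo_hp_bound [OF gX, of z \<sigma> y] S [OF that] y by (auto simp: f'_def split: nat.split)
      have "summable (\<lambda>d. M * K * (2 * (2 * K) * \<sigma>) ^ d)"
        using K\<sigma> \<sigma>(1) K by (intro summable_mult summable_geometric) simp
      then have "summable (\<lambda>d. case Suc d of 0 \<Rightarrow> 0 | Suc d \<Rightarrow> M * K * (2 * (2 * K) * \<sigma>) ^ d)" by simp
      then show "summable (\<lambda>d. case d of 0 \<Rightarrow> 0 | Suc d \<Rightarrow> M * K * (2 * (2 * K) * \<sigma>) ^ d)"
        by (subst (asm) summable_Suc_iff)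
    qed
    have "\<exists>G. \<forall>z\<in>S. (\<lambda>d. hp P d z y) sums G z \<and> (G has_field_derivative (\<Sum>i. f' i z)) (at z within S)"
    proof (rule has_field_derivative_series [OF _ _ ul])
      show "convex S" by (simp add: S_def)
      show "((\<lambda>z. hp P d z y) has_field_derivative f' d z) (at z within S)" for d z
        by (cases d) (simp_all add: f'_def hp_0_has_derivative hp_has_derivative)
      show "0 \<in> S" using \<sigma> by (simp add: S_def)
      show "summable (\<lambda>d. hp P d 0 y)" using s [of 0 y] y \<sigma> by (auto simp: summable_def)
    qed
    then obtain G where G: "\<And>z. z \<in> S \<Longrightarrow> (\<lambda>d. hp P d z y) sums G z"
      "\<And>z. z \<in> S \<Longrightarrow> (G has_field_derivative (\<Sum>i. f' i z)) (at z within S)" by blast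
    have xS: "x \<in> S" using x by (auto simp: S_def)
    have oS: "open S" by (simp add: S_def)
    have GF: "G z = F z y" if "z \<in> S" for z
    proof -
      have "\<bar>z\<bar> + \<bar>y\<bar> < r" using S [OF that] y \<sigma>(2) by linarith
      then show ?thesis using sums_unique2 [OF G(1) [OF that] s] by blast
    qed
    have "(G has_field_derivative (\<Sum>i. f' i x)) (at x)"
      using G(2) [OF xS] at_within_open [OF xS oS] by simp
    then have "((\<lambda>x. F x y) has_field_derivative (\<Sum>i. f' i x)) (at x)"
      by (rule has_field_derivative_transform_within_open [OF _ oS xS GF])
    moreover have "(\<lambda>d. hp (gdX P) d x y) sums (\<Sum>i. f' i x)"
    proof -
      have "summable (\<lambda>d. norm (hp (gdX P) d x y))"
        using geo_hp_summable [OF gX, of x \<sigma> y] x y K\<sigma> by simp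
      then have "summable (\<lambda>d. f' (Suc d) x)" unfolding f'_def by (simp add: summable_norm_cancel)
      then have "summable (\<lambda>d. f' d x)" by (simp only: summable_Suc_iff [of "\<lambda>d. f' d x"])
      then have "(\<lambda>d. f' d x) sums (\<Sum>i. f' i x)" by (rule summable_sums)
      then have "(\<lambda>d. f' (Suc d) x) sums ((\<Sum>i. f' i x) - f' 0 x)"
        by (simp add: sums_Suc_iff [of "\<lambda>d. f' d x"])
      then show ?thesis by (simp add: f'_def)
    qed
    ultimately show ?thesis by blast
  qed
  with \<sigma>(1) that show ?thesis by blast
qed

lemma partial_derivative_sums_Y:
  assumes g: "geo P M K" and r: "r > 0"
    and s: "\<And>x y. \<bar>x\<bar> + \<bar>y\<bar> < r \<Longrightarrow> (\<lambda>d. hp P d x y) sums F x y"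
  obtains \<sigma> where "\<sigma> > 0"
    "\<And>x y. \<bar>x\<bar> < \<sigma> \<Longrightarrow> \<bar>y\<bar> < \<sigma> \<Longrightarrow> \<exists>D. (\<lambda>d. hp (gdY P) d x y) sums D \<and> ((\<lambda>y. F x y) has_real_derivative D) (at y)"
proof -
  define Q where "Q = mk_fps2 (\<lambda>i j. coeff2 P j i)"
  have "\<bar>coeff2 P j i\<bar> \<le> M * K ^ (i + j)" for i j
    using g unfolding geo_def add.commute [of i j] by blast
  then have gQ: "geo Q M K" using g by (simp add: geo_def Q_def)
  have sQ: "(\<lambda>d. hp Q d x y) sums F y x" if "\<bar>x\<bar> + \<bar>y\<bar> < r" for x y
    using s [of y x] that by (simp add: Q_def hp_swap add.commute)
  obtain \<sigma> where \<sigma>: "\<sigma> > 0" "\<And>x y. \<bar>x\<bar> < \<sigma> \<Longrightarrow> \<bar>y\<bar> < \<sigma> \<Longrightarrow>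
      \<exists>D. (\<lambda>d. hp (gdX Q) d x y) sums D \<and> ((\<lambda>x. F y x) has_real_derivative D) (at x)"
    using partial_derivative_sums [where F = "\<lambda>x y. F y x", OF gQ r sQ] by metis
  have "gdX Q = mk_fps2 (\<lambda>i j. coeff2 (gdY P) j i)"
    by (rule fps2_eqI) (simp add: coeff2_gdX coeff2_gdY Q_def)
  then have h: "hp (gdX Q) d x y = hp (gdY P) d y x" for d x y by (simp add: hp_swap)
  show ?thesis
  proof (rule that [OF \<sigma>(1)])
    fix x y :: real assume "\<bar>x\<bar> < \<sigma>" "\<bar>y\<bar> < \<sigma>"
    then show "\<exists>D. (\<lambda>d. hp (gdY P) d x y) sums D \<and> ((\<lambda>y. F x y) has_real_derivative D) (at y)"
      using \<sigma>(2) [of y x] unfolding h by blast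
  qed
qed

lemma hp_zero_imp_coeff2:
  fixes Q :: fps2
  assumes "\<And>x y. hp Q d x y = 0" "i + j = d"
  shows "coeff2 Q i j = 0"
proof -
  have "(\<Sum>i\<le>d. coeff2 Q i (d - i) * x ^ i) = 0" for x
    using assms(1) [of x 1] by (simp add: hp_expand)
  then have "\<not> finite {x. (\<Sum>i\<le>d. coeff2 Q i (d - i) * x ^ i) = (0::real)}"
    by (simp add: infinite_UNIV_char_0)
  then have "coeff2 Q i (d - i) = 0"
    using polyfun_finite_roots [of "\<lambda>i. coeff2 Q i (d - i)" d] assms(2) by auto
  moreover have "d - i = j" using assms(2) by simp
  ultimately show ?thesis by simp
qed

text \<open>On a ray the first surviving homogeneous part is the limit of the sum divided by
  \<open>t ^ d\<close>, while the bound makes this quotient of order \<open>N - d > 0\<close>.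
  Induction on \<open>d\<close> removes the lower parts.\<close>

lemma small_imp_vanish:
  fixes Q :: fps2
  assumes \<delta>: "\<delta> > 0" and C: "C \<ge> 0"
    and small: "\<And>x y. \<bar>x\<bar> + \<bar>y\<bar> < \<delta> \<Longrightarrow> \<exists>s. (\<lambda>d. hp Q d x y) sums s \<and> \<bar>s\<bar> \<le> C * (\<bar>x\<bar> + \<bar>y\<bar>) ^ N"
  shows "vanish N Q"
proof -
  have "hp Q d x y = 0" if "d < N" for d x y
    using that
  proof (induction d rule: less_induct)
    case (less d)
    \<comment> \<open>The summand 1 keeps \<open>\<delta> / u\<close> meaningful when
      \<open>x\<close> and \<open>y\<close> are both 0.\<close>
    define u where "u = \<bar>x\<bar> + \<bar>y\<bar> + 1"
    have u: "u > 0" by (simp add: u_def add_nonneg_pos)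
    have "\<exists>s. (\<lambda>d. t ^ d * hp Q d x y) sums s \<and> \<bar>s\<bar> \<le> C * u ^ N * \<bar>t\<bar> ^ N" if t: "\<bar>t\<bar> < \<delta> / u" for t
    proof -
      have le: "\<bar>t * x\<bar> + \<bar>t * y\<bar> \<le> \<bar>t\<bar> * u" by (simp add: u_def abs_mult algebra_simps)
      also have "\<bar>t\<bar> * u < \<delta>" using t u by (simp add: field_simps)
      finally obtain s where s: "(\<lambda>d. hp Q d (t * x) (t * y)) sums s" "\<bar>s\<bar> \<le> C * (\<bar>t * x\<bar> + \<bar>t * y\<bar>) ^ N"
        using small by blast
      have "C * (\<bar>t * x\<bar> + \<bar>t * y\<bar>) ^ N \<le> C * (\<bar>t\<bar> * u) ^ N"
        using C le by (intro mult_left_mono power_mono) auto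
      with s show ?thesis by (auto simp: hp_scale power_mult_distrib mult_ac)
    qed
    then obtain S where S: "\<And>t. \<bar>t\<bar> < \<delta> / u \<Longrightarrow> (\<lambda>d. t ^ d * hp Q d x y) sums S t"
      "\<And>t. \<bar>t\<bar> < \<delta> / u \<Longrightarrow> \<bar>S t\<bar> \<le> C * u ^ N * \<bar>t\<bar> ^ N" by metis
    have "((\<lambda>t. S t / t ^ d) \<longlongrightarrow> hp Q (0 + d) x y) (at 0)"
    proof (rule powser_limit_0_strong [of "\<delta> / u"])
      show "0 < \<delta> / u" using \<delta> u by simp
      fix t :: real assume t: "t \<noteq> 0" "norm t < \<delta> / u"
      have "(\<Sum>i<d. t ^ i * hp Q i x y) = 0" using less by (intro sum.neutral) auto
      moreover have "(\<lambda>k. t ^ (k + d) * hp Q (k + d) x y) sums (S t - (\<Sum>i<d. t ^ i * hp Q i x y))"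
        using S(1) [of t] t by (subst sums_iff_shift) simp
      ultimately have "(\<lambda>k. t ^ (k + d) * hp Q (k + d) x y / t ^ d) sums (S t / t ^ d)"
        by (intro sums_divide) simp
      then show "(\<lambda>k. hp Q (k + d) x y * t ^ k) sums (S t / t ^ d)"
        using t by (simp add: power_add mult.commute)
    qed
    moreover have "((\<lambda>t. S t / t ^ d) \<longlongrightarrow> 0) (at 0)"
    proof (rule Lim_null_comparison)
      have "eventually (\<lambda>t. \<bar>t\<bar> < \<delta> / u \<and> t \<noteq> 0) (at (0::real))"
        unfolding eventually_at using \<delta> u by (intro exI [of _ "\<delta> / u"]) (simp add: dist_real_def)
      then show "eventually (\<lambda>t. norm (S t / t ^ d) \<le> C * u ^ N * \<bar>t\<bar> ^ (N - d)) (at 0)"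
      proof eventually_elim
        case (elim t)
        then have "\<bar>S t\<bar> / \<bar>t\<bar> ^ d \<le> C * u ^ N * \<bar>t\<bar> ^ N / \<bar>t\<bar> ^ d"
          using S(2) [of t] by (intro divide_right_mono) auto
        also have "\<dots> = C * u ^ N * \<bar>t\<bar> ^ (N - d)" using elim less.prems by (simp add: power_diff)
        finally show ?case by (simp add: power_abs)
      qed
      have "((\<lambda>t. C * u ^ N * \<bar>t\<bar> ^ (N - d)) \<longlongrightarrow> C * u ^ N * \<bar>0\<bar> ^ (N - d)) (at (0::real))"
        by (intro tendsto_intros)
      moreover have "N - d \<noteq> 0" using less.prems by simp
      ultimately show "((\<lambda>t. C * u ^ N * \<bar>t\<bar> ^ (N - d)) \<longlongrightarrow> 0) (at (0::real))"
        by (simp add: power_0_left)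
    qed
    ultimately show ?case using tendsto_unique [OF trivial_limit_at] by fastforce
  qed
  then show ?thesis by (intro vanishI) (metis hp_zero_imp_coeff2)
qed

text \<open>The real case is applied to \<open>Q\<close> and to \<open>- \<i>\<close> times
  \<open>Q\<close>, whose real parts are the real and imaginary parts of \<open>Q\<close>.\<close>

lemma small_imp_vanish_complex:
  fixes Q :: "complex fps fps"
  assumes \<delta>: "\<delta> > 0" and C: "C \<ge> 0"
    and small: "\<And>x y. \<bar>x\<bar> + \<bar>y\<bar> < \<delta> \<Longrightarrow>
      \<exists>s. (\<lambda>d. hp Q d (complex_of_real x) (complex_of_real y)) sums s \<and> norm s \<le> C * (\<bar>x\<bar> + \<bar>y\<bar>) ^ N"
  shows "vanish N Q"
proof -
  have re: "vanish N (re2 (const2 c * Q))" if c: "norm c = 1" for c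
  proof (rule small_imp_vanish [OF \<delta> C])
    fix x y :: real assume "\<bar>x\<bar> + \<bar>y\<bar> < \<delta>"
    then obtain s where s: "(\<lambda>d. hp Q d (complex_of_real x) (complex_of_real y)) sums s" "norm s \<le> C * (\<bar>x\<bar> + \<bar>y\<bar>) ^ N"
      using small by blast
    have "(\<lambda>d. hp (re2 (const2 c * Q)) d x y) sums Re (c * s)"
      unfolding hp_re2 hp_const_mult using s(1) by (intro sums_Re sums_mult)
    moreover have "\<bar>Re (c * s)\<bar> \<le> norm s"
      using abs_Re_le_cmod [of "c * s"] c by (simp add: norm_mult)
    ultimately show "\<exists>s. (\<lambda>d. hp (re2 (const2 c * Q)) d x y) sums s \<and> \<bar>s\<bar> \<le> C * (\<bar>x\<bar> + \<bar>y\<bar>) ^ N"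
      using s(2) by (meson order_trans)
  qed
  show ?thesis
    using re [of 1] re [of "- \<i>"] by (auto simp: vanish_def complex_eq_iff)
qed

section \<open>Area preservation as a formal identity\<close>

lemma hp_1: "hp 1 d x y = (if d = 0 then 1 else 0)"
  by (simp add: hp_def gsubst2_basic [OF nc_ray] coeff2_1)

lemma sums_hp_mult:
  fixes P Q :: fps2
  assumes "(\<lambda>d. hp P d x y) sums a" "(\<lambda>d. hp Q d x y) sums b"
    "summable (\<lambda>d. norm (hp P d x y))" "summable (\<lambda>d. norm (hp Q d x y))"
  shows "(\<lambda>d. hp (P * Q) d x y) sums (a * b)"
  unfolding hp_mult using Cauchy_product_sums [OF assms(3,4)] assms(1,2) by (simp add: sums_iff)

lemma vector2_eq: "(vector [x, y] :: real^2) = x *\<^sub>R axis 1 1 + y *\<^sub>R axis 2 1"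
  by (simp add: vec_eq_iff forall_2 axis_def)

lemma partial_derivatives_eq_matrix:
  fixes F :: "real^2 \<Rightarrow> real^2" and J :: "real^2^2"
  assumes "(F has_derivative (\<lambda>h. J *v h)) (at (vector [x, y]))"
  shows "((\<lambda>x. F (vector [x, y]) $ i) has_real_derivative J $ i $ 1) (at x)"
    and "((\<lambda>y. F (vector [x, y]) $ i) has_real_derivative J $ i $ 2) (at y)"
proof -
  have Fi: "((\<lambda>v. F v $ i) has_derivative (\<lambda>h. (J *v h) $ i)) (at (vector [x, y]))"
    using bounded_linear.has_derivative [OF bounded_linear_vec_nth assms] .
  have "((\<lambda>x. vector [x, y] :: real^2) has_derivative (\<lambda>h. h *\<^sub>R axis 1 1)) (at x)"
    unfolding vector2_eq by (auto intro!: derivative_eq_intros)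
  from diff_chain_at [OF this Fi]
  have "((\<lambda>x. F (vector [x, y]) $ i) has_derivative (\<lambda>h. (J *v (h *\<^sub>R axis 1 1)) $ i)) (at x)" by (simp add: o_def)
  moreover have "(J *v (h *\<^sub>R axis 1 1)) $ i = J $ i $ 1 * h" for h
    by (simp add: matrix_vector_mult_def sum_2 axis_def)
  ultimately show "((\<lambda>x. F (vector [x, y]) $ i) has_real_derivative J $ i $ 1) (at x)"
    by (simp add: has_field_derivative_def)
  have "((\<lambda>y. vector [x, y] :: real^2) has_derivative (\<lambda>h. h *\<^sub>R axis 2 1)) (at y)"
    unfolding vector2_eq by (auto intro!: derivative_eq_intros)
  from diff_chain_at [OF this Fi]
  have "((\<lambda>y. F (vector [x, y]) $ i) has_derivative (\<lambda>h. (J *v (h *\<^sub>R axis 2 1)) $ i)) (at y)" by (simp add: o_def)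
  moreover have "(J *v (h *\<^sub>R axis 2 1)) $ i = J $ i $ 2 * h" for h
    by (simp add: matrix_vector_mult_def sum_2 axis_def)
  ultimately show "((\<lambda>y. F (vector [x, y]) $ i) has_real_derivative J $ i $ 2) (at y)"
    by (simp add: has_field_derivative_def)
qed

lemma taylor_no_const:
  assumes "has_power_series_at f P 0" "f 0 = 0"
  shows "vanish 1 P"
proof -
  obtain r M K where "r > 0" and s: "\<And>x y. \<bar>x\<bar> + \<bar>y\<bar> < r \<Longrightarrow> (\<lambda>d. hp P d x y) sums f (vector [x, y])"
    using power_series_sums [OF assms(1)] by metis
  then have "(\<lambda>d. hp P d 0 0) sums f (vector [0, 0])" by simp
  moreover have "(vector [0, 0] :: real^2) = 0" by (simp add: vector2_eq)
  moreover have "hp P d 0 0 = (if d = 0 then hp P d 0 0 else 0)" for d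
    using hp_scale [of P d 0 0 0] by (cases d) auto
  then have "(\<lambda>d. hp P d 0 0) sums hp P 0 0 0" using sums_single [of 0 "\<lambda>d. hp P d 0 0"] by simp
  ultimately have "hp P 0 0 0 = 0" using assms(2) sums_unique2 by force
  then show ?thesis by (simp add: vanish_def hp_expand)
qed

lemma local_partial_derivatives:
  assumes "has_power_series_at f P 0"
  obtains \<sigma> where "\<sigma> > 0"
    "\<And>x y. \<bar>x\<bar> < \<sigma> \<Longrightarrow> \<bar>y\<bar> < \<sigma> \<Longrightarrow> summable (\<lambda>d. norm (hp (gdX P) d x y)) \<and>
       summable (\<lambda>d. norm (hp (gdY P) d x y)) \<and>
       (\<exists>D. (\<lambda>d. hp (gdX P) d x y) sums D \<and> ((\<lambda>x. f (vector [x, y])) has_real_derivative D) (at x)) \<and>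
       (\<exists>D. (\<lambda>d. hp (gdY P) d x y) sums D \<and> ((\<lambda>y. f (vector [x, y])) has_real_derivative D) (at y))"
proof -
  obtain r M K where r: "r > 0" and g: "geo P M K"
    and s: "\<And>x y. \<bar>x\<bar> + \<bar>y\<bar> < r \<Longrightarrow> (\<lambda>d. hp P d x y) sums f (vector [x, y])"
    using power_series_sums [OF assms] by metis
  have K: "K > 0" using g by (simp add: geo_def)
  obtain \<sigma>1 where 1: "\<sigma>1 > 0" "\<And>x y. \<bar>x\<bar> < \<sigma>1 \<Longrightarrow> \<bar>y\<bar> < \<sigma>1 \<Longrightarrow>
      \<exists>D. (\<lambda>d. hp (gdX P) d x y) sums D \<and> ((\<lambda>x. f (vector [x, y])) has_real_derivative D) (at x)"
    using partial_derivative_sums [where F = "\<lambda>x y. f (vector [x, y])", OF g r s] by metis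
  obtain \<sigma>2 where 2: "\<sigma>2 > 0" "\<And>x y. \<bar>x\<bar> < \<sigma>2 \<Longrightarrow> \<bar>y\<bar> < \<sigma>2 \<Longrightarrow>
      \<exists>D. (\<lambda>d. hp (gdY P) d x y) sums D \<and> ((\<lambda>y. f (vector [x, y])) has_real_derivative D) (at y)"
    using partial_derivative_sums_Y [where F = "\<lambda>x y. f (vector [x, y])", OF g r s] by metis
  define \<sigma>3 where "\<sigma>3 = 1 / (8 * K)"
  have 3: "\<sigma>3 > 0" "2 * (2 * K) * \<sigma>3 < 1" using K by (simp_all add: \<sigma>3_def)
  define \<sigma> where "\<sigma> = min \<sigma>1 (min \<sigma>2 \<sigma>3)"
  show ?thesis
  proof (rule that [of \<sigma>])
    show "\<sigma> > 0" using 1 2 3 by (simp add: \<sigma>_def)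
    fix x y assume xy: "\<bar>x\<bar> < \<sigma>" "\<bar>y\<bar> < \<sigma>"
    have x3: "\<bar>x\<bar> \<le> \<sigma>3" "\<bar>y\<bar> \<le> \<sigma>3" using xy by (simp_all add: \<sigma>_def)
    show "summable (\<lambda>d. norm (hp (gdX P) d x y)) \<and> summable (\<lambda>d. norm (hp (gdY P) d x y)) \<and>
       (\<exists>D. (\<lambda>d. hp (gdX P) d x y) sums D \<and> ((\<lambda>x. f (vector [x, y])) has_real_derivative D) (at x)) \<and>
       (\<exists>D. (\<lambda>d. hp (gdY P) d x y) sums D \<and> ((\<lambda>y. f (vector [x, y])) has_real_derivative D) (at y))"
      using 1(2) [of x y] 2(2) [of x y] geo_hp_summable [OF geo_gdX(1) [OF g] x3 3(2)]
        geo_hp_summable [OF geo_gdX(2) [OF g] x3 3(2)] xy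
      by (simp add: \<sigma>_def)
  qed
qed

text \<open>Near the origin the entries of the derivative are sums of the differentiated Taylor
  series, so determinant 1 says that the series \<open>br (fst T) (snd T) - 1\<close> sums to 0 on a
  neighbourhood. \<open>small_imp_vanish\<close> then applies with constant 0 and every
  \<open>N\<close>.\<close>

lemma symp_taylor:
  assumes U: "open U" "0 \<in> U" and F: "area_orientation_preserving_on F U" "F 0 = 0"
    and T: "taylor_at_0 F T"
  shows "symp T"
proof -
  have T1: "has_power_series_at (\<lambda>v. F v $ 1) (fst T) 0" and T2: "has_power_series_at (\<lambda>v. F v $ 2) (snd T) 0"
    using T by (simp_all add: taylor_at_0_def)
  have "vanish 1 (fst T)" "vanish 1 (snd T)"
    using taylor_no_const [OF T1] taylor_no_const [OF T2] F(2) by simp_all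
  then have nc: "nc T" by (simp add: nc_def)
  obtain \<sigma>1 where s1: "\<sigma>1 > 0" and d1: "\<And>x y. \<bar>x\<bar> < \<sigma>1 \<Longrightarrow> \<bar>y\<bar> < \<sigma>1 \<Longrightarrow> summable (\<lambda>d. norm (hp (gdX (fst T)) d x y)) \<and>
       summable (\<lambda>d. norm (hp (gdY (fst T)) d x y)) \<and>
       (\<exists>D. (\<lambda>d. hp (gdX (fst T)) d x y) sums D \<and> ((\<lambda>x. F (vector [x, y]) $ 1) has_real_derivative D) (at x)) \<and>
       (\<exists>D. (\<lambda>d. hp (gdY (fst T)) d x y) sums D \<and> ((\<lambda>y. F (vector [x, y]) $ 1) has_real_derivative D) (at y))"
    using local_partial_derivatives [OF T1] by metis
  obtain \<sigma>2 where s2: "\<sigma>2 > 0" and d2: "\<And>x y. \<bar>x\<bar> < \<sigma>2 \<Longrightarrow> \<bar>y\<bar> < \<sigma>2 \<Longrightarrow> summable (\<lambda>d. norm (hp (gdX (snd T)) d x y)) \<and>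
       summable (\<lambda>d. norm (hp (gdY (snd T)) d x y)) \<and>
       (\<exists>D. (\<lambda>d. hp (gdX (snd T)) d x y) sums D \<and> ((\<lambda>x. F (vector [x, y]) $ 2) has_real_derivative D) (at x)) \<and>
       (\<exists>D. (\<lambda>d. hp (gdY (snd T)) d x y) sums D \<and> ((\<lambda>y. F (vector [x, y]) $ 2) has_real_derivative D) (at y))"
    using local_partial_derivatives [OF T2] by metis
  obtain \<epsilon> where e: "\<epsilon> > 0" "ball 0 \<epsilon> \<subseteq> U" using U open_contains_ball by metis
  define \<delta> where "\<delta> = min \<epsilon> (min \<sigma>1 \<sigma>2)"
  have \<delta>: "\<delta> > 0" using e s1 s2 by (simp add: \<delta>_def)
  have main: "(\<lambda>d. hp (br (fst T) (snd T) - 1) d x y) sums 0" if xy: "\<bar>x\<bar> + \<bar>y\<bar> < \<delta>" for x y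
  proof -
    have b: "\<bar>x\<bar> < \<sigma>1" "\<bar>y\<bar> < \<sigma>1" "\<bar>x\<bar> < \<sigma>2" "\<bar>y\<bar> < \<sigma>2" "\<bar>x\<bar> + \<bar>y\<bar> < \<epsilon>"
      using xy by (auto simp: \<delta>_def)
    have "norm (vector [x, y] :: real^2) < \<epsilon>"
      by (rule le_less_trans [OF norm_real2]) (use b(5) in simp)
    then have "(vector [x, y] :: real^2) \<in> ball 0 \<epsilon>" by (simp only: mem_ball_0)
    then obtain J :: "real^2^2" where J: "(F has_derivative (\<lambda>h. J *v h)) (at (vector [x, y]))" "det J = 1"
      using F(1) e(2) unfolding area_orientation_preserving_on_def by blast
    note P = partial_derivatives_eq_matrix [OF J(1)]
    have 11: "(\<lambda>d. hp (gdX (fst T)) d x y) sums (J $ 1 $ 1)"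
      using d1 [OF b(1,2)] DERIV_unique [OF P(1) [of 1]] by auto
    have 12: "(\<lambda>d. hp (gdY (fst T)) d x y) sums (J $ 1 $ 2)"
      using d1 [OF b(1,2)] DERIV_unique [OF P(2) [of 1]] by auto
    have 21: "(\<lambda>d. hp (gdX (snd T)) d x y) sums (J $ 2 $ 1)"
      using d2 [OF b(3,4)] DERIV_unique [OF P(1) [of 2]] by auto
    have 22: "(\<lambda>d. hp (gdY (snd T)) d x y) sums (J $ 2 $ 2)"
      using d2 [OF b(3,4)] DERIV_unique [OF P(2) [of 2]] by auto
    have "(\<lambda>d. hp (gdX (fst T) * gdY (snd T)) d x y - hp (gdY (fst T) * gdX (snd T)) d x y) sums
        (J $ 1 $ 1 * J $ 2 $ 2 - J $ 1 $ 2 * J $ 2 $ 1)"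
      using d1 [OF b(1,2)] d2 [OF b(3,4)] by (intro sums_diff sums_hp_mult 11 12 21 22) auto
    then have "(\<lambda>d. hp (br (fst T) (snd T)) d x y) sums 1"
      using J(2) by (simp add: det_2 br_def hp_diff)
    moreover have "(\<lambda>d. hp 1 d x y) sums 1"
      unfolding hp_1 using sums_single [of 0 "\<lambda>_. 1::real"] by simp
    ultimately have "(\<lambda>d. hp (br (fst T) (snd T)) d x y - hp 1 d x y) sums (1 - 1)" by (rule sums_diff)
    then show ?thesis by (simp add: hp_diff)
  qed
  have "vanish N (br (fst T) (snd T) - 1)" for N
    by (rule small_imp_vanish [OF \<delta> order_refl]) (use main in auto)
  then have "br (fst T) (snd T) = 1" using vanish_all by fastforce
  then show ?thesis using nc by (simp add: symp_def)
qed

section \<open>The leading terms of the Taylor series of the map\<close>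

lemma poly_remainder_1:
  fixes p :: "complex poly"
  obtains C where "C \<ge> 0" "\<And>z. norm z \<le> 1 \<Longrightarrow> norm (poly p z - coeff p 0) \<le> C * norm z"
proof (cases p)
  case (pCons c q)
  obtain m where "m > 0" "\<And>z. norm z \<le> 1 \<Longrightarrow> norm (poly q z) \<le> m" using poly_bound_exists [of 1 q] by blast
  then have "norm (poly p z - coeff p 0) \<le> m * norm z" if "norm z \<le> 1" for z
    using that mult_left_mono [of "norm (poly q z)" m "norm z"]
    by (simp add: pCons norm_mult mult.commute [of m])
  with \<open>m > 0\<close> that show ?thesis by (metis less_imp_le)
qed

lemma poly_remainder_2:
  fixes p :: "complex poly"
  obtains C where "C \<ge> 0" "\<And>z. norm z \<le> 1 \<Longrightarrow> norm (poly p z - coeff p 0 - coeff p 1 * z) \<le> C * norm z ^ 2"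
proof (cases p)
  case (pCons c q)
  obtain m where m: "m \<ge> 0" "\<And>z. norm z \<le> 1 \<Longrightarrow> norm (poly q z - coeff q 0) \<le> m * norm z"
    using poly_remainder_1 [of q] by blast
  have "norm (poly p z - coeff p 0 - coeff p 1 * z) \<le> m * norm z ^ 2" if "norm z \<le> 1" for z
  proof -
    have "poly p z - coeff p 0 - coeff p 1 * z = z * (poly q z - coeff q 0)"
      by (simp add: pCons algebra_simps)
    then have "norm (poly p z - coeff p 0 - coeff p 1 * z) = norm z * norm (poly q z - coeff q 0)"
      by (simp only: norm_mult)
    also have "\<dots> \<le> norm z * (m * norm z)" using m(2) [OF that] by (intro mult_left_mono) auto
    finally show ?thesis by (simp add: power2_eq_square mult_ac)
  qed
  with m(1) that show ?thesis by blast
qed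

text \<open>Modulo order \<open>n\<close> the given form keeps the constant terms of
  \<open>a\<close> and \<open>b\<close> and, for \<open>n = 4\<close>, the linear coefficient of
  \<open>a\<close>, since \<open>z^2 w\<close> has degree 3; all other terms are of order at least
  \<open>n\<close>. The estimate is made in real \<open>x\<close>, \<open>y\<close>, turned into
  vanishing coefficients by \<open>small_imp_vanish_complex\<close>, and then transferred to
  \<open>z\<close>, \<open>w\<close>.\<close>

lemma leading_terms_taylor:
  fixes a b :: "complex poly"
  assumes n: "n = 3 \<or> n = 4" and F0: "F 0 = 0" and T: "taylor_at_0 F T"
    and O: "(\<lambda>v. cplx (F v) -
            (poly a (cplx v * cnj (cplx v)) * cplx v +
             poly b (cplx v * cnj (cplx v)) * cnj (cplx v) ^ (n - 1)))
         \<in> O[at 0](\<lambda>v. of_real (norm (cplx v) ^ (n + 1)))"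
  shows "vanish n (zmap T - (mono2 (coeff a 0) 1 0 + mono2 (if n = 4 then coeff a 1 else 0) 2 1 +
           mono2 (coeff b 0) 0 (n - 1)))"
proof -
  define a1 where "a1 = (if n = 4 then coeff a 1 else 0)"
  define full where "full \<zeta> = poly a (\<zeta> * cnj \<zeta>) * \<zeta> + poly b (\<zeta> * cnj \<zeta>) * cnj \<zeta> ^ (n - 1)" for \<zeta>
  define lp where "lp \<zeta> = coeff a 0 * \<zeta> + a1 * (\<zeta> ^ 2 * cnj \<zeta>) + coeff b 0 * cnj \<zeta> ^ (n - 1)" for \<zeta>
  define Z W where "Z = fst zw_of_xy" and "W = snd zw_of_xy"
  define G where "G = const2 (coeff a 0) * Z + const2 a1 * (Z ^ 2 * W) + const2 (coeff b 0) * W ^ (n - 1)"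
  define Tc where "Tc = cx (fst T) + const2 \<i> * cx (snd T)"
  have G_sums: "(\<lambda>d. hp G d (complex_of_real x) (complex_of_real y)) sums lp (Complex x y)" for x y
  proof -
    let ?G = "(const2 (complex_of_real x) * X2, const2 (complex_of_real y) * X2)"
    define \<zeta> where "\<zeta> = Complex x y"
    note N = nc_ray [of "complex_of_real x" "complex_of_real y"]
    have Z: "gsubst2 Z ?G = const2 \<zeta> * X2"
      unfolding Z_def zw_of_xy_def fst_conv gsubst2_add gsubst2_const_mult [OF N] gsubst2_basic [OF N] snd_conv
      by (rule fps2_eqI, simp only: coeff2_linear) (simp add: \<zeta>_def complex_eq_iff)
    have W: "gsubst2 W ?G = const2 (cnj \<zeta>) * X2"
      unfolding W_def zw_of_xy_def fst_conv gsubst2_diff [OF N] gsubst2_const_mult [OF N] gsubst2_basic [OF N] snd_conv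
      by (rule fps2_eqI, simp only: coeff2_linear) (simp add: \<zeta>_def complex_eq_iff)
    have "gsubst2 G ?G = mono2 (coeff a 0 * \<zeta>) 1 0 + mono2 (a1 * (\<zeta> ^ 2 * cnj \<zeta>)) 3 0 + mono2 (coeff b 0 * cnj \<zeta> ^ (n - 1)) (n - 1) 0"
      unfolding G_def gsubst2_add gsubst2_const_mult [OF N] gsubst2_mult [OF N] gsubst2_power [OF N]
        gsubst2_basic(3) [OF N] Z W
      by (simp add: mono2_def power_mult_distrib power2_eq_square power3_eq_cube mult_ac)
    then have "hp G d (complex_of_real x) (complex_of_real y) = (if d = 1 then coeff a 0 * \<zeta> else 0) +
        (if d = 3 then a1 * (\<zeta> ^ 2 * cnj \<zeta>) else 0) + (if d = n - 1 then coeff b 0 * cnj \<zeta> ^ (n - 1) else 0)" for d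
      unfolding hp_def by (simp add: coeff2_mono2)
    moreover have "(\<lambda>d. (if d = 1 then coeff a 0 * \<zeta> else 0) +
        (if d = 3 then a1 * (\<zeta> ^ 2 * cnj \<zeta>) else 0) + (if d = n - 1 then coeff b 0 * cnj \<zeta> ^ (n - 1) else 0)) sums lp \<zeta>"
      unfolding lp_def
      using sums_single [of 1 "\<lambda>_. coeff a 0 * \<zeta>"] sums_single [of 3 "\<lambda>_. a1 * (\<zeta> ^ 2 * cnj \<zeta>)"]
        sums_single [of "n - 1" "\<lambda>_. coeff b 0 * cnj \<zeta> ^ (n - 1)"]
      by (intro sums_add)
    ultimately show ?thesis by (simp add: \<zeta>_def)
  qed
  have T1: "has_power_series_at (\<lambda>v. F v $ 1) (fst T) 0" and T2: "has_power_series_at (\<lambda>v. F v $ 2) (snd T) 0"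
    using T by (simp_all add: taylor_at_0_def)
  obtain r1 where r1: "r1 > 0" and t1: "\<And>x y. \<bar>x\<bar> + \<bar>y\<bar> < r1 \<Longrightarrow> (\<lambda>d. hp (fst T) d x y) sums (F (vector [x, y]) $ 1)"
    using power_series_sums [OF T1] by metis
  obtain r2 where r2: "r2 > 0" and t2: "\<And>x y. \<bar>x\<bar> + \<bar>y\<bar> < r2 \<Longrightarrow> (\<lambda>d. hp (snd T) d x y) sums (F (vector [x, y]) $ 2)"
    using power_series_sums [OF T2] by metis
  have T_sums: "(\<lambda>d. hp Tc d (complex_of_real x) (complex_of_real y)) sums cplx (F (vector [x, y]))"
    if "\<bar>x\<bar> + \<bar>y\<bar> < r1" "\<bar>x\<bar> + \<bar>y\<bar> < r2" for x y
  proof -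
    have "(\<lambda>d. complex_of_real (hp (fst T) d x y) + \<i> * complex_of_real (hp (snd T) d x y)) sums
        (complex_of_real (F (vector [x, y]) $ 1) + \<i> * complex_of_real (F (vector [x, y]) $ 2))"
      using t1 t2 that by (intro sums_add sums_mult sums_of_real) auto
    then show ?thesis
      by (simp add: Tc_def hp_add hp_const_mult hp_cx cplx_def Complex_eq)
  qed
  obtain c where c: "c > 0" "eventually (\<lambda>v. norm (cplx (F v) - full (cplx v)) \<le> c * norm (complex_of_real (norm (cplx v) ^ (n + 1)))) (at 0)"
    using landau_o.bigE [OF O] unfolding full_def by blast
  then obtain e where e: "e > 0" "\<And>v. v \<noteq> 0 \<Longrightarrow> norm v < e \<Longrightarrow>
      norm (cplx (F v) - full (cplx v)) \<le> c * norm (cplx v) ^ (n + 1)"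
    unfolding eventually_at norm_of_real by (auto simp: dist_norm)
  obtain Ca where Ca: "Ca \<ge> 0" "\<And>z. norm z \<le> 1 \<Longrightarrow> norm (poly a z - coeff a 0) \<le> Ca * norm z"
    using poly_remainder_1 [of a] by blast
  obtain Ca2 where Ca2: "Ca2 \<ge> 0" "\<And>z. norm z \<le> 1 \<Longrightarrow> norm (poly a z - coeff a 0 - coeff a 1 * z) \<le> Ca2 * norm z ^ 2"
    using poly_remainder_2 [of a] by blast
  obtain Cb where Cb: "Cb \<ge> 0" "\<And>z. norm z \<le> 1 \<Longrightarrow> norm (poly b z - coeff b 0) \<le> Cb * norm z"
    using poly_remainder_1 [of b] by blast
  define C where "C = c + Ca + Ca2 + Cb"
  have C0: "C \<ge> 0" using c Ca Ca2 Cb by (simp add: C_def)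
  have rem: "norm (full \<zeta> - lp \<zeta>) \<le> (Ca + Ca2 + Cb) * norm \<zeta> ^ n" if \<zeta>: "norm \<zeta> \<le> 1" for \<zeta>
  proof -
    define s where "s = \<zeta> * cnj \<zeta>"
    have ns: "norm s = norm \<zeta> ^ 2" by (simp add: s_def norm_mult power2_eq_square)
    have s1: "norm s \<le> 1" unfolding ns using \<zeta> by (simp add: power_le_one)
    have z: "norm \<zeta> ^ k \<le> norm \<zeta> ^ n" if "n \<le> k" for k using \<zeta> that by (intro power_decreasing) auto
    have pa: "norm ((poly a s - coeff a 0 - a1 * s) * \<zeta>) \<le> (Ca + Ca2) * norm \<zeta> ^ n"
    proof (cases "n = 4")
      case True
      have "norm ((poly a s - coeff a 0 - a1 * s) * \<zeta>) \<le> (Ca2 * norm s ^ 2) * norm \<zeta>"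
        unfolding norm_mult using Ca2(2) [OF s1] True by (intro mult_right_mono) (simp_all add: a1_def)
      also have "\<dots> = Ca2 * norm \<zeta> ^ 5" by (simp add: ns power_mult [symmetric] eval_nat_numeral)
      also have "\<dots> \<le> (Ca + Ca2) * norm \<zeta> ^ n" using True z [of 5] Ca Ca2 by (intro mult_mono) auto
      finally show ?thesis .
    next
      case False
      then have n3: "n = 3" using n by simp
      have "norm ((poly a s - coeff a 0 - a1 * s) * \<zeta>) \<le> (Ca * norm s) * norm \<zeta>"
        unfolding norm_mult using Ca(2) [OF s1] False by (intro mult_right_mono) (simp_all add: a1_def)
      also have "\<dots> = Ca * norm \<zeta> ^ 3" by (simp add: ns eval_nat_numeral)
      also have "\<dots> \<le> (Ca + Ca2) * norm \<zeta> ^ n" using n3 Ca Ca2 by (intro mult_mono) auto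
      finally show ?thesis .
    qed
    have pb: "norm ((poly b s - coeff b 0) * cnj \<zeta> ^ (n - 1)) \<le> Cb * norm \<zeta> ^ n"
    proof -
      have "norm ((poly b s - coeff b 0) * cnj \<zeta> ^ (n - 1)) \<le> (Cb * norm s) * norm \<zeta> ^ (n - 1)"
        unfolding norm_mult norm_power complex_mod_cnj using Cb(2) [OF s1] by (intro mult_right_mono) auto
      also have "\<dots> = Cb * norm \<zeta> ^ (2 + (n - 1))" unfolding ns power_add by simp
      also have "\<dots> \<le> Cb * norm \<zeta> ^ n" using Cb n by (intro mult_left_mono z) auto
      finally show ?thesis .
    qed
    have "full \<zeta> - lp \<zeta> = (poly a s - coeff a 0 - a1 * s) * \<zeta> + (poly b s - coeff b 0) * cnj \<zeta> ^ (n - 1)"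
      by (simp add: full_def lp_def s_def power2_eq_square algebra_simps)
    then have "norm (full \<zeta> - lp \<zeta>) \<le> norm ((poly a s - coeff a 0 - a1 * s) * \<zeta>) + norm ((poly b s - coeff b 0) * cnj \<zeta> ^ (n - 1))"
      by (simp only: norm_triangle_ineq)
    with pa pb show ?thesis by (simp add: distrib_right)
  qed
  define \<delta> where "\<delta> = min (min r1 r2) (min e 1)"
  have \<delta>: "\<delta> > 0" using r1 r2 e by (simp add: \<delta>_def)
  have "vanish n (Tc - G)"
  proof (rule small_imp_vanish_complex [OF \<delta> C0])
    fix x y :: real assume xy: "\<bar>x\<bar> + \<bar>y\<bar> < \<delta>"
    define v :: "real^2" where "v = vector [x, y]"
    define \<zeta> where "\<zeta> = Complex x y"
    have cv: "cplx v = \<zeta>" by (simp add: v_def \<zeta>_def cplx_def)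
    have n\<zeta>: "norm \<zeta> \<le> \<bar>x\<bar> + \<bar>y\<bar>" using cmod_le [of \<zeta>] by (simp add: \<zeta>_def)
    have \<zeta>1: "norm \<zeta> \<le> 1" using n\<zeta> xy by (simp add: \<delta>_def)
    have "norm (cplx (F v) - full \<zeta>) \<le> c * norm \<zeta> ^ (n + 1)"
    proof (cases "v = 0")
      case True
      have c0: "cplx 0 = 0" by (simp add: cplx_def complex_eq_iff)
      then have "\<zeta> = 0" using True cv by simp
      then show ?thesis using True F0 n c0 by (auto simp: full_def)
    next
      case False
      moreover have "norm v < e" using norm_real2 [of v] xy by (simp add: v_def \<delta>_def)
      ultimately show ?thesis using e(2) [of v] cv by simp
    qed
    also have "\<dots> \<le> c * norm \<zeta> ^ n" using c \<zeta>1 by (intro mult_left_mono power_decreasing) auto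
    finally have 1: "norm (cplx (F v) - full \<zeta>) \<le> c * norm \<zeta> ^ n" .
    have "norm (cplx (F v) - lp \<zeta>) \<le> norm (cplx (F v) - full \<zeta>) + norm (full \<zeta> - lp \<zeta>)"
      using norm_triangle_ineq [of "cplx (F v) - full \<zeta>" "full \<zeta> - lp \<zeta>"] by simp
    also have "\<dots> \<le> c * norm \<zeta> ^ n + (Ca + Ca2 + Cb) * norm \<zeta> ^ n" using 1 rem [OF \<zeta>1] by (rule add_mono)
    also have "\<dots> = C * norm \<zeta> ^ n" by (simp add: C_def algebra_simps)
    also have "\<dots> \<le> C * (\<bar>x\<bar> + \<bar>y\<bar>) ^ n" using C0 n\<zeta> by (intro mult_left_mono power_mono) auto
    finally have "norm (cplx (F v) - lp \<zeta>) \<le> C * (\<bar>x\<bar> + \<bar>y\<bar>) ^ n" .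
    moreover have "(\<lambda>d. hp (Tc - G) d (complex_of_real x) (complex_of_real y)) sums (cplx (F v) - lp \<zeta>)"
      unfolding hp_diff v_def \<zeta>_def using xy by (intro sums_diff T_sums G_sums) (auto simp: \<delta>_def)
    ultimately show "\<exists>s. (\<lambda>d. hp (Tc - G) d (complex_of_real x) (complex_of_real y)) sums s \<and> norm s \<le> C * (\<bar>x\<bar> + \<bar>y\<bar>) ^ n"
      by blast
  qed
  then have "vanish n (gsubst2 (Tc - G) xy_of_zw)" by (rule vanish_gsubst2 [OF nc_xy_of_zw])
  moreover have "gsubst2 Tc xy_of_zw = zmap T"
    by (simp add: Tc_def zmap_def zw_def gsubst2_add gsubst2_const_mult nc_xy_of_zw)
  moreover have "gsubst2 G xy_of_zw = mono2 (coeff a 0) 1 0 + mono2 a1 2 1 + mono2 (coeff b 0) 0 (n - 1)"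
  proof -
    have "gsubst2 Z xy_of_zw = X2" "gsubst2 W xy_of_zw = Y2"
      using xy_zw_inverse(1) by (simp_all add: gcomp_def Z_def W_def)
    then show ?thesis
      unfolding G_def gsubst2_add gsubst2_const_mult [OF nc_xy_of_zw] gsubst2_mult [OF nc_xy_of_zw]
        gsubst2_power [OF nc_xy_of_zw] gsubst2_basic(3) [OF nc_xy_of_zw]
      by (simp add: mono2_def)
  qed
  ultimately show ?thesis by (simp add: gsubst2_diff [OF nc_xy_of_zw] a1_def)
qed

theorem theorem2:
  fixes n :: nat and \<alpha>\<^sub>0 :: real and U :: "(real^2) set" and F\<^sub>0 :: "real^2 \<Rightarrow> real^2"
    and a b :: "complex poly" and T :: fmap
  assumes "n = 3 \<or> n = 4"
    and "open U" and "0 \<in> U"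
    and "real_analytic_on F\<^sub>0 U"
    and "area_orientation_preserving_on F\<^sub>0 U"
    and "F\<^sub>0 0 = 0"
    and "(F\<^sub>0 has_derivative (\<lambda>h. rotation \<alpha>\<^sub>0 *v h)) (at 0)"
    and "cis \<alpha>\<^sub>0 ^ n = 1"
    and "\<forall>k. 1 \<le> k \<and> k < n \<longrightarrow> cis \<alpha>\<^sub>0 ^ k \<noteq> 1"
    and "(\<lambda>v. cplx (F\<^sub>0 v) -
            (poly a (cplx v * cnj (cplx v)) * cplx v +
             poly b (cplx v * cnj (cplx v)) * cnj (cplx v) ^ (n - 1)))
         \<in> O[at 0](\<lambda>v. of_real (norm (cplx v) ^ (n + 1)))"
    and "poly a 0 = cis \<alpha>\<^sub>0"
    and "poly b 0 \<noteq> 0"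
    and "taylor_at_0 F\<^sub>0 T"
  shows "(\<exists>A B. is_normal_form n \<alpha>\<^sub>0 T A B \<and> fps_nth B 0 > 0) \<and>
         (\<forall>A B A' B'. is_normal_form n \<alpha>\<^sub>0 T A B \<and> fps_nth B 0 > 0 \<and>
                      is_normal_form n \<alpha>\<^sub>0 T A' B' \<and> fps_nth B' 0 > 0 \<longrightarrow>
                      A = A' \<and> B = B')"
proof -
  interpret resonance n \<alpha>\<^sub>0
    using assms(1,8,9) by unfold_locales auto
  have "symp T" using symp_taylor assms(2,3,5,6,13) by blast
  moreover have "coeff b 0 \<noteq> 0" using assms(12) by (simp add: poly_0_coeff_0)
  moreover have "vanish n (zmap T - (mono2 (cis \<alpha>\<^sub>0) 1 0 + mono2 (if n = 4 then coeff a 1 else 0) 2 1 +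
      mono2 (coeff b 0) 0 (n - 1)))"
    using leading_terms_taylor [OF assms(1,6,13,10)] assms(11) by (simp add: poly_0_coeff_0)
  ultimately show ?thesis by (rule formal_normal_form_theorem)
qed

end
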